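(* Suppose $E=\bigcup_kE_k\subset\mathbb{R}^n$ is a countable union, where the $E_k$ are disjoint cone unrectifiable $F_\sigma$ sets, and let $\mathcal{N}_x:=\mathcal{N}(E_k,x)\cap\overline{B}(0,1)$ when $x\in E_k$. Then there is a Lipschitz function $f:\mathbb{R}^n\to\mathbb{R}$ such that (1) $f$ is differentiable at every $x\in\mathbb{R}^n\setminus E$; (2) for every $x\in E$ there is $c>0$ such that for every $y\in\mathbb{R}^n$, $$D^+f(x;y)-D_+f(x;y)\ge c\sup_{e\in\mathcal{N}_x}\langle e,y\rangle,$$ so, in particular, $f$ is not differentiable at $x$.
   Context: $\mathbb{R}^n$ carries the Euclidean norm $\|\cdot\|$ and inner product $\langle\cdot,\cdot\rangle$; $B(x,r)$ and $\overline{B}(x,r)$ are the open and closed balls; $\mathcal{H}^1$ is one-dimensional Hausdorff measure. Upper and lower directional derivatives: $D^+f(x;y)=\limsup_{t\searrow0}\frac{f(x+ty)-f(x)}{t}$ and $D_+f(x;y)=\liminf_{t\searrow0}\frac{f(x+ty)-f(x)}{t}$. Width. For $e\in\mathbb{R}^n\setminus\{0\}$ and $\alpha\in(0,1]$ let $C_{e,\alpha}=\{x\in\mathbb{R}^n:\langle x,e\rangle\ge\alpha\|x\|\|e\|\}$ and let $\Gamma_{e,\alpha}$ be the set of Lipschitz curves $\gamma:\mathbb{R}\to\mathbb{R}^n$ such that $\gamma'(t)\in C_{e,\alpha}$ for almost every $t\in\mathbb{R}$. For open $G\subset\mathbb{R}^n$ let $w_{e,\alpha}(G)=\sup\{\mathcal{H}^1(G\cap\gamma(\mathbb{R})):\gamma\in\Gamma_{e,\alpha}\}$,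 and for arbitrary $E\subset\mathbb{R}^n$ let $w_{e,\alpha}(E)=\inf\{w_{e,\alpha}(G):G\supset E,\ G\text{ open}\}$. When $e=0$ or $\alpha>1$, $w_{e,\alpha}(E)=0$ for every $E\subset\mathbb{R}^n$. For $x\in E\subset\mathbb{R}^n$ let $\mathcal{N}(E,x)=\{e\in\mathbb{R}^n:(\forall\varepsilon>0)(\exists r>0)\ w_{e,\varepsilon}(B(x,r)\cap E)=0\}$. A set $E\subset\mathbb{R}^n$ is cone unrectifiable if $\mathcal{N}(E,x)\neq\{0\}$ for every $x\in E$. *)

theory Defs
  imports "HOL-Analysis.Analysis"
begin

(* Coverings by sets of diameter at most delta.  Boundedness is required explicitly because the
   real-valued library function diameter is unspecified on unbounded sets. *)
definition hausdorff1_delta :: "real \<Rightarrow> 'a::metric_space set \<Rightarrow> ennreal" where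
  "hausdorff1_delta \<delta> S =
     (INF A \<in> {A :: nat \<Rightarrow> 'a set. S \<subseteq> (\<Union>i. A i) \<and> (\<forall>i. bounded (A i) \<and> diameter (A i) \<le> \<delta>)}.
        \<Sum>i. ennreal (diameter (A i)))"

definition hausdorff1 :: "'a::metric_space set \<Rightarrow> ennreal" where
  "hausdorff1 S = (SUP \<delta> \<in> {0<..}. hausdorff1_delta \<delta> S)"

definition dir_cone :: "'a::euclidean_space \<Rightarrow> real \<Rightarrow> 'a set" where
  "dir_cone e \<alpha> = {x. x \<bullet> e \<ge> \<alpha> * norm x * norm e}"

definition cone_curves :: "'a::euclidean_space \<Rightarrow> real \<Rightarrow> (real \<Rightarrow> 'a) set" where
  "cone_curves e \<alpha> =
     {\<gamma>. (\<exists>L. L-lipschitz_on UNIV \<gamma>) \<and>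
         (AE t in lebesgue. \<exists>v \<in> dir_cone e \<alpha>. (\<gamma> has_vector_derivative v) (at t))}"

definition width_open :: "'a::euclidean_space \<Rightarrow> real \<Rightarrow> 'a set \<Rightarrow> ennreal" where
  "width_open e \<alpha> G = (SUP \<gamma> \<in> cone_curves e \<alpha>. hausdorff1 (G \<inter> range \<gamma>))"

(* Only positive alpha are meaningful here.  For open S, monotonicity of width_open makes the
   infimum equal to width_open e alpha S (for nonzero e and alpha at most 1). *)
definition width :: "'a::euclidean_space \<Rightarrow> real \<Rightarrow> 'a set \<Rightarrow> ennreal" where
  "width e \<alpha> S =
     (if e = 0 \<or> \<alpha> > 1 then 0 else (INF G \<in> {G. open G \<and> S \<subseteq> G}. width_open e \<alpha> G))"

definition null_dirs :: "'a::euclidean_space set \<Rightarrow> 'a \<Rightarrow> 'a set" where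
  "null_dirs S x = {e. \<forall>\<epsilon>>0. \<exists>r>0. width e \<epsilon> (ball x r \<inter> S) = 0}"

definition cone_unrectifiable :: "'a::euclidean_space set \<Rightarrow> bool" where
  "cone_unrectifiable S \<longleftrightarrow> (\<forall>x\<in>S. null_dirs S x \<noteq> {0})"

definition upper_dir_deriv :: "('a::real_normed_vector \<Rightarrow> real) \<Rightarrow> 'a \<Rightarrow> 'a \<Rightarrow> ereal" where
  "upper_dir_deriv f x y = Limsup (at_right 0) (\<lambda>t. ereal ((f (x + t *\<^sub>R y) - f x) / t))"

definition lower_dir_deriv :: "('a::real_normed_vector \<Rightarrow> real) \<Rightarrow> 'a \<Rightarrow> 'a \<Rightarrow> ereal" where
  "lower_dir_deriv f x y = Liminf (at_right 0) (\<lambda>t. ereal ((f (x + t *\<^sub>R y) - f x) / t))"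

end

theory Submission
  imports Defs
begin

text \<open>
  An F-sigma set is a disjoint union of countably many sets of the form closed \<open>\<inter>\<close> open, and
  functions belonging to disjoint pieces can be added with summable weights, since off its own piece
  each of them is differentiable. So let \<open>E = F \<inter> U\<close> with \<open>F\<close> closed and \<open>U\<close> open.

  If a compact part of \<open>E\<close> has zero width for the unit direction \<open>e\<close> and aperture \<open>\<alpha>\<close>, it has a
  neighbourhood \<open>G\<close> in which all cone curves spend little time. The supremum of this time over curves
  ending at \<open>x\<close>, regularised along \<open>e\<close>, is a uniformly small function whose gradient is within
  \<open>\<alpha> / (1 - \<alpha>)\<close> of \<open>e\<close> inside \<open>G\<close>. Localised and mollified, it yields layers: tiny differentiable
  functions, supported near \<open>E\<close>, whose gradient near \<open>E\<close> is close to a prescribed field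
  \<open>v = \<Sum> \<psi>\<^sub>i e\<^sub>i\<close>, with an error proportional to \<open>\<alpha> \<Sum> \<psi>\<^sub>i\<close>.

  The function \<open>f\<close> is a sum of layers with fields \<open>v\<^sub>0, -v\<^sub>0, v\<^sub>1, -v\<^sub>1, \<dots>\<close>, each supported in the
  region where the gradient of the previous sum is controlled and much smaller than the scales at
  which the previous ones look linear. Off \<open>E\<close> the sum is locally finite. At \<open>x \<in> E\<close> the difference
  quotients at consecutive scales differ by about \<open>v\<^sub>k x\<close>. For each aperture \<open>\<alpha>\<close> the weights are spread
  over shells adding up to at most 1, so that the errors at a point are summable, while one shell
  always has weight at least 1/2. Hence every \<open>e\<close> in the null directions of \<open>E\<close> at \<open>x\<close> is approached
  by infinitely many \<open>v\<^sub>k x / \<psi>\<^sub>k x\<close> with \<open>\<psi>\<^sub>k x \<ge> 1/2\<close>.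
\<close>

section \<open>Cone curves and null sets\<close>

text \<open>Parametrising by height turns the time spent in a set into a Lebesgue measure on the
  line and lets curves through a common point be spliced. For unit \<open>e\<close>, the derivative
  \<open>v\<close> of such a curve satisfies \<open>v \<bullet> e = 1\<close> and
  \<open>\<alpha> * norm v \<le> 1\<close> almost everywhere.\<close>

definition graph_curves :: "'a::euclidean_space \<Rightarrow> real \<Rightarrow> (real \<Rightarrow> 'a) set" where
  "graph_curves e \<alpha> = {\<gamma> \<in> cone_curves e \<alpha>. \<forall>t. \<gamma> t \<bullet> e = t}"

text \<open>The projection onto the line of \<open>e\<close> is 1-Lipschitz, so each covering set
  has its image in an interval no longer than its diameter. Coverings at the single scale 1 are
  enough, because \<open>hausdorff1\<close> is a supremum over scales.\<close>

lemma measure_projection_le_hausdorff1: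
  fixes S :: "'a::euclidean_space set"
  assumes e: "norm e = 1" and A: "A \<in> sets lborel" and sub: "\<And>t. t \<in> A \<Longrightarrow> \<exists>x\<in>S. x \<bullet> e = t"
  shows "emeasure lborel A \<le> hausdorff1 S"
proof -
  have "emeasure lborel A \<le> (\<Sum>i. ennreal (diameter (C i)))"
    if C: "S \<subseteq> (\<Union>i. C i)" "\<forall>i. bounded (C i) \<and> diameter (C i) \<le> 1" for C :: "nat \<Rightarrow> 'a set"
  proof -
    define J where "J i = (if C i = {} then {} else
       {(INF x\<in>C i. x \<bullet> e) .. (SUP x\<in>C i. x \<bullet> e)})" for i
    have bb: "bounded ((\<lambda>x. x \<bullet> e) ` C i)" for i
      using C(2) by (intro bounded_linear_image bounded_linear_inner_left) auto
    have bnds: "bdd_above ((\<lambda>x. x \<bullet> e) ` C i)" "bdd_below ((\<lambda>x. x \<bullet> e) ` C i)" for i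
      using bb[of i] by (auto intro: bounded_imp_bdd_above bounded_imp_bdd_below)
    have "A \<subseteq> (\<Union>i. J i)"
    proof
      fix t assume "t \<in> A"
      then obtain x where x: "x \<in> S" "x \<bullet> e = t" using sub by blast
      then obtain i where i: "x \<in> C i" using C(1) by blast
      have "t \<in> J i"
        using i x(2) bnds[of i] by (auto simp: J_def intro!: cINF_lower cSUP_upper)
      then show "t \<in> (\<Union>i. J i)" by blast
    qed
    then have "emeasure lborel A \<le> emeasure lborel (\<Union>i. J i)"
      by (rule emeasure_mono) (auto simp: J_def)
    also have "\<dots> \<le> (\<Sum>i. emeasure lborel (J i))"
      by (rule emeasure_subadditive_countably) (auto simp: J_def)
    also have "\<dots> \<le> (\<Sum>i. ennreal (diameter (C i)))"
    proof (rule suminf_le)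
      fix i
      show "emeasure lborel (J i) \<le> ennreal (diameter (C i))"
      proof (cases "C i = {}")
        case False
        have "(SUP x\<in>C i. x \<bullet> e) \<le> (INF x\<in>C i. x \<bullet> e) + diameter (C i)"
        proof (rule cSUP_least[OF False])
          fix x assume x: "x \<in> C i"
          have "x \<bullet> e - diameter (C i) \<le> (INF x\<in>C i. x \<bullet> e)"
          proof (rule cINF_greatest[OF False])
            fix y assume y: "y \<in> C i"
            have "(x - y) \<bullet> e \<le> norm (x - y) * norm e" by (rule norm_cauchy_schwarz)
            also have "\<dots> \<le> diameter (C i)"
              using diameter_bounded_bound[of "C i" x y] C(2) x y e by (simp add: dist_norm)
            finally show "x \<bullet> e - diameter (C i) \<le> y \<bullet> e" by (simp add: inner_diff_left)
          qed
          then show "x \<bullet> e \<le> (INF x\<in>C i. x \<bullet> e) + diameter (C i)" by simp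
        qed
        then show ?thesis
          using diameter_ge_0[of "C i"] C(2) False
          by (auto simp: J_def emeasure_lborel_Icc_eq intro!: ennreal_leI)
      qed (simp add: J_def)
    qed auto
    finally show ?thesis .
  qed
  then have "emeasure lborel A \<le> hausdorff1_delta 1 S"
    unfolding hausdorff1_delta_def by (intro INF_greatest) auto
  also have "\<dots> \<le> hausdorff1 S"
    unfolding hausdorff1_def by (rule SUP_upper) auto
  finally show ?thesis .
qed

lemma graph_curves_lipschitz: "\<gamma> \<in> graph_curves e \<alpha> \<Longrightarrow> \<exists>L. L-lipschitz_on UNIV \<gamma>"
  by (simp add: graph_curves_def cone_curves_def)

lemma graph_curves_measurable:
  assumes "\<gamma> \<in> graph_curves e \<alpha>" "open G"
  shows "{t. \<gamma> t \<in> G} \<in> sets borel"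
proof -
  obtain L where "L-lipschitz_on UNIV \<gamma>" using graph_curves_lipschitz[OF assms(1)] by blast
  then have "continuous_on UNIV \<gamma>" by (rule lipschitz_on_continuous_on)
  then have "open (\<gamma> -` G)" using assms(2) by (simp add: continuous_on_open_vimage)
  then show ?thesis by (simp add: vimage_def)
qed

lemma graph_curves_line:
  assumes e: "norm e = 1" and w: "w \<bullet> e = 1" "\<alpha> * norm w \<le> 1"
  shows "(\<lambda>t. x + (t - x \<bullet> e) *\<^sub>R w) \<in> graph_curves e \<alpha>"
proof -
  have "(norm w)-lipschitz_on UNIV (\<lambda>t. x + (t - x \<bullet> e) *\<^sub>R w)"
    by (rule lipschitz_onI)
       (auto simp: dist_norm algebra_simps simp flip: scaleR_left_diff_distrib)
  moreover have "((\<lambda>t. x + (t - x \<bullet> e) *\<^sub>R w) has_vector_derivative w) (at t)" for t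
    by (auto intro!: derivative_eq_intros simp: has_vector_derivative_def)
  moreover have "w \<in> dir_cone e \<alpha>" using assms by (simp add: dir_cone_def)
  ultimately show ?thesis
    using w by (auto simp: graph_curves_def cone_curves_def inner_add_left)
qed

text \<open>Replacing the part after time \<open>s\<close> by a ray in the cone creates only one new
  exceptional time, \<open>s\<close> itself, which is a null set.\<close>

lemma graph_curves_extend:
  assumes e: "norm e = 1" and w: "w \<bullet> e = 1" "\<alpha> * norm w \<le> 1" and \<gamma>: "\<gamma> \<in> graph_curves e \<alpha>"
  shows "(\<lambda>t. if t \<le> s then \<gamma> t else \<gamma> s + (t - s) *\<^sub>R w) \<in> graph_curves e \<alpha>" (is "?\<gamma> \<in> _")
proof -
  obtain L where L: "L-lipschitz_on UNIV \<gamma>" using graph_curves_lipschitz[OF \<gamma>] by blast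
  have L0: "L \<ge> 0" using L lipschitz_on_nonneg by blast
  have LD: "norm (\<gamma> a - \<gamma> b) \<le> L * \<bar>a - b\<bar>" for a b
    using lipschitz_on_normD[OF L, of a b] by simp
  define M where "M = L + norm w"
  have ord: "norm (?\<gamma> a - ?\<gamma> b) \<le> M * \<bar>a - b\<bar>" if "a \<le> b" for a b
  proof -
    consider "b \<le> s" | "a \<le> s" "s < b" | "s < a" using that by linarith
    then show ?thesis
    proof cases
      case 1
      have "L * \<bar>a - b\<bar> \<le> M * \<bar>a - b\<bar>" unfolding M_def by (intro mult_right_mono) auto
      then show ?thesis using 1 that LD[of a b] by auto
    next
      case 2
      have "norm (?\<gamma> a - ?\<gamma> b) = norm ((\<gamma> a - \<gamma> s) - (b - s) *\<^sub>R w)" using 2 by (simp add: algebra_simps)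
      also have "\<dots> \<le> norm (\<gamma> a - \<gamma> s) + norm ((b - s) *\<^sub>R w)" by (rule norm_triangle_ineq4)
      also have "\<dots> \<le> L * \<bar>a - s\<bar> + \<bar>b - s\<bar> * norm w" using LD[of a s] by simp
      also have "\<dots> \<le> L * \<bar>a - b\<bar> + \<bar>a - b\<bar> * norm w"
        using 2 L0 by (intro add_mono mult_left_mono mult_right_mono) auto
      finally show ?thesis by (simp add: M_def algebra_simps)
    next
      case 3
      have "?\<gamma> a - ?\<gamma> b = (a - b) *\<^sub>R w" using 3 that by (simp add: algebra_simps)
      then have "norm (?\<gamma> a - ?\<gamma> b) = \<bar>a - b\<bar> * norm w" by simp
      also have "\<dots> \<le> M * \<bar>a - b\<bar>" using L0 by (simp add: M_def algebra_simps)
      finally show ?thesis .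
    qed
  qed
  have "M-lipschitz_on UNIV ?\<gamma>"
  proof (rule lipschitz_onI)
    fix a b :: real
    show "dist (?\<gamma> a) (?\<gamma> b) \<le> M * dist a b"
      using ord[of a b] ord[of b a]
      by (cases "a \<le> b") (simp_all add: dist_norm norm_minus_commute abs_minus_commute)
  qed (use L0 in \<open>simp add: M_def\<close>)
  moreover have "AE t in lebesgue. \<exists>v \<in> dir_cone e \<alpha>. (?\<gamma> has_vector_derivative v) (at t)"
  proof -
    have 1: "AE t in lebesgue. \<exists>v \<in> dir_cone e \<alpha>. (\<gamma> has_vector_derivative v) (at t)"
      using \<gamma> by (simp add: graph_curves_def cone_curves_def)
    have 2: "AE t in lebesgue. t \<noteq> s"
      using AE_lborel_singleton[of s] by (rule AE_completion)
    from 1 2 show ?thesis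
    proof eventually_elim
      case (elim t)
      show ?case
      proof (cases "t < s")
        case True
        from elim obtain v where v: "v \<in> dir_cone e \<alpha>" "(\<gamma> has_vector_derivative v) (at t)" by blast
        have "(?\<gamma> has_vector_derivative v) (at t)"
          by (rule has_vector_derivative_transform_within_open[OF v(2), of "{..<s}"])
             (use True in auto)
        then show ?thesis using v(1) by blast
      next
        case False
        then have t: "s < t" using elim by simp
        have d: "((\<lambda>t. \<gamma> s + (t - s) *\<^sub>R w) has_vector_derivative w) (at t)"
          by (auto intro!: derivative_eq_intros simp: has_vector_derivative_def)
        have "(?\<gamma> has_vector_derivative w) (at t)"
          by (rule has_vector_derivative_transform_within_open[OF d, of "{s<..}"]) (use t in auto)
        moreover have "w \<in> dir_cone e \<alpha>" using assms by (simp add: dir_cone_def)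
        ultimately show ?thesis by blast
      qed
    qed
  qed
  moreover have "?\<gamma> t \<bullet> e = t" for t
    using \<gamma> w by (simp add: graph_curves_def inner_add_left)
  ultimately show ?thesis by (auto simp: graph_curves_def cone_curves_def)
qed

text \<open>This is what is kept of zero width. Stated through times on height-parametrised curves,
  it passes to finite unions by subadditivity of Lebesgue measure.\<close>

definition cone_null :: "'a::euclidean_space \<Rightarrow> real \<Rightarrow> 'a set \<Rightarrow> bool" where
  "cone_null e \<alpha> S \<longleftrightarrow> (\<forall>\<epsilon>>0. \<exists>G. open G \<and> S \<subseteq> G \<and>
     (\<forall>\<gamma>\<in>graph_curves e \<alpha>. emeasure lborel {t. \<gamma> t \<in> G} \<le> ennreal \<epsilon>))"

lemma cone_null_empty: "cone_null e \<alpha> {}"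
  unfolding cone_null_def by (auto intro!: exI[of _ "{}"])

lemma cone_null_subset: "cone_null e \<alpha> T \<Longrightarrow> S \<subseteq> T \<Longrightarrow> cone_null e \<alpha> S"
  unfolding cone_null_def by (meson subset_trans)

lemma cone_null_Un:
  assumes "cone_null e \<alpha> S" "cone_null e \<alpha> T"
  shows "cone_null e \<alpha> (S \<union> T)"
  unfolding cone_null_def
proof (intro allI impI)
  fix \<epsilon> :: real assume "\<epsilon> > 0"
  then have \<epsilon>: "\<epsilon> / 2 > 0" by simp
  obtain G H where G: "open G" "S \<subseteq> G" "\<And>\<gamma>. \<gamma>\<in>graph_curves e \<alpha> \<Longrightarrow> emeasure lborel {t. \<gamma> t \<in> G} \<le> ennreal (\<epsilon>/2)"
    and H: "open H" "T \<subseteq> H" "\<And>\<gamma>. \<gamma>\<in>graph_curves e \<alpha> \<Longrightarrow> emeasure lborel {t. \<gamma> t \<in> H} \<le> ennreal (\<epsilon>/2)"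
    using assms \<epsilon> unfolding cone_null_def by metis
  have "emeasure lborel {t. \<gamma> t \<in> G \<union> H} \<le> ennreal \<epsilon>" if \<gamma>: "\<gamma> \<in> graph_curves e \<alpha>" for \<gamma>
  proof -
    have "{t. \<gamma> t \<in> G \<union> H} = {t. \<gamma> t \<in> G} \<union> {t. \<gamma> t \<in> H}" by auto
    then have "emeasure lborel {t. \<gamma> t \<in> G \<union> H} \<le> emeasure lborel {t. \<gamma> t \<in> G} + emeasure lborel {t. \<gamma> t \<in> H}"
      using graph_curves_measurable[OF \<gamma>] G(1) H(1) by (auto intro!: emeasure_subadditive)
    also have "\<dots> \<le> ennreal (\<epsilon>/2) + ennreal (\<epsilon>/2)" using G(3) H(3) \<gamma> by (intro add_mono) auto
    also have "\<dots> = ennreal \<epsilon>" using \<epsilon> by (simp flip: ennreal_plus)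
    finally show ?thesis .
  qed
  then show "\<exists>G. open G \<and> S \<union> T \<subseteq> G \<and>
     (\<forall>\<gamma>\<in>graph_curves e \<alpha>. emeasure lborel {t. \<gamma> t \<in> G} \<le> ennreal \<epsilon>)"
    using G(1,2) H(1,2) by (intro exI[of _ "G \<union> H"]) auto
qed

lemma cone_null_UN:
  assumes "finite F" "\<And>i. i \<in> F \<Longrightarrow> cone_null e \<alpha> (S i)"
  shows "cone_null e \<alpha> (\<Union>i\<in>F. S i)"
  using assms by (induction F rule: finite_induct) (auto simp: cone_null_empty cone_null_Un)

lemma width_zero_imp_cone_null:
  fixes e :: "'a::euclidean_space"
  assumes e: "norm e = 1" and \<alpha>: "\<alpha> \<le> 1" and w: "width e \<alpha> S = 0"
  shows "cone_null e \<alpha> S"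
  unfolding cone_null_def
proof (intro allI impI)
  fix \<epsilon> :: real assume \<epsilon>: "\<epsilon> > 0"
  have "(INF G \<in> {G. open G \<and> S \<subseteq> G}. width_open e \<alpha> G) = 0"
    using w e \<alpha> by (auto simp: width_def split: if_splits)
  then have "(INF G \<in> {G. open G \<and> S \<subseteq> G}. width_open e \<alpha> G) < ennreal \<epsilon>" using \<epsilon> by simp
  then obtain G where G: "open G" "S \<subseteq> G" "width_open e \<alpha> G < ennreal \<epsilon>"
    by (auto simp: INF_less_iff)
  have "emeasure lborel {t. \<gamma> t \<in> G} \<le> ennreal \<epsilon>" if \<gamma>: "\<gamma> \<in> graph_curves e \<alpha>" for \<gamma>
  proof -
    \<comment> \<open>The set of times is the projection of \<open>G \<inter> range \<gamma>\<close>
      onto the line of \<open>e\<close>.\<close>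
    have "emeasure lborel {t. \<gamma> t \<in> G} \<le> hausdorff1 (G \<inter> range \<gamma>)"
      by (rule measure_projection_le_hausdorff1[OF e])
         (use \<gamma> graph_curves_measurable[OF \<gamma> G(1)] in \<open>auto simp: graph_curves_def\<close>)
    also have "\<dots> \<le> width_open e \<alpha> G"
      unfolding width_open_def by (rule SUP_upper) (use \<gamma> in \<open>simp add: graph_curves_def\<close>)
    finally show ?thesis using G(3) by simp
  qed
  then show "\<exists>G. open G \<and> S \<subseteq> G \<and> (\<forall>\<gamma>\<in>graph_curves e \<alpha>. emeasure lborel {t. \<gamma> t \<in> G} \<le> ennreal \<epsilon>)"
    using G by blast
qed

section \<open>The width function\<close>

definition curve_potential :: "'a::euclidean_space \<Rightarrow> real \<Rightarrow> 'a set \<Rightarrow> 'a \<Rightarrow> real" where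
  "curve_potential e \<alpha> G x =
     (SUP \<gamma> \<in> {\<gamma> \<in> graph_curves e \<alpha>. \<gamma> (x \<bullet> e) = x}. measure lborel {t. t \<le> x \<bullet> e \<and> \<gamma> t \<in> G})"

context
  fixes e :: "'a::euclidean_space" and \<alpha> \<epsilon> :: real and G :: "'a set"
  assumes e: "norm e = 1" and \<alpha>: "0 < \<alpha>" "\<alpha> < 1" and G: "open G" and \<epsilon>: "\<epsilon> \<ge> 0"
    and small: "\<And>\<gamma>. \<gamma> \<in> graph_curves e \<alpha> \<Longrightarrow> emeasure lborel {t. \<gamma> t \<in> G} \<le> ennreal \<epsilon>"
begin

lemma unit_inner_self: "e \<bullet> e = 1" using e by (simp add: dot_square_norm)

lemma curves_through_nonempty: "{\<gamma> \<in> graph_curves e \<alpha>. \<gamma> (x \<bullet> e) = x} \<noteq> {}"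
  using graph_curves_line[OF e unit_inner_self, of \<alpha> x] e \<alpha> by auto

lemma trace_sets:
  assumes "\<gamma> \<in> graph_curves e \<alpha>"
  shows "{t. t \<le> a \<and> \<gamma> t \<in> G} \<in> sets lborel"
proof -
  have "{t. t \<le> a \<and> \<gamma> t \<in> G} = {..a} \<inter> {t. \<gamma> t \<in> G}" by auto
  then show ?thesis using graph_curves_measurable[OF assms G] by simp
qed

lemma trace_finite:
  assumes "\<gamma> \<in> graph_curves e \<alpha>"
  shows "emeasure lborel {t. t \<le> a \<and> \<gamma> t \<in> G} \<le> ennreal \<epsilon>"
proof -
  have "emeasure lborel {t. t \<le> a \<and> \<gamma> t \<in> G} \<le> emeasure lborel {t. \<gamma> t \<in> G}"
    by (rule emeasure_mono) (use graph_curves_measurable[OF assms G] in auto)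
  then show ?thesis using small[OF assms] by simp
qed

lemma trace_le:
  assumes "\<gamma> \<in> graph_curves e \<alpha>"
  shows "measure lborel {t. t \<le> a \<and> \<gamma> t \<in> G} \<le> \<epsilon>"
  using trace_finite[OF assms, of a] \<epsilon> by (simp add: measure_def enn2real_leI)

lemma trace_bdd: "bdd_above ((\<lambda>\<gamma>. measure lborel {t. t \<le> x \<bullet> e \<and> \<gamma> t \<in> G}) ` {\<gamma> \<in> graph_curves e \<alpha>. \<gamma> (x \<bullet> e) = x})"
  by (rule bdd_aboveI[of _ \<epsilon>]) (use trace_le in auto)

lemma curve_potential_bounds: "0 \<le> curve_potential e \<alpha> G x" "curve_potential e \<alpha> G x \<le> \<epsilon>"
proof -
  obtain \<gamma> where \<gamma>: "\<gamma> \<in> {\<gamma> \<in> graph_curves e \<alpha>. \<gamma> (x \<bullet> e) = x}" using curves_through_nonempty by blast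
  have "0 \<le> measure lborel {t. t \<le> x \<bullet> e \<and> \<gamma> t \<in> G}" by simp
  also have "\<dots> \<le> curve_potential e \<alpha> G x"
    unfolding curve_potential_def by (rule cSUP_upper[OF \<gamma> trace_bdd])
  finally show "0 \<le> curve_potential e \<alpha> G x" .
  show "curve_potential e \<alpha> G x \<le> \<epsilon>"
    unfolding curve_potential_def by (rule cSUP_least[OF curves_through_nonempty]) (use trace_le in auto)
qed

text \<open>Continue a curve ending at \<open>x\<close> along the ray in direction \<open>w\<close>.
  Its earlier time in \<open>G\<close> and the time set \<open>B\<close> on the ray are disjoint,
  and both count towards the potential of the endpoint.\<close>

lemma curve_potential_step:
  assumes w: "w \<bullet> e = 1" "\<alpha> * norm w \<le> 1" and t: "t \<ge> 0"
    and B: "B \<subseteq> {0<..t}" "B \<in> sets lborel" "\<And>s. s \<in> B \<Longrightarrow> x + s *\<^sub>R w \<in> G"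
  shows "curve_potential e \<alpha> G x + measure lborel B \<le> curve_potential e \<alpha> G (x + t *\<^sub>R w)"
proof -
  have "curve_potential e \<alpha> G x \<le> curve_potential e \<alpha> G (x + t *\<^sub>R w) - measure lborel B"
    unfolding curve_potential_def[of _ _ _ x]
  proof (rule cSUP_least[OF curves_through_nonempty])
    fix \<gamma> assume \<gamma>: "\<gamma> \<in> {\<gamma> \<in> graph_curves e \<alpha>. \<gamma> (x \<bullet> e) = x}"
    define a where "a = x \<bullet> e"
    define \<beta> where "\<beta> = (\<lambda>s. if s \<le> a then \<gamma> s else \<gamma> a + (s - a) *\<^sub>R w)"
    define y where "y = x + t *\<^sub>R w"
    have ye: "y \<bullet> e = a + t" using w by (simp add: y_def a_def inner_add_left)
    have \<beta>: "\<beta> \<in> graph_curves e \<alpha>" unfolding \<beta>_def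
      by (rule graph_curves_extend[OF e w]) (use \<gamma> in auto)
    have \<beta>after: "\<beta> s = x + (s - a) *\<^sub>R w" if "s \<ge> a" for s
      using that \<gamma> by (cases "s = a") (simp_all add: \<beta>_def a_def)
    have \<beta>y: "\<beta> (y \<bullet> e) = y" using \<beta>after[of "a + t"] t unfolding ye by (simp add: y_def)
    \<comment> \<open>\<open>B\<close> counts time from the start of the ray, which the spliced
      curve reaches at time \<open>a\<close>.\<close>
    define B' where "B' = (+) a ` B"
    have fin: "emeasure lborel S < \<infinity>" if "S \<subseteq> {s. s \<le> y \<bullet> e \<and> \<beta> s \<in> G}" for S
    proof -
      have "emeasure lborel S \<le> emeasure lborel {s. s \<le> y \<bullet> e \<and> \<beta> s \<in> G}"
        by (rule emeasure_mono[OF that trace_sets[OF \<beta>]])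
      also have "\<dots> \<le> ennreal \<epsilon>" by (rule trace_finite[OF \<beta>])
      finally show ?thesis by (simp add: le_less_trans)
    qed
    have B'eq: "B' = {s. s - a \<in> B}"
      unfolding B'_def by (auto intro!: image_eqI[where x = "_ - a"])
    have B'm: "B' \<in> sets lborel"
    proof -
      have "(\<lambda>s. s - a) \<in> borel_measurable borel" by simp
      then have "(\<lambda>s. s - a) -` B \<inter> space borel \<in> sets borel" using B(2) by (intro measurable_sets) auto
      then show ?thesis by (simp add: B'eq vimage_def)
    qed
    have mB': "measure lborel B' = measure lborel B"
    proof -
      have "measure lborel B' = measure (distr lborel borel ((+) a)) B'" by (simp add: lborel_distr_plus)
      also have "\<dots> = measure lborel ((+) a -` B' \<inter> space lborel)"
        by (rule measure_distr) (use B'm in auto)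
      also have "(+) a -` B' \<inter> space lborel = B" by (auto simp: B'eq)
      finally show ?thesis .
    qed
    let ?A = "{s. s \<le> a \<and> \<gamma> s \<in> G}"
    have sub: "?A \<union> B' \<subseteq> {s. s \<le> y \<bullet> e \<and> \<beta> s \<in> G}"
    proof (rule Un_least; rule subsetI)
      fix s assume "s \<in> ?A"
      then show "s \<in> {s. s \<le> y \<bullet> e \<and> \<beta> s \<in> G}" using t by (simp add: ye \<beta>_def)
    next
      fix s assume "s \<in> B'"
      then have "s - a \<in> B" by (simp add: B'eq)
      moreover from this have "0 < s - a" "s - a \<le> t" using B(1) by auto
      ultimately show "s \<in> {s. s \<le> y \<bullet> e \<and> \<beta> s \<in> G}" using B(3) \<beta>after[of s] by (simp add: ye)
    qed
    have Am: "?A \<in> sets lborel" by (rule trace_sets) (use \<gamma> in auto)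
    have "measure lborel ?A + measure lborel B' = measure lborel (?A \<union> B')"
    proof (rule measure_Union[symmetric])
      show "emeasure lborel ?A \<noteq> \<infinity>" using fin[of ?A] sub by auto
      show "emeasure lborel B' \<noteq> \<infinity>" using fin[of B'] sub by auto
      show "?A \<inter> B' = {}" using B(1) by (auto simp: B'eq)
    qed (use Am B'm in auto)
    also have "\<dots> \<le> measure lborel {s. s \<le> y \<bullet> e \<and> \<beta> s \<in> G}"
      by (rule measure_mono_fmeasurable[OF sub])
         (use Am B'm trace_sets[OF \<beta>] fin[OF subset_refl] in \<open>auto simp: fmeasurable_def\<close>)
    also have "\<dots> \<le> curve_potential e \<alpha> G y"
      unfolding curve_potential_def by (rule cSUP_upper[OF _ trace_bdd]) (use \<beta> \<beta>y in auto)
    finally show "measure lborel {t. t \<le> x \<bullet> e \<and> \<gamma> t \<in> G} \<le> curve_potential e \<alpha> G (x + t *\<^sub>R w) - measure lborel B"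
      by (simp add: mB' y_def a_def)
  qed
  then show ?thesis by simp
qed

lemma curve_potential_mono:
  assumes "w \<bullet> e = 1" "\<alpha> * norm w \<le> 1" "t \<ge> 0"
  shows "curve_potential e \<alpha> G x \<le> curve_potential e \<alpha> G (x + t *\<^sub>R w)"
  using curve_potential_step[OF assms, of "{}" x] by simp

text \<open>The potential may grow faster than rate 1 along \<open>e\<close>. This infimal
  convolution is the largest function below it that does not, and it keeps the monotonicity in cone
  directions.\<close>

definition width_fun :: "'a \<Rightarrow> real" where
  "width_fun x = (INF s\<in>{0..}. curve_potential e \<alpha> G (x - s *\<^sub>R e) + s)"

lemma width_fun_bdd: "bdd_below ((\<lambda>s. curve_potential e \<alpha> G (x - s *\<^sub>R e) + s) ` {0..})"
  by (rule bdd_belowI[of _ 0]) (use curve_potential_bounds(1) in \<open>auto simp: add_nonneg_nonneg\<close>)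

lemma width_fun_le: "s \<ge> 0 \<Longrightarrow> width_fun x \<le> curve_potential e \<alpha> G (x - s *\<^sub>R e) + s"
  unfolding width_fun_def by (rule cINF_lower[OF width_fun_bdd]) auto

lemma width_fun_ge: "(\<And>s. s \<ge> 0 \<Longrightarrow> c \<le> curve_potential e \<alpha> G (x - s *\<^sub>R e) + s) \<Longrightarrow> c \<le> width_fun x"
  unfolding width_fun_def by (rule cINF_greatest) auto

lemma width_fun_bounds: "0 \<le> width_fun x" "width_fun x \<le> \<epsilon>"
  using width_fun_ge[of 0 x] width_fun_le[of 0 x] curve_potential_bounds
  by (auto simp: add_nonneg_nonneg intro: order_trans)

lemma width_fun_mono:
  assumes "w \<bullet> e = 1" "\<alpha> * norm w \<le> 1" "t \<ge> 0"
  shows "width_fun x \<le> width_fun (x + t *\<^sub>R w)"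
proof (rule width_fun_ge)
  fix s :: real assume s: "s \<ge> 0"
  have "width_fun x \<le> curve_potential e \<alpha> G (x - s *\<^sub>R e) + s" by (rule width_fun_le[OF s])
  also have "\<dots> \<le> curve_potential e \<alpha> G ((x - s *\<^sub>R e) + t *\<^sub>R w) + s"
    using curve_potential_mono[OF assms] by simp
  finally show "width_fun x \<le> curve_potential e \<alpha> G (x + t *\<^sub>R w - s *\<^sub>R e) + s"
    by (simp add: algebra_simps)
qed

lemma width_fun_upper:
  assumes t: "t \<ge> 0"
  shows "width_fun (x + t *\<^sub>R e) \<le> width_fun x + t"
proof -
  have "width_fun (x + t *\<^sub>R e) - t \<le> width_fun x"
  proof (rule width_fun_ge)
    fix s :: real assume s: "s \<ge> 0"
    have "width_fun (x + t *\<^sub>R e) \<le> curve_potential e \<alpha> G (x + t *\<^sub>R e - (s + t) *\<^sub>R e) + (s + t)"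
      using s t by (intro width_fun_le) simp
    then show "width_fun (x + t *\<^sub>R e) - t \<le> curve_potential e \<alpha> G (x - s *\<^sub>R e) + s"
      by (simp add: algebra_simps)
  qed
  then show ?thesis by simp
qed

text \<open>For the lower bound, a shift \<open>s \<le> t\<close> ends on the segment inside
  \<open>G\<close>, where the potential has already gained \<open>t - s\<close>; a larger shift ends
  behind \<open>x\<close> and is a shift of \<open>x\<close> by \<open>s - t\<close>.\<close>

lemma width_fun_inside:
  assumes t: "t \<ge> 0" and seg: "\<And>s. 0 \<le> s \<Longrightarrow> s \<le> t \<Longrightarrow> x + s *\<^sub>R e \<in> G"
  shows "width_fun (x + t *\<^sub>R e) = width_fun x + t"
proof (rule antisym[OF width_fun_upper[OF t]])
  show "width_fun x + t \<le> width_fun (x + t *\<^sub>R e)"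
  proof (rule width_fun_ge)
    fix s :: real assume s: "s \<ge> 0"
    show "width_fun x + t \<le> curve_potential e \<alpha> G (x + t *\<^sub>R e - s *\<^sub>R e) + s"
    proof (cases "s \<le> t")
      case True
      have "width_fun x \<le> curve_potential e \<alpha> G x" using width_fun_le[of 0 x] by simp
      moreover have "curve_potential e \<alpha> G x + measure lborel {0<..t-s} \<le> curve_potential e \<alpha> G (x + (t - s) *\<^sub>R e)"
        by (rule curve_potential_step[OF unit_inner_self]) (use True e \<alpha> seg s in auto)
      ultimately show ?thesis using True by (simp add: algebra_simps)
    next
      case False
      then show ?thesis using width_fun_le[of "s - t" x] by (simp add: algebra_simps)
    qed
  qed
qed

text \<open>Tilting \<open>u\<close> by a multiple of \<open>e\<close> gives a cone direction, along
  which \<open>width_fun\<close> does not decrease; undoing the tilt costs at most its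
  length.\<close>

lemma width_fun_orthogonal_le:
  assumes u: "u \<bullet> e = 0"
  shows "width_fun x \<le> width_fun (x + u) + \<alpha> / (1 - \<alpha>) * norm u"
proof (cases "u = 0")
  case False
  \<comment> \<open>With this \<open>t\<close> the vector \<open>w\<close> below has norm at most
    \<open>1 + (1 - \<alpha>) / \<alpha> = 1 / \<alpha>\<close>, so it lies in the cone.\<close>
  define t where "t = \<alpha> / (1 - \<alpha>) * norm u"
  have t: "t > 0" using False \<alpha> by (simp add: t_def)
  define w where "w = e + (1 / t) *\<^sub>R u"
  have we: "w \<bullet> e = 1" using u unit_inner_self by (simp add: w_def inner_add_left)
  have "norm w \<le> norm e + norm ((1 / t) *\<^sub>R u)" unfolding w_def by (rule norm_triangle_ineq)
  also have "\<dots> = 1 / \<alpha>" using t False \<alpha> e by (simp add: t_def field_simps)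
  finally have "\<alpha> * norm w \<le> 1" using \<alpha> by (simp add: field_simps)
  from width_fun_mono[OF we this, of t x] t
  have "width_fun x \<le> width_fun ((x + u) + t *\<^sub>R e)" by (simp add: w_def algebra_simps)
  also have "\<dots> \<le> width_fun (x + u) + t" using t by (intro width_fun_upper) simp
  finally show ?thesis by (simp add: t_def)
qed simp

lemma width_fun_orthogonal:
  assumes u: "u \<bullet> e = 0"
  shows "\<bar>width_fun (x + u) - width_fun x\<bar> \<le> \<alpha> / (1 - \<alpha>) * norm u"
  using width_fun_orthogonal_le[OF u, of x] width_fun_orthogonal_le[of "-u" "x + u"] u by simp

lemma width_fun_along: "\<bar>width_fun (x + t *\<^sub>R e) - width_fun x\<bar> \<le> \<bar>t\<bar>"
proof -
  have *: "\<bar>width_fun (x + t *\<^sub>R e) - width_fun x\<bar> \<le> t" if "t \<ge> 0" for t x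
    using width_fun_upper[OF that, of x] width_fun_mono[OF unit_inner_self _ that, of x] e \<alpha> by simp
  show ?thesis using *[of t x] *[of "-t" "x + t *\<^sub>R e"] by (cases "t \<ge> 0") simp_all
qed

lemma orthogonal_part:
  fixes d :: 'a
  shows "(d - (d \<bullet> e) *\<^sub>R e) \<bullet> e = 0" "norm (d - (d \<bullet> e) *\<^sub>R e) \<le> norm d"
proof -
  show 1: "(d - (d \<bullet> e) *\<^sub>R e) \<bullet> e = 0" using unit_inner_self by (simp add: inner_diff_left)
  have "(norm d)\<^sup>2 = (norm (d - (d \<bullet> e) *\<^sub>R e))\<^sup>2 + (norm ((d \<bullet> e) *\<^sub>R e))\<^sup>2"
    using norm_add_Pythagorean[of "d - (d \<bullet> e) *\<^sub>R e" "(d \<bullet> e) *\<^sub>R e"] 1 by (simp add: orthogonal_def)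
  then have "(norm (d - (d \<bullet> e) *\<^sub>R e))\<^sup>2 \<le> (norm d)\<^sup>2" by simp
  then show "norm (d - (d \<bullet> e) *\<^sub>R e) \<le> norm d" by (rule power2_le_imp_le) simp
qed

lemma width_fun_lipschitz:
  assumes "\<alpha> \<le> 1/2"
  shows "\<bar>width_fun y - width_fun x\<bar> \<le> 2 * norm (y - x)"
proof -
  define d where "d = y - x"
  define u where "u = d - (d \<bullet> e) *\<^sub>R e"
  have y: "y = (x + u) + (d \<bullet> e) *\<^sub>R e" by (simp add: d_def u_def)
  have "\<bar>width_fun y - width_fun (x + u)\<bar> \<le> \<bar>d \<bullet> e\<bar>" unfolding y by (rule width_fun_along)
  also have "\<dots> \<le> norm d" using Cauchy_Schwarz_ineq2[of d e] e by simp
  finally have 1: "\<bar>width_fun y - width_fun (x + u)\<bar> \<le> norm d" .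
  have "\<bar>width_fun (x + u) - width_fun x\<bar> \<le> \<alpha> / (1 - \<alpha>) * norm u"
    by (rule width_fun_orthogonal) (simp add: u_def orthogonal_part)
  also have "\<dots> \<le> 1 * norm d"
    using orthogonal_part(2)[of d] assms \<alpha> unfolding u_def by (intro mult_mono) auto
  finally show ?thesis using 1 unfolding d_def by linarith
qed

text \<open>Go from \<open>z\<close> to \<open>y\<close> by moving first orthogonally to
  \<open>e\<close> and then parallel to it. The parallel move inside \<open>G\<close> is exact; only
  the orthogonal move causes an error.\<close>

lemma width_fun_affine_inside:
  assumes G': "ball x r \<subseteq> G" and yz: "y \<in> ball x (r/2)" "z \<in> ball x (r/2)"
  shows "\<bar>width_fun y - width_fun z - e \<bullet> (y - z)\<bar> \<le> \<alpha> / (1 - \<alpha>) * norm (y - z)"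
proof -
  define d where "d = y - z"
  define u where "u = d - (d \<bullet> e) *\<^sub>R e"
  have y: "y = (z + u) + (d \<bullet> e) *\<^sub>R e" by (simp add: d_def u_def)
  have zu: "z + u \<in> ball x r"
  proof -
    \<comment> \<open>The corner of the path is the parallel part of \<open>z - x\<close> plus the
      orthogonal part of \<open>y - x\<close>. Each is shorter than \<open>r / 2\<close>, which is
      why the estimate is confined to half the radius.\<close>
    have "z + u - x = ((z - x) \<bullet> e) *\<^sub>R e + ((y - x) - ((y - x) \<bullet> e) *\<^sub>R e)"
      by (simp add: u_def d_def inner_diff_left algebra_simps)
    then have "norm (z + u - x) \<le> norm (((z - x) \<bullet> e) *\<^sub>R e) + norm ((y - x) - ((y - x) \<bullet> e) *\<^sub>R e)"
      by (metis norm_triangle_ineq)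
    also have "\<dots> \<le> norm (z - x) + norm (y - x)"
      using orthogonal_part(2)[of "y - x"] Cauchy_Schwarz_ineq2[of "z - x" e] e by simp
    also have "\<dots> < r" using yz by (simp add: dist_norm norm_minus_commute)
    finally show ?thesis by (simp add: dist_norm norm_minus_commute)
  qed
  have yb: "y \<in> ball x r"
  proof -
    have "0 < r / 2" using yz(1) by (metis ball_eq_empty empty_iff not_le)
    then show ?thesis using yz(1) by simp
  qed
  have conv: "(1 - c) *\<^sub>R (z + u) + c *\<^sub>R y \<in> G" if "0 \<le> c" "c \<le> 1" for c
    using convexD_alt[OF convex_ball zu yb that] G' by blast
  have "width_fun y = width_fun (z + u) + d \<bullet> e"
  proof (cases "d \<bullet> e \<ge> 0")
    case True
    show ?thesis unfolding y
    proof (rule width_fun_inside[OF True])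
      fix s assume s: "0 \<le> s" "s \<le> d \<bullet> e"
      show "z + u + s *\<^sub>R e \<in> G"
      proof (cases "d \<bullet> e = 0")
        case True then show ?thesis using s zu G' by auto
      next
        case False
        then show ?thesis using conv[of "s / (d \<bullet> e)"] s unfolding y by (simp add: algebra_simps)
      qed
    qed
  next
    case False
    \<comment> \<open>For a negative increment the segment is traversed upwards, from
      \<open>y\<close> to the corner.\<close>
    have "width_fun (y + (- (d \<bullet> e)) *\<^sub>R e) = width_fun y + (- (d \<bullet> e))"
    proof (rule width_fun_inside)
      fix s assume s: "0 \<le> s" "s \<le> - (d \<bullet> e)"
      define c where "c = 1 + s / (d \<bullet> e)"
      have c: "0 \<le> c" "c \<le> 1" using s False by (auto simp: c_def divide_simps)
      have "c * (d \<bullet> e) = d \<bullet> e + s" using False by (simp add: c_def field_simps)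
      then have "(1 - c) *\<^sub>R (z + u) + c *\<^sub>R y = y + s *\<^sub>R e"
        unfolding y by (simp add: scaleR_add_right scaleR_add_left scaleR_diff_left)
      then show "y + s *\<^sub>R e \<in> G" using conv[OF c] by simp
    qed (use False in auto)
    then show ?thesis by (simp add: y)
  qed
  moreover have "\<bar>width_fun (z + u) - width_fun z\<bar> \<le> \<alpha> / (1 - \<alpha>) * norm u"
    by (rule width_fun_orthogonal) (simp add: u_def orthogonal_part)
  moreover have "\<alpha> / (1 - \<alpha>) * norm u \<le> \<alpha> / (1 - \<alpha>) * norm d"
    using orthogonal_part(2)[of d] \<alpha> unfolding u_def by (intro mult_left_mono) auto
  ultimately show ?thesis unfolding d_def by (simp add: inner_commute)
qed

end

lemma width_function_exists:
  fixes e :: "'a::euclidean_space"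
  assumes e: "norm e = 1" and \<alpha>: "0 < \<alpha>" "\<alpha> \<le> 1/2" and S: "cone_null e \<alpha> S" and \<epsilon>: "\<epsilon> > 0"
  obtains G \<omega> where "open G" "S \<subseteq> G" "\<And>x. 0 \<le> \<omega> x \<and> \<omega> x \<le> \<epsilon>"
    "\<And>x y. \<bar>\<omega> y - \<omega> x\<bar> \<le> 2 * norm (y - x)"
    "\<And>x y z r. ball x r \<subseteq> G \<Longrightarrow> y \<in> ball x (r/2) \<Longrightarrow> z \<in> ball x (r/2) \<Longrightarrow>
       \<bar>\<omega> y - \<omega> z - e \<bullet> (y - z)\<bar> \<le> \<alpha> / (1 - \<alpha>) * norm (y - z)"
proof -
  obtain G where G: "open G" "S \<subseteq> G"
    "\<And>\<gamma>. \<gamma> \<in> graph_curves e \<alpha> \<Longrightarrow> emeasure lborel {t. \<gamma> t \<in> G} \<le> ennreal \<epsilon>"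
    using S[unfolded cone_null_def, rule_format, OF \<epsilon>] by metis
  have a1: "\<alpha> < 1" using \<alpha> by simp
  note facts = e \<alpha>(1) a1 G(1) less_imp_le[OF \<epsilon>] G(3)
  show thesis
    by (rule that[OF G(1,2), of "width_fun e \<alpha> G"])
       (use width_fun_bounds[OF facts] width_fun_lipschitz[OF facts \<alpha>(2)]
          width_fun_affine_inside[OF facts] in auto)
qed

section \<open>Mollification\<close>

text \<open>Squaring the positive part makes the bump continuously differentiable across the unit
  sphere, which is enough for differentiable layers.\<close>

definition bump :: "'a::euclidean_space \<Rightarrow> real" where
  "bump z = (max 0 (1 - z \<bullet> z))\<^sup>2"

lemma max0_square_derivative: "((\<lambda>u. (max 0 u)\<^sup>2) has_real_derivative 2 * max 0 u) (at u)"
proof -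
  consider "u < 0" | "u > 0" | "u = 0" by linarith
  then show ?thesis
  proof cases
    case 1
    have "((\<lambda>u. 0) has_real_derivative 0) (at u)" by simp
    then show ?thesis
      by (rule has_field_derivative_transform_within_open[of _ _ _ "{..<0}", THEN DERIV_cong]) (use 1 in auto)
  next
    case 2
    have "((\<lambda>u. u\<^sup>2) has_real_derivative 2 * u) (at u)" by (auto intro!: derivative_eq_intros)
    then show ?thesis
      by (rule has_field_derivative_transform_within_open[of _ _ _ "{0<..}", THEN DERIV_cong]) (use 2 in auto)
  next
    case 3
    have "((\<lambda>h. ((max 0 (0 + h))\<^sup>2 - (max 0 0)\<^sup>2) / h) \<longlongrightarrow> 0) (at (0::real))"
    proof (rule Lim_null_comparison)
      show "\<forall>\<^sub>F h in at 0. norm (((max 0 (0 + h))\<^sup>2 - (max 0 0)\<^sup>2) / h) \<le> \<bar>h::real\<bar>"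
        by (auto simp: eventually_at_filter power2_eq_square max_def abs_mult)
      show "((\<lambda>h. \<bar>h::real\<bar>) \<longlongrightarrow> 0) (at 0)" by (intro tendsto_rabs_zero tendsto_ident_at)
    qed
    then show ?thesis using 3 by (simp add: DERIV_def)
  qed
qed

lemma bump_derivative:
  "(bump has_derivative (\<lambda>v. - (4 * max 0 (1 - z \<bullet> z)) * (z \<bullet> v))) (at z)"
proof -
  have "((\<lambda>z. 1 - z \<bullet> z) has_derivative (\<lambda>v. - (2 * (z \<bullet> v)))) (at z)"
    by (auto intro!: derivative_eq_intros simp: inner_commute)
  from has_derivative_compose[OF this max0_square_derivative[unfolded has_field_derivative_def]]
  show ?thesis by (simp add: bump_def[abs_def] algebra_simps)
qed

lemma bump_nonneg: "bump z \<ge> 0" by (simp add: bump_def)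

lemma continuous_on_bump [continuous_intros]:
  "continuous_on S f \<Longrightarrow> continuous_on S (\<lambda>x. bump (f x))"
  unfolding bump_def by (intro continuous_intros)

lemma bump_zero: "norm z \<ge> 1 \<Longrightarrow> bump z = 0"
  by (simp add: bump_def dot_square_norm)

lemma bump_scaled_zero: "h > 0 \<Longrightarrow> norm z \<ge> h \<Longrightarrow> bump ((1/h) *\<^sub>R z) = 0"
  by (rule bump_zero) simp

lemma bump_integrable:
  fixes f :: "'a::euclidean_space \<Rightarrow> real"
  assumes f: "continuous_on UNIV f" and h: "h > 0"
  shows "integrable lborel (\<lambda>w. f w * bump ((1/h) *\<^sub>R (w - x)))"
proof -
  have "integrable lborel (\<lambda>w. indicator (cball x h) w *\<^sub>R (f w * bump ((1/h) *\<^sub>R (w - x))))"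
    by (rule borel_integrable_compact)
       (auto intro!: continuous_intros continuous_on_subset[OF f])
  moreover have "indicator (cball x h) w *\<^sub>R (f w * bump ((1/h) *\<^sub>R (w - x))) = f w * bump ((1/h) *\<^sub>R (w - x))" for w
    using bump_scaled_zero[OF h, of "w - x"] by (auto simp: indicator_def dist_norm norm_minus_commute)
  ultimately show ?thesis by (simp only:)
qed

lemma lborel_integral_shift:
  fixes f :: "'a::euclidean_space \<Rightarrow> real"
  assumes "f \<in> borel_measurable borel"
  shows "(\<integral>w. f (x + w) \<partial>lborel) = (\<integral>w. f w \<partial>lborel)"
proof -
  have "(\<integral>w. f w \<partial>lborel) = (\<integral>w. f w \<partial>(distr lborel borel ((+) x)))" by (simp add: lborel_distr_plus)
  also have "\<dots> = (\<integral>w. f (x + w) \<partial>lborel)" by (rule integral_distr) (use assms in auto)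
  finally show ?thesis by simp
qed

lemma bump_integral_pos:
  assumes "h > 0"
  shows "(\<integral>w. bump ((1/h) *\<^sub>R w) \<partial>(lborel :: 'a::euclidean_space measure)) > 0"
proof -
  have int: "integrable lborel (\<lambda>w::'a. bump ((1/h) *\<^sub>R w))"
    using bump_integrable[of "\<lambda>_. 1" h 0] assms by simp
  have "(\<integral>w. bump ((1/h) *\<^sub>R w) \<partial>(lborel :: 'a measure)) \<noteq> 0"
  proof
    assume "(\<integral>w. bump ((1/h) *\<^sub>R w) \<partial>(lborel :: 'a measure)) = 0"
    then have "AE w in (lborel :: 'a measure). bump ((1/h) *\<^sub>R w) = 0"
      using integral_nonneg_eq_0_iff_AE[OF int] by (simp add: bump_nonneg)
    then have "AE w in lebesgue. w \<in> {w::'a. bump ((1/h) *\<^sub>R w) = 0}"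
      using AE_completion by fastforce
    \<comment> \<open>A closed set of full measure is the whole space, but the bump equals 1 at the
      origin.\<close>
    moreover have "closed {w::'a. bump ((1/h) *\<^sub>R w) = 0}"
      by (intro closed_Collect_eq continuous_intros)
    ultimately have "(0::'a) \<in> {w::'a. bump ((1/h) *\<^sub>R w) = 0}"
      by (metis mem_closed_if_AE_lebesgue)
    then show False by (simp add: bump_def)
  qed
  moreover have "(\<integral>w. bump ((1/h) *\<^sub>R w) \<partial>(lborel :: 'a measure)) \<ge> 0"
    by (rule Bochner_Integration.integral_nonneg) (simp add: bump_nonneg)
  ultimately show ?thesis by simp
qed

text \<open>Translating the variable moves \<open>x\<close> into the kernel, so continuity of
  \<open>f\<close> suffices for differentiating under the integral. For \<open>x\<close> within
  distance 1 of \<open>x0\<close> all kernels live in one box, where the Leibniz rule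
  applies.\<close>

lemma convolution_differentiable:
  fixes f :: "'a::euclidean_space \<Rightarrow> real"
  assumes f: "continuous_on UNIV f" and h: "h > 0"
  shows "(\<lambda>x. \<integral>w. f (x + w) * bump ((1/h) *\<^sub>R w) \<partial>lborel) differentiable (at x0)"
proof -
  have meas: "(\<lambda>w. f w * bump ((1/h) *\<^sub>R (w - x))) \<in> borel_measurable borel" for x
    by (intro borel_measurable_continuous_onI continuous_intros f)
  have eq: "(\<integral>w. f (x + w) * bump ((1/h) *\<^sub>R w) \<partial>lborel) = (\<integral>w. f w * bump ((1/h) *\<^sub>R (w - x)) \<partial>lborel)" for x
    using lborel_integral_shift[OF meas, of x x] by simp
  obtain a b :: 'a where ab: "cball x0 (1 + h) \<subseteq> cbox a b"
    using bounded_subset_cbox_symmetric[OF bounded_cball] by metis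
  define F where "F = (\<lambda>x w. f w * bump ((1/h) *\<^sub>R (w - x)))"
  have cF: "continuous_on S (F x)" for x S
    unfolding F_def by (intro continuous_intros continuous_on_subset[OF f]) auto
  have loc: "(\<integral>w. f w * bump ((1/h) *\<^sub>R (w - x)) \<partial>lborel) = integral (cbox a b) (F x)"
    if x: "x \<in> ball x0 1" for x
  proof -
    have out: "F x w = 0" if "w \<notin> cbox a b" for w
    proof -
      have "w \<notin> cball x0 (1 + h)" using that ab by blast
      then have "norm (w - x0) > 1 + h" by (simp add: dist_norm norm_minus_commute)
      moreover have "norm (w - x0) \<le> norm (w - x) + norm (x - x0)"
        using norm_triangle_ineq[of "w - x" "x - x0"] by simp
      ultimately have "norm (w - x) \<ge> h" using x by (simp add: dist_norm norm_minus_commute)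
      then show ?thesis unfolding F_def using bump_scaled_zero[OF h, of "w - x"] by simp
    qed
    have "(\<integral>w. F x w \<partial>lborel) = integral UNIV (F x)"
      using bump_integrable[OF f h, of x] unfolding F_def
      by (intro integral_lborel[symmetric])
    also have "\<dots> = integral (cbox a b) (F x)"
      by (rule integral_spike_set[symmetric] )
         (use out in \<open>auto intro!: negligible_subset[OF negligible_empty]\<close>)
    finally show ?thesis by (simp add: F_def)
  qed
  define D where "D = (\<lambda>x w. blinfun_scaleR_left (f w * (4 / h\<^sup>2) * max 0 (1 - ((1/h) *\<^sub>R (w - x)) \<bullet> ((1/h) *\<^sub>R (w - x))))
      o\<^sub>L blinfun_inner_left (w - x))"
  have D: "blinfun_apply (D x w) v = f w * (4 / h\<^sup>2) * max 0 (1 - ((1/h) *\<^sub>R (w - x)) \<bullet> ((1/h) *\<^sub>R (w - x))) * (v \<bullet> (w - x))" for x w v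
    by (simp add: D_def mult.commute)
  have "((\<lambda>x. integral (cbox a b) (F x)) has_derivative integral (cbox a b) (D x0)) (at x0 within ball x0 1)"
  proof (rule leibniz_rule)
    fix x w assume "x \<in> ball x0 1" "w \<in> cbox a b"
    have "((\<lambda>x. (1/h) *\<^sub>R (w - x)) has_derivative (\<lambda>v. - ((1/h) *\<^sub>R v))) (at x)"
      by (auto intro!: derivative_eq_intros)
    from has_derivative_compose[OF this bump_derivative]
    have "((\<lambda>x. f w * bump ((1/h) *\<^sub>R (w - x))) has_derivative (\<lambda>v. f w * (- (4 * max 0 (1 - ((1/h) *\<^sub>R (w - x)) \<bullet> ((1/h) *\<^sub>R (w - x)))) * (((1/h) *\<^sub>R (w - x)) \<bullet> (- ((1/h) *\<^sub>R v)))))) (at x)"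
      by (intro has_derivative_mult_right)
    moreover have "(\<lambda>v. f w * (- (4 * max 0 (1 - ((1/h) *\<^sub>R (w - x)) \<bullet> ((1/h) *\<^sub>R (w - x)))) * (((1/h) *\<^sub>R (w - x)) \<bullet> (- ((1/h) *\<^sub>R v))))) = blinfun_apply (D x w)"
      unfolding D by (rule ext) (simp add: inner_commute power2_eq_square)
    ultimately show "((\<lambda>x. F x w) has_derivative blinfun_apply (D x w)) (at x within ball x0 1)"
      unfolding F_def by (simp add: has_derivative_at_withinI)
  next
    fix x show "F x integrable_on cbox a b" by (intro integrable_continuous cF)
  next
    have f2: "continuous_on S (\<lambda>p. f (snd p))" for S :: "('a \<times> 'a) set"
      by (rule continuous_on_compose2[OF f]) (auto intro!: continuous_intros)
    show "continuous_on (ball x0 1 \<times> cbox a b) (\<lambda>(x, t). D x t)"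
      unfolding D_def case_prod_beta by (intro continuous_intros f2)
  qed auto
  then have "((\<lambda>x. integral (cbox a b) (F x)) has_derivative integral (cbox a b) (D x0)) (at x0)"
    using at_within_open[of x0 "ball x0 1"] by (simp only: centre_in_ball open_ball zero_less_one simp_thms)
  then have "((\<lambda>x. \<integral>w. f (x + w) * bump ((1/h) *\<^sub>R w) \<partial>lborel) has_derivative integral (cbox a b) (D x0)) (at x0)"
    by (rule has_derivative_transform_within_open[of _ _ _ _ "ball x0 1"]) (simp_all add: loc eq)
  then show ?thesis unfolding differentiable_def by blast
qed

text \<open>\<open>F\<close> averages translates of \<open>f\<close> with a normalised nonnegative
  kernel. Bounds on values and on the deviation of increments from a constant pass to averages, so
  gradient estimates survive in the form of increments.\<close>

lemma mollification:
  fixes f :: "'a::euclidean_space \<Rightarrow> real"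
  assumes f: "continuous_on UNIV f" and h: "h > 0"
  obtains F :: "'a \<Rightarrow> real" where "\<And>x. F differentiable (at x)"
    "\<And>x c. (\<And>w. norm w < h \<Longrightarrow> \<bar>f (x + w)\<bar> \<le> c) \<Longrightarrow> \<bar>F x\<bar> \<le> c"
    "\<And>y z a c. (\<And>w. norm w < h \<Longrightarrow> \<bar>f (y + w) - f (z + w) - a\<bar> \<le> c) \<Longrightarrow> \<bar>F y - F z - a\<bar> \<le> c"
proof -
  define k where "k = (\<lambda>w::'a. bump ((1/h) *\<^sub>R w))"
  define c where "c = (\<integral>w. k w \<partial>lborel)"
  have c: "c > 0" unfolding c_def k_def by (rule bump_integral_pos[OF h])
  define F where "F x = (\<integral>w. f (x + w) * k w \<partial>lborel) / c" for x
  have int: "integrable lborel (\<lambda>w. g w * k w)" if "continuous_on UNIV g" for g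
    using bump_integrable[OF that h, of 0] by (simp add: k_def)
  have cs: "continuous_on UNIV (\<lambda>w. f (x + w))" for x
    by (rule continuous_on_compose2[OF f]) (auto intro!: continuous_intros)
  have avg: "\<bar>(\<integral>w. g w * k w \<partial>lborel) / c\<bar> \<le> d"
    if g: "continuous_on UNIV g" and b: "\<And>w. norm w < h \<Longrightarrow> \<bar>g w\<bar> \<le> d" for g d
  proof -
    have "\<bar>\<integral>w. g w * k w \<partial>lborel\<bar> \<le> (\<integral>w. d * k w \<partial>lborel)"
    proof (rule integral_abs_bound_integral[OF int[OF g] int])
      fix w
      show "\<bar>g w * k w\<bar> \<le> d * k w"
      proof (cases "norm w < h")
        case True
        then show ?thesis using b[OF True] by (simp add: abs_mult k_def bump_nonneg mult_right_mono)
      next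
        case False
        then have "k w = 0" using bump_scaled_zero[OF h, of w] by (simp add: k_def)
        then show ?thesis by simp
      qed
    qed auto
    also have "\<dots> = d * c" by (simp add: c_def)
    finally show ?thesis using c by (simp add: field_simps)
  qed
  show thesis
  proof (rule that[of F])
    fix x
    show "F differentiable (at x)"
      using convolution_differentiable[OF f h, of x] c unfolding F_def k_def
      by (auto intro!: differentiable_divide)
  next
    fix x d assume "\<And>w. norm w < h \<Longrightarrow> \<bar>f (x + w)\<bar> \<le> d"
    then show "\<bar>F x\<bar> \<le> d" unfolding F_def using avg[OF cs] by blast
  next
    fix y z a d assume b: "\<And>w. norm w < h \<Longrightarrow> \<bar>f (y + w) - f (z + w) - a\<bar> \<le> d"
    have "(\<integral>w. (f (y + w) - f (z + w) - a) * k w \<partial>lborel) =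
       (\<integral>w. f (y + w) * k w - f (z + w) * k w - a * k w \<partial>lborel)"
      by (simp add: left_diff_distrib)
    also have "\<dots> = (\<integral>w. f (y + w) * k w \<partial>lborel) - (\<integral>w. f (z + w) * k w \<partial>lborel) - a * c"
      using int[OF cs] int[of "\<lambda>_. a"] by (simp add: c_def)
    finally have "F y - F z - a = (\<integral>w. (f (y + w) - f (z + w) - a) * k w \<partial>lborel) / c"
      using c by (simp add: F_def field_simps)
    also have "\<bar>\<dots>\<bar> \<le> d" by (rule avg) (use b in \<open>auto intro!: continuous_intros cs\<close>)
    finally show "\<bar>F y - F z - a\<bar> \<le> d" .
  qed
qed

section \<open>Layers\<close>

definition exhaustion :: "'a::euclidean_space set \<Rightarrow> ('a \<Rightarrow> real) \<Rightarrow> bool" where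
  "exhaustion U g \<longleftrightarrow> 1-lipschitz_on UNIV g \<and> (\<forall>x. 0 \<le> g x \<and> g x \<le> 1) \<and>
     (\<forall>x. 0 < g x \<longleftrightarrow> x \<in> U) \<and> (\<forall>s>0. compact {x. s \<le> g x})"

lemma exhaustionD:
  assumes "exhaustion U g"
  shows "1-lipschitz_on UNIV g" "0 \<le> g x" "g x \<le> 1" "0 < g x \<longleftrightarrow> x \<in> U" "s > 0 \<Longrightarrow> compact {x. s \<le> g x}"
  using assms by (auto simp: exhaustion_def)

lemma exhaustion_outside:
  assumes "exhaustion U g" "z \<notin> U"
  shows "g z = 0" "g x \<le> norm (x - z)"
proof -
  show "g z = 0" using exhaustionD(2,4)[OF assms(1), of z] assms(2) by force
  then show "g x \<le> norm (x - z)"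
    using lipschitz_on_normD[OF exhaustionD(1)[OF assms(1)], of x z] exhaustionD(2)[OF assms(1), of x] by simp
qed

lemma lipschitz_on_min:
  fixes f h :: "'a::metric_space \<Rightarrow> real"
  assumes "L-lipschitz_on X f" "L-lipschitz_on X h"
  shows "L-lipschitz_on X (\<lambda>x. min (f x) (h x))"
proof (rule lipschitz_onI)
  fix x y assume "x \<in> X" "y \<in> X"
  then show "dist (min (f x) (h x)) (min (f y) (h y)) \<le> L * dist x y"
    using lipschitz_onD[OF assms(1), of x y] lipschitz_onD[OF assms(2), of x y]
    by (auto simp: dist_real_def min_def)
qed (rule lipschitz_on_nonneg[OF assms(1)])

lemma exhaustion_exists:
  fixes U :: "'a::euclidean_space set"
  assumes U: "open U"
  shows "\<exists>g. exhaustion U g"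
proof -
  \<comment> \<open>\<open>infdist\<close> to the empty set is 0, so the whole space gets the
    constant 1 instead. In \<open>g\<close> the term \<open>1 / (1 + norm x)\<close> makes the
    superlevel sets bounded.\<close>
  define d where "d x = (if U = UNIV then 1 else infdist x (-U))" for x
  define g where "g x = min (d x) (1 / (1 + norm x))" for x
  have "1-lipschitz_on UNIV d"
    by (rule lipschitz_onI) (use infdist_triangle_abs in \<open>auto simp: d_def dist_real_def\<close>)
  moreover have "1-lipschitz_on UNIV (\<lambda>x::'a. 1 / (1 + norm x))"
  proof (rule lipschitz_onI)
    fix x y :: 'a
    have "1 / (1 + norm x) - 1 / (1 + norm y) = (norm y - norm x) / ((1 + norm x) * (1 + norm y))"
      by (simp add: divide_simps add_nonneg_eq_0_iff) 
    also have "\<bar>\<dots>\<bar> = \<bar>norm y - norm x\<bar> / ((1 + norm x) * (1 + norm y))"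
      by (simp add: abs_mult)
    also have "\<dots> \<le> \<bar>norm y - norm x\<bar> / 1"
    proof (rule divide_left_mono)
      have "1 * 1 \<le> (1 + norm x) * (1 + norm y)" by (rule mult_mono) auto
      then show "1 \<le> (1 + norm x) * (1 + norm y)" by simp
    qed (auto intro!: mult_pos_pos add_pos_nonneg)
    also have "\<dots> \<le> norm (x - y)" using norm_triangle_ineq3[of y x] by (simp add: norm_minus_commute)
    finally show "dist (1 / (1 + norm x)) (1 / (1 + norm y)) \<le> 1 * dist x y"
      by (simp add: dist_norm)
  qed simp
  ultimately have L: "1-lipschitz_on UNIV g" unfolding g_def by (rule lipschitz_on_min)
  have d0: "0 \<le> d x" "0 < d x \<longleftrightarrow> x \<in> U" for x
  proof -
    show "0 \<le> d x" by (simp add: d_def infdist_nonneg)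
    show "0 < d x \<longleftrightarrow> x \<in> U"
    proof (cases "U = UNIV")
      case False
      then have "x \<in> -U \<longleftrightarrow> infdist x (-U) = 0"
        by (intro in_closed_iff_infdist_zero) (use U in auto)
      then show ?thesis using False infdist_nonneg[of x "-U"] by (auto simp: d_def less_le)
    qed (simp add: d_def)
  qed
  have n1: "0 < 1 / (1 + norm x)" "1 / (1 + norm x) \<le> 1" for x :: 'a
  proof -
    have "0 < 1 + norm x" by (simp add: add_pos_nonneg)
    then show "0 < 1 / (1 + norm x)" "1 / (1 + norm x) \<le> 1" by (auto simp: field_simps)
  qed
  have "compact {x. s \<le> g x}" if s: "s > 0" for s
  proof -
    have "closed {x. s \<le> g x}"
      using lipschitz_on_continuous_on[OF L] by (intro closed_Collect_le continuous_intros)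
    moreover have "{x. s \<le> g x} \<subseteq> cball 0 (1/s)"
    proof
      fix x assume "x \<in> {x. s \<le> g x}"
      then have "s \<le> 1 / (1 + norm x)" by (simp add: g_def)
      then have "1 + norm x \<le> 1 / s" using s n1(1)[of x] by (simp add: field_simps)
      then show "x \<in> cball 0 (1/s)" by simp
    qed
    then have "bounded {x. s \<le> g x}" using bounded_cball bounded_subset by blast
    ultimately show ?thesis by (simp add: compact_eq_bounded_closed)
  qed
  then have "exhaustion U g"
    using L d0 n1 unfolding exhaustion_def by (auto simp: g_def min_le_iff_disj less_imp_le)
  then show ?thesis by blast
qed

text \<open>\<open>W\<close> is the neighbourhood of \<open>E\<close> where the gradient of \<open>\<phi>\<close> is under control and where later layers
  may live. The quadratic bound in \<open>g\<close> makes sums of layers differentiable at points outside \<open>U\<close>.\<close>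

definition layer :: "'a::euclidean_space set \<Rightarrow> 'a set \<Rightarrow> ('a \<Rightarrow> real) \<Rightarrow> ('a \<Rightarrow> 'a) \<Rightarrow> ('a \<Rightarrow> real) \<Rightarrow>
    real \<Rightarrow> real \<Rightarrow> real \<Rightarrow> ('a \<Rightarrow> real) \<Rightarrow> 'a set \<Rightarrow> real \<Rightarrow> bool" where
  "layer E V g v \<psi> \<eta> \<epsilon> \<delta> \<phi> W \<rho> \<longleftrightarrow>
     (\<forall>x. \<phi> differentiable (at x)) \<and>
     (\<exists>D. compact D \<and> D \<subseteq> V \<and> (\<forall>x. x \<notin> D \<longrightarrow> \<phi> x = 0)) \<and>
     (\<forall>x. \<bar>\<phi> x\<bar> \<le> \<epsilon> * (g x)\<^sup>2) \<and>
     open W \<and> E \<subseteq> W \<and> W \<subseteq> V \<and> \<rho> > 0 \<and>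
     (\<forall>x. \<forall>y\<in>ball x \<rho>. \<forall>z\<in>ball x \<rho>. \<bar>\<phi> y - \<phi> z\<bar> \<le> (2 * \<psi> x + \<delta>) * norm (y - z)) \<and>
     (\<forall>x\<in>W. \<forall>y\<in>ball x \<rho>. \<forall>z\<in>ball x \<rho>. \<bar>\<phi> y - \<phi> z - v x \<bullet> (y - z)\<bar> \<le> (\<eta> * \<psi> x + \<delta>) * norm (y - z))"

lemma layerD:
  assumes "layer E V g v \<psi> \<eta> \<epsilon> \<delta> \<phi> W \<rho>"
  shows "\<phi> differentiable (at x)" "\<exists>D. compact D \<and> D \<subseteq> V \<and> (\<forall>x. x \<notin> D \<longrightarrow> \<phi> x = 0)"
    "\<bar>\<phi> x\<bar> \<le> \<epsilon> * (g x)\<^sup>2" "open W" "E \<subseteq> W" "W \<subseteq> V" "\<rho> > 0"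
    "y \<in> ball x \<rho> \<Longrightarrow> z \<in> ball x \<rho> \<Longrightarrow> \<bar>\<phi> y - \<phi> z\<bar> \<le> (2 * \<psi> x + \<delta>) * norm (y - z)"
    "x \<in> W \<Longrightarrow> y \<in> ball x \<rho> \<Longrightarrow> z \<in> ball x \<rho> \<Longrightarrow>
       \<bar>\<phi> y - \<phi> z - v x \<bullet> (y - z)\<bar> \<le> (\<eta> * \<psi> x + \<delta>) * norm (y - z)"
  using assms unfolding layer_def by simp_all

text \<open>Quantifying over every neighbourhood \<open>V\<close> and all tolerances is what allows
  an induction to put each new layer inside the region controlled by the previous one and at a
  smaller scale.\<close>

definition admissible :: "'a::euclidean_space set \<Rightarrow> 'a set \<Rightarrow> ('a \<Rightarrow> real) \<Rightarrow> ('a \<Rightarrow> 'a) \<Rightarrow>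
    ('a \<Rightarrow> real) \<Rightarrow> real \<Rightarrow> bool" where
  "admissible E U g v \<psi> \<eta> \<longleftrightarrow> (\<forall>V \<epsilon> \<delta>. open V \<and> E \<subseteq> V \<and> V \<subseteq> U \<and> \<epsilon> > 0 \<and> \<delta> > 0 \<longrightarrow>
     (\<exists>\<phi> W \<rho>. layer E V g v \<psi> \<eta> \<epsilon> \<delta> \<phi> W \<rho>))"

lemma compact_infdist_nbhd:
  fixes S :: "'a::euclidean_space set"
  assumes "compact S" "S \<noteq> {}" "open V" "S \<subseteq> V"
  obtains r where "r > 0" "{x. infdist x S < r} \<subseteq> V"
proof -
  obtain r where r: "r > 0" "(\<Union>x\<in>S. ball x r) \<subseteq> V"
    using compact_subset_open_imp_ball_epsilon_subset[OF assms(1,3,4)] by blast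
  have "{x. infdist x S < r} \<subseteq> V"
  proof
    fix x assume "x \<in> {x. infdist x S < r}"
    moreover obtain a where "a \<in> S" "infdist x S = dist x a"
      using infdist_attains_inf[of S x] compact_imp_closed[OF assms(1)] assms(2) by metis
    ultimately show "x \<in> V" using r(2) by (auto simp: dist_commute subset_eq)
  qed
  then show thesis using that r(1) by blast
qed

text \<open>The layer is the mollification of \<open>\<zeta> x * \<omega> x\<close>, where \<omega>
  is a width function for the compact set \<open>E \<inter> C\<close> and \<zeta> is \<psi> cut off
  near that set. Its gradient there is close to \<open>\<psi> x *\<^sub>R e\<close> because \<omega>
  is tiny and \<zeta> varies little at the scale \<rho>.\<close>

lemma admissible_single:
  fixes e :: "'a::euclidean_space"
  assumes E: "E = F \<inter> U" "closed F" "open U" and g: "exhaustion U g"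
    and e: "norm e = 1" and \<alpha>: "0 < \<alpha>" "\<alpha> \<le> 1/2"
    and C: "compact C" "C \<subseteq> U" "cone_null e \<alpha> (E \<inter> C)"
    and \<psi>: "M-lipschitz_on UNIV \<psi>" "\<And>x. 0 \<le> \<psi> x" "\<And>x. \<psi> x \<le> 1" "\<And>x. x \<notin> C \<Longrightarrow> \<psi> x = 0"
  shows "admissible E U g (\<lambda>x. \<psi> x *\<^sub>R e) \<psi> (\<alpha> / (1 - \<alpha>))"
  unfolding admissible_def
proof (intro allI impI, elim conjE)
  fix V and \<epsilon> \<delta> :: real
  assume V: "open V" "E \<subseteq> V" "V \<subseteq> U" and \<epsilon>: "\<epsilon> > 0" and \<delta>: "\<delta> > 0"
  define \<eta> where "\<eta> = \<alpha> / (1 - \<alpha>)"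
  have \<eta>: "0 \<le> \<eta>" "\<eta> \<le> 1" using \<alpha> by (auto simp: \<eta>_def)
  define S where "S = E \<inter> C"
  have S: "compact S"
  proof -
    \<comment> \<open>Since \<open>C \<subseteq> U\<close>, relative closedness of \<open>E\<close>
      in \<open>U\<close> becomes closedness.\<close>
    have "S = F \<inter> C" using E(1) C(2) by (auto simp: S_def)
    then show ?thesis using E(2) C(1) by (simp add: closed_Int_compact)
  qed
  show "\<exists>\<phi> W \<rho>. layer E V g (\<lambda>x. \<psi> x *\<^sub>R e) \<psi> (\<alpha> / (1 - \<alpha>)) \<epsilon> \<delta> \<phi> W \<rho>"
  proof (cases "S = {}")
    case True
    \<comment> \<open>If \<open>E\<close> misses \<open>C\<close>, the zero function serves: on
      \<open>V - C\<close> the prescribed field vanishes.\<close>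
    have "layer E V g (\<lambda>x. \<psi> x *\<^sub>R e) \<psi> \<eta> \<epsilon> \<delta> (\<lambda>x. 0) (V - C) 1"
      unfolding layer_def
    proof (intro conjI)
      show "\<exists>D. compact D \<and> D \<subseteq> V \<and> (\<forall>x. x \<notin> D \<longrightarrow> (0::real) = 0)" by (rule exI[of _ "{}"]) simp
      show "open (V - C)" using V(1) C(1) by (simp add: open_Diff compact_imp_closed)
    qed (use V \<epsilon> \<delta> \<psi> True in \<open>auto simp: S_def\<close>)
    then show ?thesis unfolding \<eta>_def by blast
  next
    case False
    obtain r0 where r0: "r0 > 0" "{x. infdist x S < r0} \<subseteq> V"
      by (rule compact_infdist_nbhd[OF S False V(1)]) (use V(2) in \<open>auto simp: S_def\<close>)
    define r where "r = r0 / 4"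
    have r: "r > 0" using r0 by (simp add: r_def)
    \<comment> \<open>The cutoff vanishes beyond distance \<open>2 * r\<close> and mollification
      spreads by at most \<open>r / 8\<close>, so \<phi> vanishes off \<open>D\<close>.\<close>
    define D where "D = {x. infdist x S \<le> 3 * r}"
    have D: "compact D" "D \<subseteq> V" "D \<noteq> {}"
    proof -
      show "compact D" unfolding D_def using False S r by (intro compact_infdist_le) auto
      show "D \<subseteq> V" using r0 by (auto simp: D_def r_def)
      obtain a where "a \<in> S" using False by blast
      then show "D \<noteq> {}" using r by (auto simp: D_def intro!: exI[of _ a])
    qed
    have gc: "continuous_on A g" for A
      using lipschitz_on_continuous_on[OF exhaustionD(1)[OF g]] continuous_on_subset by blast
    obtain a where a: "a \<in> D" "\<And>x. x \<in> D \<Longrightarrow> g a \<le> g x"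
      using continuous_attains_inf[OF D(1,3) gc] by blast
    have ga: "g a > 0" using exhaustionD(4)[OF g, of a] a(1) D(2) V(3) by blast
    have M: "M \<ge> 0" using \<psi>(1) by (rule lipschitz_on_nonneg)
    define B where "B = M + 1 / r"
    have B: "B > 0" using M r by (simp add: B_def add_nonneg_pos)
    \<comment> \<open>\<open>B\<close> bounds the Lipschitz constant of \<zeta>. On \<open>D\<close>
      the gauge is at least \<open>g a > 0\<close>, so the first entry gives the bound by
      \<open>\<epsilon> * (g x)\<^sup>2\<close>; the second keeps the contribution of the variation
      of \<zeta> multiplied by \<omega> below \<open>\<delta> / 2\<close>.\<close>
    define \<epsilon>1 where "\<epsilon>1 = min (\<epsilon> * (g a)\<^sup>2) (\<delta> / (2 * B))"
    have \<epsilon>1: "\<epsilon>1 > 0" "\<epsilon>1 * B \<le> \<delta> / 2"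
    proof -
      show "\<epsilon>1 > 0" using \<epsilon> \<delta> B ga by (simp add: \<epsilon>1_def)
      have "\<epsilon>1 * B \<le> \<delta> / (2 * B) * B" using B by (intro mult_right_mono) (auto simp: \<epsilon>1_def)
      then show "\<epsilon>1 * B \<le> \<delta> / 2" using B by simp
    qed
    obtain G \<omega> where G: "open G" "S \<subseteq> G" and \<omega>: "\<And>x. 0 \<le> \<omega> x \<and> \<omega> x \<le> \<epsilon>1"
      "\<And>x y. \<bar>\<omega> y - \<omega> x\<bar> \<le> 2 * norm (y - x)"
      "\<And>x y z r. ball x r \<subseteq> G \<Longrightarrow> y \<in> ball x (r/2) \<Longrightarrow> z \<in> ball x (r/2) \<Longrightarrow>
       \<bar>\<omega> y - \<omega> z - e \<bullet> (y - z)\<bar> \<le> \<eta> * norm (y - z)"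
      using width_function_exists[OF e \<alpha> C(3) \<epsilon>1(1)] unfolding \<eta>_def S_def by metis
    obtain r2 where r2: "r2 > 0" "{x. infdist x S < r2} \<subseteq> G"
      using compact_infdist_nbhd[OF S False G] by blast
    define q where "q = min r2 r / 2"
    have q: "q > 0" using r2 r by (simp add: q_def)
    \<comment> \<open>The first entry keeps balls of radius \<open>4 * \<rho>\<close> about points
      at distance below \<open>q\<close> from \<open>S\<close> inside \<open>G\<close>; the second
      limits the variation of \<zeta> over a ball of radius \<open>2 * \<rho>\<close>.\<close>
    define \<rho> where "\<rho> = min (min r2 r / 8) (\<delta> / (8 * B))"
    have \<rho>: "\<rho> > 0" "4 * \<rho> \<le> min r2 r / 2" "8 * \<rho> \<le> r" "4 * B * \<rho> \<le> \<delta> / 2"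
    proof -
      show "\<rho> > 0" using r2 r \<delta> B by (simp add: \<rho>_def)
      show "4 * \<rho> \<le> min r2 r / 2" "8 * \<rho> \<le> r" by (auto simp: \<rho>_def)
      have "4 * B * \<rho> \<le> 4 * B * (\<delta> / (8 * B))" using B by (intro mult_left_mono) (auto simp: \<rho>_def)
      then show "4 * B * \<rho> \<le> \<delta> / 2" using B by simp
    qed
    define cut where "cut x = max 0 (min 1 (2 - infdist x S / r))" for x
    have cut01: "0 \<le> cut x" "cut x \<le> 1" for x by (auto simp: cut_def)
    have cutL: "\<bar>cut y - cut z\<bar> \<le> 1 / r * norm (y - z)" for y z
    proof -
      have "\<bar>cut y - cut z\<bar> \<le> \<bar>infdist y S / r - infdist z S / r\<bar>" by (auto simp: cut_def)
      also have "\<dots> = \<bar>infdist y S - infdist z S\<bar> / r" using r by (simp add: abs_divide flip: diff_divide_distrib)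
      also have "\<dots> \<le> norm (y - z) / r"
        using infdist_triangle_abs[of y S z] r by (intro divide_right_mono) (auto simp: dist_norm)
      finally show ?thesis by simp
    qed
    define \<zeta> where "\<zeta> x = cut x * \<psi> x" for x
    have \<zeta>01: "0 \<le> \<zeta> x" "\<zeta> x \<le> \<psi> x" "\<zeta> x \<le> 1" for x
      using cut01[of x] \<psi>(2,3)[of x] by (auto simp: \<zeta>_def mult_left_le_one_le mult_le_one)
    have \<zeta>L: "\<bar>\<zeta> y - \<zeta> z\<bar> \<le> B * norm (y - z)" for y z
    proof -
      have "\<zeta> y - \<zeta> z = (cut y - cut z) * \<psi> y + cut z * (\<psi> y - \<psi> z)" by (simp add: \<zeta>_def algebra_simps)
      also have "\<bar>\<dots>\<bar> \<le> \<bar>cut y - cut z\<bar> * \<psi> y + cut z * \<bar>\<psi> y - \<psi> z\<bar>"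
        using \<psi>(2) cut01 by (metis abs_mult abs_of_nonneg abs_triangle_ineq)
      also have "\<dots> \<le> (1 / r * norm (y - z)) * 1 + 1 * (M * norm (y - z))"
        using cutL[of y z] lipschitz_on_normD[OF \<psi>(1), of y z] \<psi>(2,3) cut01 r M
        by (intro add_mono mult_mono) auto
      finally show ?thesis by (simp add: B_def algebra_simps)
    qed
    define \<phi>0 where "\<phi>0 x = \<zeta> x * \<omega> x" for x
    \<comment> \<open>The increment is expanded with \<zeta> frozen at the centre \<open>x\<close>.
      The other two terms are small because \<zeta> changes little on the ball and because \<omega>
      is small.\<close>
    have split: "\<phi>0 y - \<phi>0 z = \<zeta> x * (\<omega> y - \<omega> z) + (\<zeta> y - \<zeta> x) * (\<omega> y - \<omega> z) + \<omega> z * (\<zeta> y - \<zeta> z)" for x y z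
      by (simp add: \<phi>0_def algebra_simps)
    have err: "\<bar>(\<zeta> y - \<zeta> x) * (\<omega> y - \<omega> z) + \<omega> z * (\<zeta> y - \<zeta> z)\<bar> \<le> \<delta> * norm (y - z)"
      if "y \<in> ball x (2 * \<rho>)" for x y z
    proof -
      have "\<bar>\<zeta> y - \<zeta> x\<bar> \<le> B * (2 * \<rho>)"
        using \<zeta>L[of y x] that B by (auto simp: dist_norm norm_minus_commute intro: order_trans[OF _ mult_left_mono])
      then have "\<bar>(\<zeta> y - \<zeta> x) * (\<omega> y - \<omega> z)\<bar> \<le> (B * (2 * \<rho>)) * (2 * norm (y - z))"
        unfolding abs_mult using \<omega>(2)[of y z] by (intro mult_mono) auto
      moreover have "\<bar>\<omega> z * (\<zeta> y - \<zeta> z)\<bar> \<le> \<epsilon>1 * (B * norm (y - z))"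
        unfolding abs_mult using \<omega>(1)[of z] \<zeta>L[of y z] \<epsilon>1(1) by (intro mult_mono) auto
      ultimately have "\<bar>(\<zeta> y - \<zeta> x) * (\<omega> y - \<omega> z) + \<omega> z * (\<zeta> y - \<zeta> z)\<bar> \<le> (4 * B * \<rho> + \<epsilon>1 * B) * norm (y - z)"
        by (simp add: algebra_simps)
      also have "\<dots> \<le> \<delta> * norm (y - z)" using \<rho>(4) \<epsilon>1(2) by (intro mult_right_mono) auto
      finally show ?thesis .
    qed
    have lip0: "\<bar>\<phi>0 y - \<phi>0 z\<bar> \<le> (2 * \<psi> x + \<delta>) * norm (y - z)" if "y \<in> ball x (2 * \<rho>)" for x y z
    proof -
      have "\<bar>\<zeta> x * (\<omega> y - \<omega> z)\<bar> \<le> \<psi> x * (2 * norm (y - z))"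
        unfolding abs_mult using \<zeta>01[of x] \<omega>(2)[of y z] \<psi>(2)[of x] by (intro mult_mono) auto
      then show ?thesis using err[OF that, of z] unfolding split[of y z x] by (simp add: algebra_simps)
    qed
    have lin0: "\<bar>\<phi>0 y - \<phi>0 z - \<psi> x * (e \<bullet> (y - z))\<bar> \<le> (\<eta> * \<psi> x + \<delta>) * norm (y - z)"
      if x: "infdist x S < q" and y: "y \<in> ball x (2 * \<rho>)" and z: "z \<in> ball x (2 * \<rho>)" for x y z
    proof -
      have near: "infdist u S < min r2 r" if "u \<in> ball x (4 * \<rho>)" for u
        using infdist_triangle[of u S x] x that \<rho>(2) by (auto simp: q_def dist_commute)
      have "infdist x S / r \<le> 1" using near[of x] \<rho>(1) r by simp
      then have "cut x = 1" by (simp add: cut_def)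
      then have \<zeta>x: "\<zeta> x = \<psi> x" by (simp add: \<zeta>_def)
      \<comment> \<open>The affine estimate is valid on half the radius, so radius
        \<open>4 * \<rho>\<close> serves points within \<open>2 * \<rho>\<close>.\<close>
      have "ball x (4 * \<rho>) \<subseteq> G" using near r2(2) by auto
      from \<omega>(3)[OF this, of y z] have "\<bar>\<omega> y - \<omega> z - e \<bullet> (y - z)\<bar> \<le> \<eta> * norm (y - z)"
        using y z by simp
      then have "\<bar>\<psi> x * (\<omega> y - \<omega> z - e \<bullet> (y - z))\<bar> \<le> \<psi> x * (\<eta> * norm (y - z))"
        unfolding abs_mult using \<psi>(2)[of x] by (intro mult_mono) auto
      then show ?thesis using err[OF y, of z] unfolding split[of y z x] \<zeta>x by (simp add: algebra_simps)
    qed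
    have c0: "continuous_on UNIV \<phi>0"
    proof -
      have "B-lipschitz_on UNIV \<zeta>" by (rule lipschitz_onI) (use \<zeta>L B in \<open>auto simp: dist_norm\<close>)
      moreover have "2-lipschitz_on UNIV \<omega>" by (rule lipschitz_onI) (use \<omega>(2) in \<open>auto simp: dist_norm\<close>)
      ultimately show ?thesis unfolding \<phi>0_def
        by (intro continuous_intros lipschitz_on_continuous_on)
    qed
    obtain \<phi> where \<phi>: "\<And>x. \<phi> differentiable (at x)"
      "\<And>x c. (\<And>w. norm w < \<rho> \<Longrightarrow> \<bar>\<phi>0 (x + w)\<bar> \<le> c) \<Longrightarrow> \<bar>\<phi> x\<bar> \<le> c"
      "\<And>y z a c. (\<And>w. norm w < \<rho> \<Longrightarrow> \<bar>\<phi>0 (y + w) - \<phi>0 (z + w) - a\<bar> \<le> c) \<Longrightarrow> \<bar>\<phi> y - \<phi> z - a\<bar> \<le> c"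
      using mollification[OF c0 \<rho>(1)] by metis
    \<comment> \<open>Mollifying moves points by less than \<rho>, so estimates for
      \<open>\<phi>0\<close> on radius \<open>2 * \<rho>\<close> become estimates for \<phi> on
      radius \<rho>.\<close>
    have shift: "y + w \<in> ball x (2 * \<rho>)" if "y \<in> ball x \<rho>" "norm w < \<rho>" for x y w
    proof -
      have "norm (x - (y + w)) \<le> norm (x - y) + norm w" by (metis diff_diff_eq norm_triangle_ineq4)
      then show ?thesis using that by (simp add: dist_norm)
    qed
    have zero: "\<phi> x = 0" if "x \<notin> D" for x
    proof -
      have "\<bar>\<phi>0 (x + w)\<bar> \<le> 0" if "norm w < \<rho>" for w
      proof -
        have "infdist x S \<le> infdist (x + w) S + norm w"
          using infdist_triangle[of x S "x + w"] by (simp add: dist_norm)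
        then have "2 * r < infdist (x + w) S" using \<open>x \<notin> D\<close> that \<rho>(3) r by (simp add: D_def)
        then have "2 < infdist (x + w) S / r" using r by (simp add: field_simps)
        then have "cut (x + w) = 0" by (simp add: cut_def)
        then show ?thesis by (simp add: \<phi>0_def \<zeta>_def)
      qed
      from \<phi>(2)[OF this] show ?thesis by simp
    qed
    \<comment> \<open>Off \<open>C\<close> both \<psi> and the field vanish, so there the Lipschitz
      bound alone is the required approximation.\<close>
    define W where "W = V \<inter> ({x. infdist x S < q} \<union> - C)"
    have L1: "\<bar>\<phi> y - \<phi> z\<bar> \<le> (2 * \<psi> x + \<delta>) * norm (y - z)" if "y \<in> ball x \<rho>" for x y z
    proof -
      have "\<bar>\<phi> y - \<phi> z - 0\<bar> \<le> (2 * \<psi> x + \<delta>) * norm (y - z)"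
      proof (rule \<phi>(3))
        fix w :: 'a assume w: "norm w < \<rho>"
        show "\<bar>\<phi>0 (y + w) - \<phi>0 (z + w) - 0\<bar> \<le> (2 * \<psi> x + \<delta>) * norm (y - z)"
          using lip0[OF shift[OF that w], of "z + w"] by simp
      qed
      then show ?thesis by simp
    qed
    have "layer E V g (\<lambda>x. \<psi> x *\<^sub>R e) \<psi> \<eta> \<epsilon> \<delta> \<phi> W \<rho>"
      unfolding layer_def
    proof (intro conjI)
      show "\<forall>x. \<phi> differentiable (at x)" using \<phi>(1) by blast
      show "\<exists>D. compact D \<and> D \<subseteq> V \<and> (\<forall>x. x \<notin> D \<longrightarrow> \<phi> x = 0)"
        using D zero by blast
      show "\<forall>x. \<bar>\<phi> x\<bar> \<le> \<epsilon> * (g x)\<^sup>2"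
      proof
        fix x
        show "\<bar>\<phi> x\<bar> \<le> \<epsilon> * (g x)\<^sup>2"
        proof (cases "x \<in> D")
          case True
          have "\<bar>\<phi> x\<bar> \<le> \<epsilon>1"
          proof (rule \<phi>(2))
            fix w
            have "\<zeta> (x + w) * \<omega> (x + w) \<le> 1 * \<epsilon>1"
              using \<zeta>01 \<omega>(1) by (intro mult_mono) auto
            then show "\<bar>\<phi>0 (x + w)\<bar> \<le> \<epsilon>1" using \<zeta>01(1) \<omega>(1) by (simp add: \<phi>0_def abs_mult)
          qed
          also have "\<dots> \<le> \<epsilon> * (g a)\<^sup>2" by (simp add: \<epsilon>1_def)
          also have "\<dots> \<le> \<epsilon> * (g x)\<^sup>2"
            using a(2)[OF True] ga \<epsilon> by (intro mult_left_mono power_mono) auto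
          finally show ?thesis .
        next
          case False
          then show ?thesis using zero \<epsilon> by simp
        qed
      qed
      have "open {x. infdist x S < q}"
        by (intro open_Collect_less continuous_intros)
      then show "open W" unfolding W_def
        using V(1) C(1) by (auto intro!: open_Int open_Un open_Compl compact_imp_closed)
      show "E \<subseteq> W" using V(2) q by (auto simp: W_def S_def)
      show "W \<subseteq> V" by (simp add: W_def)
      show "\<rho> > 0" by (rule \<rho>(1))
      show "\<forall>x. \<forall>y\<in>ball x \<rho>. \<forall>z\<in>ball x \<rho>. \<bar>\<phi> y - \<phi> z\<bar> \<le> (2 * \<psi> x + \<delta>) * norm (y - z)"
        using L1 by blast
      show "\<forall>x\<in>W. \<forall>y\<in>ball x \<rho>. \<forall>z\<in>ball x \<rho>.
          \<bar>\<phi> y - \<phi> z - (\<psi> x *\<^sub>R e) \<bullet> (y - z)\<bar> \<le> (\<eta> * \<psi> x + \<delta>) * norm (y - z)"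
      proof (intro ballI)
        fix x y z assume x: "x \<in> W" and y: "y \<in> ball x \<rho>" and z: "z \<in> ball x \<rho>"
        show "\<bar>\<phi> y - \<phi> z - (\<psi> x *\<^sub>R e) \<bullet> (y - z)\<bar> \<le> (\<eta> * \<psi> x + \<delta>) * norm (y - z)"
        proof (cases "x \<in> C")
          case False
          then show ?thesis using L1[OF y, of z] \<psi>(4)[of x] by simp
        next
          case True
          then have xq: "infdist x S < q" using x by (simp add: W_def)
          show ?thesis
          proof (rule \<phi>(3))
            fix w :: 'a assume w: "norm w < \<rho>"
            show "\<bar>\<phi>0 (y + w) - \<phi>0 (z + w) - (\<psi> x *\<^sub>R e) \<bullet> (y - z)\<bar> \<le> (\<eta> * \<psi> x + \<delta>) * norm (y - z)"
              using lin0[OF xq shift[OF y w] shift[OF z w]] by simp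
          qed
        qed
      qed
    qed
    then show ?thesis unfolding \<eta>_def by blast
  qed
qed

lemma admissible_zero: "admissible E U g (\<lambda>x. 0) (\<lambda>x. 0) \<eta>"
  unfolding admissible_def
proof (intro allI impI, elim conjE)
  fix V and \<epsilon> \<delta> :: real assume "open V" "E \<subseteq> V" "\<epsilon> > 0" "\<delta> > 0"
  then have "layer E V g (\<lambda>x. 0) (\<lambda>x. 0) \<eta> \<epsilon> \<delta> (\<lambda>x. 0) V 1"
    unfolding layer_def by (auto intro!: exI[of _ "{}"])
  then show "\<exists>\<phi> W \<rho>. layer E V g (\<lambda>x. 0) (\<lambda>x. 0) \<eta> \<epsilon> \<delta> \<phi> W \<rho>" by blast
qed

lemma admissible_minus:
  fixes E :: "'a::euclidean_space set"
  assumes "admissible E U g v \<psi> \<eta>"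
  shows "admissible E U g (\<lambda>x. - v x) \<psi> \<eta>"
  unfolding admissible_def
proof (intro allI impI)
  fix V and \<epsilon> \<delta> :: real assume "open V \<and> E \<subseteq> V \<and> V \<subseteq> U \<and> \<epsilon> > 0 \<and> \<delta> > 0"
  then obtain \<phi> W \<rho> where l: "layer E V g v \<psi> \<eta> \<epsilon> \<delta> \<phi> W \<rho>"
    using assms unfolding admissible_def by blast
  have "layer E V g (\<lambda>x. - v x) \<psi> \<eta> \<epsilon> \<delta> (\<lambda>x. - \<phi> x) W \<rho>"
    unfolding layer_def
  proof (intro conjI allI ballI)
    fix x y z :: 'a assume yz: "y \<in> ball x \<rho>" "z \<in> ball x \<rho>"
    show "\<bar>- \<phi> y - - \<phi> z\<bar> \<le> (2 * \<psi> x + \<delta>) * norm (y - z)"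
      using layerD(8)[OF l yz] by simp
  next
    fix x y z :: 'a assume yz: "x \<in> W" "y \<in> ball x \<rho>" "z \<in> ball x \<rho>"
    show "\<bar>- \<phi> y - - \<phi> z - (- v x) \<bullet> (y - z)\<bar> \<le> (\<eta> * \<psi> x + \<delta>) * norm (y - z)"
      using layerD(9)[OF l yz] unfolding inner_minus_left by linarith
  qed (use layerD(1-7)[OF l] in auto)
  then show "\<exists>\<phi> W \<rho>. layer E V g (\<lambda>x. - v x) \<psi> \<eta> \<epsilon> \<delta> \<phi> W \<rho>" by blast
qed

text \<open>Each layer takes half the tolerances; the errors proportional to the weights add up
  because both layers share the same \<eta>.\<close>

lemma admissible_add:
  fixes E :: "'a::euclidean_space set"
  assumes "admissible E U g v1 \<psi>1 \<eta>" "admissible E U g v2 \<psi>2 \<eta>"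
  shows "admissible E U g (\<lambda>x. v1 x + v2 x) (\<lambda>x. \<psi>1 x + \<psi>2 x) \<eta>"
  unfolding admissible_def
proof (intro allI impI, elim conjE)
  fix V and \<epsilon> \<delta> :: real assume V: "open V" "E \<subseteq> V" "V \<subseteq> U" and \<epsilon>: "\<epsilon> > 0" and \<delta>: "\<delta> > 0"
  have half: "\<epsilon>/2 > 0" "\<delta>/2 > 0" using \<epsilon> \<delta> by auto
  obtain \<phi>1 W1 \<rho>1 where l1: "layer E V g v1 \<psi>1 \<eta> (\<epsilon>/2) (\<delta>/2) \<phi>1 W1 \<rho>1"
    using assms(1) V half unfolding admissible_def by metis
  obtain \<phi>2 W2 \<rho>2 where l2: "layer E V g v2 \<psi>2 \<eta> (\<epsilon>/2) (\<delta>/2) \<phi>2 W2 \<rho>2"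
    using assms(2) V half unfolding admissible_def by metis
  obtain D1 D2 where D: "compact D1" "D1 \<subseteq> V" "\<And>x. x \<notin> D1 \<Longrightarrow> \<phi>1 x = 0"
     "compact D2" "D2 \<subseteq> V" "\<And>x. x \<notin> D2 \<Longrightarrow> \<phi>2 x = 0"
    using layerD(2)[OF l1] layerD(2)[OF l2] by metis
  have b: "\<bar>\<phi>1 x\<bar> \<le> (\<epsilon>/2) * (g x)\<^sup>2" "\<bar>\<phi>2 x\<bar> \<le> (\<epsilon>/2) * (g x)\<^sup>2" for x
    using layerD(3)[OF l1] layerD(3)[OF l2] by auto
  have "layer E V g (\<lambda>x. v1 x + v2 x) (\<lambda>x. \<psi>1 x + \<psi>2 x) \<eta> \<epsilon> \<delta> (\<lambda>x. \<phi>1 x + \<phi>2 x) (W1 \<inter> W2) (min \<rho>1 \<rho>2)"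
    unfolding layer_def
  proof (intro conjI)
    show "\<forall>x. (\<lambda>x. \<phi>1 x + \<phi>2 x) differentiable at x" using l1 l2 by (simp add: layer_def)
    show "\<exists>D. compact D \<and> D \<subseteq> V \<and> (\<forall>x. x \<notin> D \<longrightarrow> \<phi>1 x + \<phi>2 x = 0)"
      by (rule exI[of _ "D1 \<union> D2"]) (use D in auto)
    show "\<forall>x. \<bar>\<phi>1 x + \<phi>2 x\<bar> \<le> \<epsilon> * (g x)\<^sup>2"
    proof
      fix x show "\<bar>\<phi>1 x + \<phi>2 x\<bar> \<le> \<epsilon> * (g x)\<^sup>2"
        using b(1)[of x] b(2)[of x] by (simp add: algebra_simps)
    qed
    show "open (W1 \<inter> W2)" "E \<subseteq> W1 \<inter> W2" "W1 \<inter> W2 \<subseteq> V" "min \<rho>1 \<rho>2 > 0"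
      using l1 l2 by (auto simp: layer_def)
    show "\<forall>x. \<forall>y\<in>ball x (min \<rho>1 \<rho>2). \<forall>z\<in>ball x (min \<rho>1 \<rho>2).
       \<bar>\<phi>1 y + \<phi>2 y - (\<phi>1 z + \<phi>2 z)\<bar> \<le> (2 * (\<psi>1 x + \<psi>2 x) + \<delta>) * norm (y - z)"
    proof (intro allI ballI)
      fix x y z :: 'a assume "y \<in> ball x (min \<rho>1 \<rho>2)" "z \<in> ball x (min \<rho>1 \<rho>2)"
      then have yz: "y \<in> ball x \<rho>1" "z \<in> ball x \<rho>1" "y \<in> ball x \<rho>2" "z \<in> ball x \<rho>2" by auto
      have "\<bar>\<phi>1 y - \<phi>1 z\<bar> \<le> (2 * \<psi>1 x + \<delta>/2) * norm (y - z)" "\<bar>\<phi>2 y - \<phi>2 z\<bar> \<le> (2 * \<psi>2 x + \<delta>/2) * norm (y - z)"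
        using layerD(8)[OF l1 yz(1,2)] layerD(8)[OF l2 yz(3,4)] by auto
      then show "\<bar>\<phi>1 y + \<phi>2 y - (\<phi>1 z + \<phi>2 z)\<bar> \<le> (2 * (\<psi>1 x + \<psi>2 x) + \<delta>) * norm (y - z)"
        by (simp add: algebra_simps)
    qed
    show "\<forall>x\<in>W1 \<inter> W2. \<forall>y\<in>ball x (min \<rho>1 \<rho>2). \<forall>z\<in>ball x (min \<rho>1 \<rho>2).
       \<bar>\<phi>1 y + \<phi>2 y - (\<phi>1 z + \<phi>2 z) - (v1 x + v2 x) \<bullet> (y - z)\<bar> \<le> (\<eta> * (\<psi>1 x + \<psi>2 x) + \<delta>) * norm (y - z)"
    proof (intro ballI)
      fix x y z :: 'a assume x: "x \<in> W1 \<inter> W2" and "y \<in> ball x (min \<rho>1 \<rho>2)" "z \<in> ball x (min \<rho>1 \<rho>2)"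
      then have yz: "x \<in> W1" "x \<in> W2" "y \<in> ball x \<rho>1" "z \<in> ball x \<rho>1" "y \<in> ball x \<rho>2" "z \<in> ball x \<rho>2" by auto
      have "\<bar>\<phi>1 y - \<phi>1 z - v1 x \<bullet> (y - z)\<bar> \<le> (\<eta> * \<psi>1 x + \<delta>/2) * norm (y - z)"
           "\<bar>\<phi>2 y - \<phi>2 z - v2 x \<bullet> (y - z)\<bar> \<le> (\<eta> * \<psi>2 x + \<delta>/2) * norm (y - z)"
        using layerD(9)[OF l1 yz(1,3,4)] layerD(9)[OF l2 yz(2,5,6)] by auto
      then show "\<bar>\<phi>1 y + \<phi>2 y - (\<phi>1 z + \<phi>2 z) - (v1 x + v2 x) \<bullet> (y - z)\<bar> \<le> (\<eta> * (\<psi>1 x + \<psi>2 x) + \<delta>) * norm (y - z)"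
        unfolding inner_add_left by (simp add: algebra_simps)
    qed
  qed
  then show "\<exists>\<phi> W \<rho>. layer E V g (\<lambda>x. v1 x + v2 x) (\<lambda>x. \<psi>1 x + \<psi>2 x) \<eta> \<epsilon> \<delta> \<phi> W \<rho>" by blast
qed

section \<open>Choice of the gradient fields\<close>

definition null_region :: "'a::euclidean_space set \<Rightarrow> 'a set \<Rightarrow> real \<Rightarrow> 'a \<Rightarrow> 'a set" where
  "null_region E U \<alpha> e = {x \<in> U. \<exists>r>0. width e \<alpha> (ball x r \<inter> E) = 0}"

lemma width_mono: "S \<subseteq> T \<Longrightarrow> width e \<alpha> S \<le> width e \<alpha> T"
  unfolding width_def by (auto intro!: INF_superset_mono)

lemma width_zero_subset: "S \<subseteq> T \<Longrightarrow> width e \<alpha> T = 0 \<Longrightarrow> width e \<alpha> S = 0"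
  using width_mono[of S T e \<alpha>] by simp

lemma open_null_region:
  assumes "open U"
  shows "open (null_region E U \<alpha> e)"
  unfolding open_contains_ball
proof
  fix x assume "x \<in> null_region E U \<alpha> e"
  then obtain r where x: "x \<in> U" "r > 0" "width e \<alpha> (ball x r \<inter> E) = 0" by (auto simp: null_region_def)
  obtain s where s: "s > 0" "ball x s \<subseteq> U" using assms x(1) open_contains_ball by blast
  have "y \<in> null_region E U \<alpha> e" if y: "y \<in> ball x (min s (r/2))" for y
  proof -
    have "ball y (r/2) \<inter> E \<subseteq> ball x r \<inter> E"
    proof -
      have "ball y (r/2) \<subseteq> ball x r"
        using y by (subst ball_subset_ball_iff) (auto simp: dist_commute)
      then show ?thesis by blast
    qed
    then have "width e \<alpha> (ball y (r/2) \<inter> E) = 0" using x(3) by (rule width_zero_subset)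
    then show ?thesis using x(2) s y by (auto simp: null_region_def intro!: exI[of _ "r/2"])
  qed
  then show "\<exists>d>0. ball x d \<subseteq> null_region E U \<alpha> e"
    using x(2) s by (intro exI[of _ "min s (r/2)"]) auto
qed

text \<open>By compactness, finitely many balls in which \<open>E\<close> has zero width cover
  \<open>C\<close>.\<close>

lemma cone_null_in_null_region:
  assumes e: "norm e = 1" and \<alpha>: "\<alpha> \<le> 1" and C: "compact C" "C \<subseteq> null_region E U \<alpha> e"
  shows "cone_null e \<alpha> (E \<inter> C)"
proof -
  have "\<exists>r. r > 0 \<and> width e \<alpha> (ball x r \<inter> E) = 0" if "x \<in> C" for x
    using C(2) that by (auto simp: null_region_def)
  then obtain r where r: "\<And>x. x \<in> C \<Longrightarrow> r x > 0 \<and> width e \<alpha> (ball x (r x) \<inter> E) = 0" by metis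
  obtain T where T: "T \<subseteq> C" "finite T" "C \<subseteq> (\<Union>x\<in>T. ball x (r x))"
    by (rule compactE_image[OF C(1), of C "\<lambda>x. ball x (r x)"]) (use r in auto)
  have "cone_null e \<alpha> (\<Union>x\<in>T. ball x (r x) \<inter> E)"
    by (rule cone_null_UN[OF T(2)]) (use r T(1) width_zero_imp_cone_null[OF e \<alpha>] in auto)
  then show ?thesis by (rule cone_null_subset) (use T(3) in auto)
qed

section \<open>Cutoff functions and dyadic shells\<close>

definition tent :: "real \<Rightarrow> real" where "tent t = min 1 (max 0 (t - 1))"

lemma tent_bounds: "0 \<le> tent t" "tent t \<le> 1" by (auto simp: tent_def)

lemma tent_mono: "s \<le> t \<Longrightarrow> tent s \<le> tent t" by (auto simp: tent_def)

lemma tent_scaled_lipschitz: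
  assumes "exhaustion W h" "c \<ge> 0"
  shows "c-lipschitz_on UNIV (\<lambda>x. tent (c * h x))"
proof (rule lipschitz_onI)
  fix x y
  have "dist (tent (c * h x)) (tent (c * h y)) \<le> \<bar>c * h x - c * h y\<bar>"
    by (auto simp: tent_def dist_real_def)
  also have "\<dots> = c * \<bar>h x - h y\<bar>" using assms(2) by (simp add: abs_mult flip: right_diff_distrib)
  also have "\<dots> \<le> c * dist x y"
    using lipschitz_onD[OF exhaustionD(1)[OF assms(1)], of x y] assms(2)
    by (intro mult_left_mono) (auto simp: dist_real_def)
  finally show "dist (tent (c * h x)) (tent (c * h y)) \<le> c * dist x y" .
qed (rule assms(2))

definition cutoff_in :: "'a::euclidean_space set \<Rightarrow> ('a \<Rightarrow> real) \<Rightarrow> bool" where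
  "cutoff_in W \<theta> \<longleftrightarrow> (\<exists>L. L-lipschitz_on UNIV \<theta>) \<and> (\<forall>x. 0 \<le> \<theta> x \<and> \<theta> x \<le> 1) \<and>
     (\<exists>C. compact C \<and> C \<subseteq> W \<and> (\<forall>x. x \<notin> C \<longrightarrow> \<theta> x = 0))"

lemma cutoff_in_tent:
  assumes h: "exhaustion W h" and c: "c > 0"
  shows "cutoff_in W (\<lambda>x. tent (c * h x))"
  unfolding cutoff_in_def
proof (intro conjI)
  show "\<exists>L. L-lipschitz_on UNIV (\<lambda>x. tent (c * h x))" using tent_scaled_lipschitz[OF h, of c] c by auto
  show "\<exists>C. compact C \<and> C \<subseteq> W \<and> (\<forall>x. x \<notin> C \<longrightarrow> tent (c * h x) = 0)"
  proof (intro exI conjI)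
    show "compact {x. 1 / c \<le> h x}" using exhaustionD(5)[OF h] c by simp
    show "{x. 1 / c \<le> h x} \<subseteq> W"
    proof
      fix x assume "x \<in> {x. 1 / c \<le> h x}"
      then have "0 < 1 / c" "1 / c \<le> h x" using c by auto
      then have "0 < h x" by linarith
      then show "x \<in> W" using exhaustionD(4)[OF h] by simp
    qed
    show "\<forall>x. x \<notin> {x. 1 / c \<le> h x} \<longrightarrow> tent (c * h x) = 0"
      using c by (auto simp: tent_def field_simps)
  qed
qed (simp add: tent_bounds)

text \<open>Instead of a quotient partition of unity, the part \<open>min \<psi> \<theta>\<close> is split off \<open>\<psi>\<close> for one cutoff \<open>\<theta>\<close>
  after the other; the remainder vanishes where \<open>\<theta> = 1\<close>.\<close>

lemma admissible_field_finite:
  fixes F :: "'a::euclidean_space set"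
  assumes E: "E = F \<inter> U" "closed F" "open U" and g: "exhaustion U g"
    and \<alpha>: "0 < \<alpha>" "\<alpha> \<le> 1/2"
    and A: "\<And>e. e \<in> A \<Longrightarrow> norm e = 1 \<and> norm (e - b) \<le> d"
    and J: "finite J" "\<And>e \<theta>. (e, \<theta>) \<in> J \<Longrightarrow> e \<in> A \<and> cutoff_in (null_region E U \<alpha> e) \<theta>"
    and \<psi>: "\<exists>L. L-lipschitz_on UNIV \<psi>" "\<And>x. 0 \<le> \<psi> x \<and> \<psi> x \<le> 1"
       "\<And>x. \<psi> x \<noteq> 0 \<Longrightarrow> \<exists>(e, \<theta>)\<in>J. \<theta> x = 1"
  shows "\<exists>v. admissible E U g v \<psi> (\<alpha> / (1 - \<alpha>)) \<and> (\<forall>x. norm (v x - \<psi> x *\<^sub>R b) \<le> d * \<psi> x \<and> norm (v x) \<le> \<psi> x)"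
  using J \<psi>
\<comment> \<open>The weight is generalised because what remains after one cutoff is a different
  weight.\<close>
proof (induction J arbitrary: \<psi> rule: finite_induct)
  case empty
  then have "\<psi> = (\<lambda>x. 0)" by auto
  then show ?case using admissible_zero by (intro exI[of _ "\<lambda>x. 0"]) auto
next
  case (insert j J)
  obtain e \<theta> where j: "j = (e, \<theta>)" by (cases j)
  have e: "e \<in> A" "norm e = 1" "norm (e - b) \<le> d" and \<theta>: "cutoff_in (null_region E U \<alpha> e) \<theta>"
    using insert.prems(1)[of e \<theta>] A j by auto
  obtain L C where L: "L-lipschitz_on UNIV \<theta>" and C: "compact C" "C \<subseteq> null_region E U \<alpha> e" "\<And>x. x \<notin> C \<Longrightarrow> \<theta> x = 0"
    and \<theta>01: "\<And>x. 0 \<le> \<theta> x" "\<And>x. \<theta> x \<le> 1"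
    using \<theta> unfolding cutoff_in_def by metis
  obtain M where M: "M-lipschitz_on UNIV \<psi>" using insert.prems(2) by blast
  define \<psi>1 where "\<psi>1 x = min (\<psi> x) (\<theta> x)" for x
  define \<psi>2 where "\<psi>2 x = \<psi> x - \<psi>1 x" for x
  have M1: "(max M L)-lipschitz_on UNIV \<psi>1" unfolding \<psi>1_def
    by (rule lipschitz_on_min; rule lipschitz_on_mono[OF M] lipschitz_on_mono[OF L]) auto
  have adm1: "admissible E U g (\<lambda>x. \<psi>1 x *\<^sub>R e) \<psi>1 (\<alpha> / (1 - \<alpha>))"
  proof (rule admissible_single[OF E g e(2) \<alpha> C(1) _ _ M1])
    show "C \<subseteq> U" using C(2) by (auto simp: null_region_def)
    show "cone_null e \<alpha> (E \<inter> C)" by (rule cone_null_in_null_region[OF e(2) _ C(1,2)]) (use \<alpha> in simp)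
    fix x
    show "0 \<le> \<psi>1 x" "\<psi>1 x \<le> 1" using insert.prems(3)[of x] \<theta>01[of x] by (auto simp: \<psi>1_def)
    show "\<psi>1 x = 0" if "x \<notin> C" using insert.prems(3)[of x] C(3)[OF that] by (auto simp: \<psi>1_def)
  qed
  have "\<exists>v. admissible E U g v \<psi>2 (\<alpha> / (1 - \<alpha>)) \<and> (\<forall>x. norm (v x - \<psi>2 x *\<^sub>R b) \<le> d * \<psi>2 x \<and> norm (v x) \<le> \<psi>2 x)"
  proof (rule insert.IH)
    show "\<exists>L. L-lipschitz_on UNIV \<psi>2" unfolding \<psi>2_def using lipschitz_on_diff[OF M M1] by blast
    fix x
    show "0 \<le> \<psi>2 x \<and> \<psi>2 x \<le> 1"
      using insert.prems(3)[of x] \<theta>01[of x] by (auto simp: \<psi>2_def \<psi>1_def min_def)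
    assume "\<psi>2 x \<noteq> 0"
    then have "\<theta> x \<noteq> 1" "\<psi> x \<noteq> 0"
      using insert.prems(3)[of x] \<theta>01[of x] by (auto simp: \<psi>2_def \<psi>1_def min_def split: if_splits)
    then show "\<exists>(e, \<theta>)\<in>J. \<theta> x = 1" using insert.prems(4)[of x] j by auto
  qed (use insert.prems(1) in auto)
  then obtain v where v: "admissible E U g v \<psi>2 (\<alpha> / (1 - \<alpha>))"
    "\<And>x. norm (v x - \<psi>2 x *\<^sub>R b) \<le> d * \<psi>2 x" "\<And>x. norm (v x) \<le> \<psi>2 x" by blast
  have sum: "\<psi>1 x + \<psi>2 x = \<psi> x" for x by (simp add: \<psi>2_def)
  have \<psi>1: "0 \<le> \<psi>1 x" for x using insert.prems(3)[of x] \<theta>01[of x] by (auto simp: \<psi>1_def)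
  show ?case
  proof (intro exI[of _ "\<lambda>x. \<psi>1 x *\<^sub>R e + v x"] conjI allI)
    show "admissible E U g (\<lambda>x. \<psi>1 x *\<^sub>R e + v x) \<psi> (\<alpha> / (1 - \<alpha>))"
      using admissible_add[OF adm1 v(1)] by (simp add: sum)
    fix x
    have "(\<psi>1 x *\<^sub>R e + v x) - \<psi> x *\<^sub>R b = \<psi>1 x *\<^sub>R (e - b) + (v x - \<psi>2 x *\<^sub>R b)"
      by (simp add: \<psi>2_def algebra_simps)
    also have "norm \<dots> \<le> norm (\<psi>1 x *\<^sub>R (e - b)) + norm (v x - \<psi>2 x *\<^sub>R b)" by (rule norm_triangle_ineq)
    also have "\<dots> \<le> \<psi>1 x * d + d * \<psi>2 x"
      using e(3) v(2)[of x] \<psi>1[of x] by (intro add_mono) (auto intro: mult_left_mono)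
    also have "\<dots> = d * \<psi> x" by (simp add: \<psi>2_def algebra_simps)
    finally show "norm (\<psi>1 x *\<^sub>R e + v x - \<psi> x *\<^sub>R b) \<le> d * \<psi> x" .
    have "norm (\<psi>1 x *\<^sub>R e + v x) \<le> norm (\<psi>1 x *\<^sub>R e) + norm (v x)" by (rule norm_triangle_ineq)
    also have "\<dots> \<le> \<psi>1 x + \<psi>2 x" using e(2) v(3)[of x] \<psi>1[of x] by simp
    finally show "norm (\<psi>1 x *\<^sub>R e + v x) \<le> \<psi> x" by (simp add: sum)
  qed
qed

text \<open>The support of \<psi> lies in a compact set, and each point of that set has a
  neighbourhood on which some cutoff in a null region is 1. Finitely many of these neighbourhoods
  reduce to the finite case.\<close>

lemma admissible_field:
  fixes F :: "'a::euclidean_space set"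
  assumes E: "E = F \<inter> U" "closed F" "open U" and g: "exhaustion U g"
    and \<alpha>: "0 < \<alpha>" "\<alpha> \<le> 1/2"
    and A: "\<And>e. e \<in> A \<Longrightarrow> norm e = 1 \<and> norm (e - b) \<le> d"
    and \<psi>: "cutoff_in (\<Union>e\<in>A. null_region E U \<alpha> e) \<psi>"
  shows "\<exists>v. admissible E U g v \<psi> (\<alpha> / (1 - \<alpha>)) \<and> (\<forall>x. norm (v x - \<psi> x *\<^sub>R b) \<le> d * \<psi> x \<and> norm (v x) \<le> \<psi> x)"
proof -
  obtain K where K: "compact K" "K \<subseteq> (\<Union>e\<in>A. null_region E U \<alpha> e)" "\<And>x. x \<notin> K \<Longrightarrow> \<psi> x = 0"
    using \<psi> unfolding cutoff_in_def by metis
  define P where "P = {(e, \<theta>). e \<in> A \<and> cutoff_in (null_region E U \<alpha> e) \<theta>}"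
  define \<V> where "\<V> = {V. open V \<and> (\<exists>(e, \<theta>)\<in>P. \<forall>x\<in>V. \<theta> x = 1)}"
  have "K \<subseteq> \<Union>\<V>"
  proof
    fix x assume "x \<in> K"
    then obtain e where e: "e \<in> A" "x \<in> null_region E U \<alpha> e" using K(2) by blast
    obtain h where h: "exhaustion (null_region E U \<alpha> e) h"
      using exhaustion_exists[OF open_null_region[OF E(3)]] by blast
    have hx: "h x > 0" using exhaustionD(4)[OF h] e(2) by simp
    \<comment> \<open>Then \<open>2 / c = h x / 2\<close>, so \<open>x\<close> lies in the open set
      \<open>?V\<close>, on which the cutoff equals 1.\<close>
    define c where "c = 4 / h x"
    have c: "c > 0" using hx by (simp add: c_def)
    let ?V = "{y. 2 / c < h y}"
    have "open ?V"
      using lipschitz_on_continuous_on[OF exhaustionD(1)[OF h]] by (intro open_Collect_less continuous_intros)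
    moreover have "tent (c * h y) = 1" if "y \<in> ?V" for y
      using that c by (simp add: tent_def field_simps)
    moreover have "x \<in> ?V" using hx by (simp add: c_def)
    ultimately show "x \<in> \<Union>\<V>"
      using cutoff_in_tent[OF h c] e(1) unfolding \<V>_def P_def
      by (intro UnionI[of ?V]) (auto intro!: exI[of _ e] exI[of _ "\<lambda>y. tent (c * h y)"])
  qed
  then obtain T where T: "T \<subseteq> \<V>" "finite T" "K \<subseteq> \<Union>T"
    by (rule compactE[OF K(1)]) (simp add: \<V>_def)
  have "\<exists>p. p \<in> P \<and> (\<forall>x\<in>V. snd p x = 1)" if "V \<in> T" for V
  proof -
    have "V \<in> \<V>" using T(1) that by blast
    then show ?thesis by (simp add: \<V>_def case_prod_beta Bex_def)
  qed
  then obtain p where p: "\<And>V. V \<in> T \<Longrightarrow> p V \<in> P \<and> (\<forall>x\<in>V. snd (p V) x = 1)" by metis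
  show ?thesis
  proof (rule admissible_field_finite[OF E g \<alpha> A])
    show "finite (p ` T)" using T(2) by simp
    show "e \<in> A \<and> cutoff_in (null_region E U \<alpha> e) \<theta>" if "(e, \<theta>) \<in> p ` T" for e \<theta>
      using that p unfolding P_def by force
    show "\<exists>L. L-lipschitz_on UNIV \<psi>" "\<And>x. 0 \<le> \<psi> x \<and> \<psi> x \<le> 1" using \<psi> by (auto simp: cutoff_in_def)
    show "\<exists>(e, \<theta>)\<in>p ` T. \<theta> x = 1" if "\<psi> x \<noteq> 0" for x
    proof -
      have "x \<in> K" using K(3) that by blast
      then obtain V where V: "V \<in> T" "x \<in> V" using T(3) by blast
      then show ?thesis using p[OF V(1)] by (intro bexI[of _ "p V"]) (auto simp: case_prod_beta)
    qed
  qed auto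
qed

text \<open>For nonnegative \<open>h\<close> the shell vanishes unless \<open>h x\<close> lies
  between \<open>1 / 2 ^ (l + 1)\<close> and \<open>2 / 2 ^ l\<close>. Being consecutive differences
  of one sequence, the shells at a point telescope and add up to at most 1.\<close>

definition shell :: "('a \<Rightarrow> real) \<Rightarrow> nat \<Rightarrow> 'a \<Rightarrow> real" where
  "shell h l x = tent (2 ^ Suc l * h x) - tent (2 ^ l * h x)"

lemma shell_bounds: "h x \<ge> 0 \<Longrightarrow> 0 \<le> shell h l x" "shell h l x \<le> 1"
  using tent_mono[of "2 ^ l * h x" "2 ^ Suc l * h x"] tent_bounds[of "2 ^ Suc l * h x"] tent_bounds[of "2 ^ l * h x"]
  unfolding shell_def by auto

lemma cutoff_in_shell:
  assumes h: "exhaustion W h"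
  shows "cutoff_in W (shell h l)"
  unfolding cutoff_in_def
proof (intro conjI)
  show "\<exists>L. L-lipschitz_on UNIV (shell h l)"
    unfolding shell_def[abs_def]
    using lipschitz_on_diff[OF tent_scaled_lipschitz[OF h, of "2 ^ Suc l"] tent_scaled_lipschitz[OF h, of "2 ^ l"]]
    by (intro exI) simp
  show "\<forall>x. 0 \<le> shell h l x \<and> shell h l x \<le> 1" using shell_bounds(1)[of h _ l] shell_bounds(2)[of h l] exhaustionD(2)[OF h] by simp
  obtain C where C: "compact C" "C \<subseteq> W" "\<And>x. x \<notin> C \<Longrightarrow> tent (2 ^ Suc l * h x) = 0"
    using cutoff_in_tent[OF h, of "2 ^ Suc l"] unfolding cutoff_in_def by auto
  have "shell h l x = 0" if "x \<notin> C" for x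
    using C(3)[OF that] shell_bounds(1)[of h x l, OF exhaustionD(2)[OF h]] tent_bounds(1)[of "2 ^ l * h x"]
    unfolding shell_def by linarith
  then show "\<exists>C. compact C \<and> C \<subseteq> W \<and> (\<forall>x. x \<notin> C \<longrightarrow> shell h l x = 0)" using C by blast
qed

lemma sum_shell_le: "(\<Sum>l<N. shell h l x) \<le> 1"
proof -
  have "(\<Sum>l<N. shell h l x) = tent (2 ^ N * h x) - tent (2 ^ 0 * h x)"
    unfolding shell_def by (rule sum_lessThan_telescope)
  then show ?thesis using tent_bounds(2)[of "2 ^ N * h x"] tent_bounds(1)[of "2 ^ 0 * h x"] by linarith
qed

text \<open>For the largest \<open>m\<close> with \<open>2 ^ m * h x \<le> 1\<close>, the shells
  \<open>m\<close> and \<open>Suc m\<close> add up to 1, so one of them is at least one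
  half.\<close>

lemma shell_half:
  assumes "0 < h x" "h x \<le> 1"
  shows "\<exists>l. shell h l x \<ge> 1/2"
proof -
  have "\<exists>n. 1 < 2 ^ n * h x"
  proof -
    obtain n where "1 / h x < 2 ^ n" using real_arch_pow[of 2 "1 / h x"] by auto
    then show ?thesis using assms(1) by (auto simp: field_simps)
  qed
  define n where "n = (LEAST n. 1 < 2 ^ n * h x)"
  have n: "1 < 2 ^ n * h x" unfolding n_def using \<open>\<exists>n. _\<close> by (rule LeastI_ex)
  have n0: "n \<noteq> 0" using n assms(2) by (cases n) auto
  then obtain m where m: "n = Suc m" by (cases n) auto
  have "\<not> 1 < 2 ^ m * h x" using not_less_Least[of m "\<lambda>n. 1 < 2 ^ n * h x"] m unfolding n_def by auto
  then have "tent (2 ^ m * h x) = 0" by (simp add: tent_def)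
  moreover have "tent (2 ^ Suc (Suc m) * h x) = 1" using n m by (simp add: tent_def)
  ultimately have "shell h m x + shell h (Suc m) x = 1" by (simp add: shell_def)
  then show ?thesis by (metis add_mono_thms_linordered_field(5) field_sum_of_halves not_less order_less_irrefl)
qed

text \<open>An initial segment of the pairing is contained in a square, because a code dominates
  both components.\<close>

lemma sum_prod_decode_le:
  fixes a :: "nat \<Rightarrow> nat \<Rightarrow> real"
  assumes "\<And>m l. 0 \<le> a m l"
  shows "(\<Sum>k<N. a (fst (prod_decode k)) (snd (prod_decode k))) \<le> (\<Sum>m<N. \<Sum>l<N. a m l)"
proof -
  have inj: "inj_on prod_decode {..<N}" by (rule inj_prod_decode)
  have "(\<Sum>k<N. a (fst (prod_decode k)) (snd (prod_decode k))) = (\<Sum>p\<in>prod_decode ` {..<N}. a (fst p) (snd p))"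
    by (simp add: sum.reindex[OF inj])
  also have "\<dots> \<le> (\<Sum>p\<in>{..<N} \<times> {..<N}. a (fst p) (snd p))"
  proof (rule sum_mono2)
    show "prod_decode ` {..<N} \<subseteq> {..<N} \<times> {..<N}"
    proof
      fix p assume "p \<in> prod_decode ` {..<N}"
      then obtain k where k: "k < N" "p = prod_decode k" by blast
      then have "prod_encode p = k" by simp
      then show "p \<in> {..<N} \<times> {..<N}"
        using k(1) le_prod_encode_1[of "fst p" "snd p"] le_prod_encode_2[of "snd p" "fst p"] by (cases p) auto
    qed
  qed (use assms in auto)
  also have "\<dots> = (\<Sum>m<N. \<Sum>l<N. a m l)" by (simp add: sum.cartesian_product case_prod_beta)
  finally show ?thesis .
qed

text \<open>Stage \<open>m\<close> codes a direction \<open>b m\<close> from a countable dense set,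
  a precision \<open>d m\<close> and, through its size, an aperture \<open>\<alpha> m\<close>. Its
  weights are the shells of the region \<open>W m\<close> where some direction within
  \<open>d m\<close> of \<open>b m\<close> is null. Over all shells the error of a stage is at most
  \<open>\<eta>' m\<close>, which is summable, and every direction is approximated at infinitely
  many stages.\<close>

lemma oscillation_plan:
  fixes F :: "'a::euclidean_space set"
  assumes E: "E = F \<inter> U" "closed F" "open U" and g: "exhaustion U g"
  obtains v :: "nat \<Rightarrow> 'a \<Rightarrow> 'a" and \<psi> :: "nat \<Rightarrow> 'a \<Rightarrow> real" and \<eta> :: "nat \<Rightarrow> real"
  where "\<And>k. admissible E U g (v k) (\<psi> k) (\<eta> k)" "\<And>k x. 0 \<le> \<psi> k x" "\<And>k x. \<psi> k x \<le> 1"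
    "\<And>k x. norm (v k x) \<le> 1" "\<And>k. 0 \<le> \<eta> k" "\<And>N x. (\<Sum>k<N. \<eta> k * \<psi> k x) \<le> 2"
    "\<And>x e \<delta> N. x \<in> E \<Longrightarrow> e \<in> null_dirs E x \<Longrightarrow> norm e = 1 \<Longrightarrow> \<delta> > 0 \<Longrightarrow>
       \<exists>k\<ge>N. \<psi> k x \<ge> 1/2 \<and> norm (v k x - \<psi> k x *\<^sub>R e) \<le> \<delta>"
proof -
  obtain D :: "'a set" where D: "countable D" "\<And>X. open X \<Longrightarrow> X \<noteq> {} \<Longrightarrow> \<exists>d\<in>D. d \<in> X"
    using countable_dense_setE by blast
  have Dne: "D \<noteq> {}" using D(2)[of UNIV] by auto
  define b where "b m = from_nat_into D (fst (prod_decode m))" for m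
  define d where "d m = 1 / (1 + real (snd (prod_decode m)))" for m
  define \<alpha> :: "nat \<Rightarrow> real" where "\<alpha> m = (1/2) ^ (m + 2)" for m
  have \<alpha>: "0 < \<alpha> m" "\<alpha> m \<le> 1/2" for m
  proof -
    have "(1/2::real) ^ (m + 1) \<le> 1" by (rule power_le_one) auto
    then show "0 < \<alpha> m" "\<alpha> m \<le> 1/2" by (auto simp: \<alpha>_def)
  qed
  define A where "A m = {e. norm e = 1 \<and> norm (e - b m) \<le> d m}" for m
  define W where "W m = (\<Union>e\<in>A m. null_region E U (\<alpha> m) e)" for m
  have "open (W m)" for m unfolding W_def using open_null_region[OF E(3)] by blast
  then have "\<exists>h. exhaustion (W m) h" for m by (rule exhaustion_exists)
  then obtain h where h: "\<And>m. exhaustion (W m) (h m)" by metis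
  define \<eta>' where "\<eta>' m = \<alpha> m / (1 - \<alpha> m)" for m
  have \<eta>': "0 \<le> \<eta>' m" "\<eta>' m \<le> (1/2) ^ m" for m
  proof -
    show "0 \<le> \<eta>' m" using \<alpha>[of m] by (simp add: \<eta>'_def)
    have "\<eta>' m \<le> \<alpha> m / (1/2)" unfolding \<eta>'_def using \<alpha>[of m] by (intro divide_left_mono) auto
    also have "\<dots> \<le> (1/2) ^ m" by (simp add: \<alpha>_def)
    finally show "\<eta>' m \<le> (1/2) ^ m" .
  qed
  have "\<exists>v. admissible E U g v (shell (h m) l) (\<eta>' m) \<and>
      (\<forall>x. norm (v x - shell (h m) l x *\<^sub>R b m) \<le> d m * shell (h m) l x \<and> norm (v x) \<le> shell (h m) l x)" for m l
    unfolding \<eta>'_def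
    by (rule admissible_field[OF E g \<alpha>, where A = "A m"])
       (use cutoff_in_shell[OF h] in \<open>auto simp: A_def W_def\<close>)
  then obtain w where w: "\<And>m l. admissible E U g (w m l) (shell (h m) l) (\<eta>' m)"
    "\<And>m l x. norm (w m l x - shell (h m) l x *\<^sub>R b m) \<le> d m * shell (h m) l x"
    "\<And>m l x. norm (w m l x) \<le> shell (h m) l x" by metis
  have sh: "0 \<le> shell (h m) l x" "shell (h m) l x \<le> 1" for m l x
    using shell_bounds(1)[of "h m" x l] shell_bounds(2)[of "h m" l x] exhaustionD(2)[OF h[of m], of x] by auto
  show thesis
  proof (rule that[of "\<lambda>k. w (fst (prod_decode k)) (snd (prod_decode k))"
        "\<lambda>k. shell (h (fst (prod_decode k))) (snd (prod_decode k))" "\<lambda>k. \<eta>' (fst (prod_decode k))"])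
    fix k x
    show "norm (w (fst (prod_decode k)) (snd (prod_decode k)) x) \<le> 1"
      using w(3) sh(2) order_trans by blast
  next
    fix N x
    have "(\<Sum>k<N. \<eta>' (fst (prod_decode k)) * shell (h (fst (prod_decode k))) (snd (prod_decode k)) x)
       \<le> (\<Sum>m<N. \<Sum>l<N. \<eta>' m * shell (h m) l x)"
      by (rule sum_prod_decode_le[of "\<lambda>m l. \<eta>' m * shell (h m) l x"]) (use sh \<eta>' in simp)
    also have "\<dots> = (\<Sum>m<N. \<eta>' m * (\<Sum>l<N. shell (h m) l x))" by (simp add: sum_distrib_left)
    also have "\<dots> \<le> (\<Sum>m<N. (1/2) ^ m * 1)"
      by (intro sum_mono mult_mono \<eta>' sum_shell_le sum_nonneg) (use sh in auto)
    also have "\<dots> \<le> 2" by (simp add: sum_gp_strict)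
    finally show "(\<Sum>k<N. \<eta>' (fst (prod_decode k)) * shell (h (fst (prod_decode k))) (snd (prod_decode k)) x) \<le> 2" .
  next
    fix x e \<delta> N assume x: "x \<in> E" and e: "e \<in> null_dirs E x" "norm e = 1" and \<delta>: "(\<delta>::real) > 0"
    obtain k0 :: nat where k0: "2 / \<delta> < real k0" using reals_Archimedean2 by blast
    \<comment> \<open>\<open>k0\<close> provides the precision, and \<open>k \<ge> N\<close> pushes
      the final index past \<open>N\<close>, since codes dominate their components.\<close>
    define k where "k = max k0 N"
    define \<epsilon> where "\<epsilon> = 1 / (1 + real k)"
    have \<epsilon>: "\<epsilon> > 0" "2 * \<epsilon> \<le> \<delta>"
    proof -
      show "\<epsilon> > 0" by (simp add: \<epsilon>_def)
      have "2 / \<delta> < 1 + real k" using k0 by (simp add: k_def)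
      then show "2 * \<epsilon> \<le> \<delta>" using \<delta> by (simp add: \<epsilon>_def field_simps)
    qed
    obtain b' where b': "b' \<in> D" "b' \<in> ball e \<epsilon>" using D(2)[of "ball e \<epsilon>"] \<epsilon> by auto
    obtain i where i: "from_nat_into D i = b'" using b'(1) D(1) by (metis from_nat_into_to_nat_on)
    define m where "m = prod_encode (i, k)"
    have bm: "b m = b'" "d m = \<epsilon>" by (simp_all add: b_def d_def m_def i \<epsilon>_def)
    have eA: "e \<in> A m" using e(2) b'(2) by (simp add: A_def bm dist_norm less_imp_le)
    \<comment> \<open>A null direction is null at every aperture, so it is harmless that
      \<open>\<alpha> m\<close> is dictated by the code \<open>m\<close>.\<close>
    have "x \<in> null_region E U (\<alpha> m) e"
      using e(1) x E(1) \<alpha>(1)[of m] by (auto simp: null_region_def null_dirs_def)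
    then have "x \<in> W m" using eA by (auto simp: W_def)
    then obtain l where l: "shell (h m) l x \<ge> 1/2"
      using shell_half[of "h m" x] exhaustionD(3,4)[OF h[of m], of x] by auto
    have "norm (w m l x - shell (h m) l x *\<^sub>R e) \<le> norm (w m l x - shell (h m) l x *\<^sub>R b m) + norm (shell (h m) l x *\<^sub>R (b m - e))"
      using norm_triangle_ineq[of "w m l x - shell (h m) l x *\<^sub>R b m" "shell (h m) l x *\<^sub>R (b m - e)"]
      by (simp add: scaleR_right_diff_distrib)
    also have "\<dots> \<le> \<epsilon> * 1 + 1 * \<epsilon>"
    proof (rule add_mono)
      show "norm (w m l x - shell (h m) l x *\<^sub>R b m) \<le> \<epsilon> * 1"
        using w(2)[of m l x] sh[of m l x] \<epsilon>(1) bm(2) by (intro order_trans[OF w(2)] mult_mono) auto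
      show "norm (shell (h m) l x *\<^sub>R (b m - e)) \<le> 1 * \<epsilon>"
        using sh[of m l x] b'(2) \<epsilon>(1) unfolding norm_scaleR bm
        by (intro mult_mono) (auto simp: dist_norm norm_minus_commute)
    qed
    finally have "norm (w m l x - shell (h m) l x *\<^sub>R e) \<le> \<delta>" using \<epsilon>(2) by simp
    moreover have "N \<le> prod_encode (m, l)"
    proof -
      have "N \<le> k" by (simp add: k_def)
      also have "k \<le> m" unfolding m_def by (rule le_prod_encode_2)
      also have "m \<le> prod_encode (m, l)" by (rule le_prod_encode_1)
      finally show ?thesis .
    qed
    ultimately show "\<exists>k\<ge>N. 1/2 \<le> shell (h (fst (prod_decode k))) (snd (prod_decode k)) x \<and>
        norm (w (fst (prod_decode k)) (snd (prod_decode k)) x - shell (h (fst (prod_decode k))) (snd (prod_decode k)) x *\<^sub>R e) \<le> \<delta>"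
      using l by (intro exI[of _ "prod_encode (m, l)"]) simp
  qed (use w(1) sh \<eta>' in auto)
qed

section \<open>Summation of the layers\<close>

lemma locally_lipschitz_bound:
  fixes f :: "'a::real_normed_vector \<Rightarrow> real"
  assumes loc: "\<And>x. \<exists>r>0. \<forall>y\<in>ball x r. \<bar>f y - f x\<bar> \<le> L * norm (y - x)" and L: "L \<ge> 0"
  shows "\<bar>f b - f a\<bar> \<le> L * norm (b - a)"
proof -
  define p where "p s = a + s *\<^sub>R (b - a)" for s
  have pd: "norm (p s - p u) = \<bar>s - u\<bar> * norm (b - a)" for s u
    by (simp add: p_def flip: scaleR_left_diff_distrib)
  have "\<bar>f (p 1) - f (p 0)\<bar> \<le> L * (1 - 0) * norm (b - a)"
  \<comment> \<open>On the segment the estimate is additive over adjacent intervals and holds on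
    short intervals around each point, as the bisection principle requires.\<close>
  proof (rule Bolzano[of 0 1 "\<lambda>s u. \<bar>f (p u) - f (p s)\<bar> \<le> L * (u - s) * norm (b - a)"])
    fix s u w assume "\<bar>f (p u) - f (p s)\<bar> \<le> L * (u - s) * norm (b - a)" "\<bar>f (p w) - f (p u)\<bar> \<le> L * (w - u) * norm (b - a)"
    moreover have "L * (w - s) * norm (b - a) = L * (u - s) * norm (b - a) + L * (w - u) * norm (b - a)"
      by (simp add: algebra_simps)
    ultimately show "\<bar>f (p w) - f (p s)\<bar> \<le> L * (w - s) * norm (b - a)" by linarith
  next
    fix x :: real
    obtain r where r: "r > 0" "\<And>y. y \<in> ball (p x) r \<Longrightarrow> \<bar>f y - f (p x)\<bar> \<le> L * norm (y - p x)"
      using loc by blast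
    define d where "d = r / (norm (b - a) + 1)"
    have d: "d > 0" using r(1) by (simp add: d_def add_nonneg_pos)
    have near: "\<bar>f (p s) - f (p x)\<bar> \<le> L * \<bar>s - x\<bar> * norm (b - a)" if "\<bar>s - x\<bar> < d" for s
    proof -
      have "\<bar>s - x\<bar> * norm (b - a) \<le> \<bar>s - x\<bar> * (norm (b - a) + 1)" by (intro mult_left_mono) auto
      also have "\<dots> < d * (norm (b - a) + 1)" using that by (intro mult_strict_right_mono) (auto simp: add_nonneg_pos)
      also have "\<dots> = r" by (simp add: d_def add_nonneg_eq_0_iff)
      finally have "p s \<in> ball (p x) r" using pd[of s x] by (simp add: dist_norm norm_minus_commute)
      from r(2)[OF this] show ?thesis by (simp add: pd)
    qed
    show "\<exists>d>0. \<forall>s u. s \<le> x \<and> x \<le> u \<and> u - s < d \<longrightarrow> \<bar>f (p u) - f (p s)\<bar> \<le> L * (u - s) * norm (b - a)"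
    proof (intro exI[of _ d] conjI d allI impI)
      fix s u assume su: "s \<le> x \<and> x \<le> u \<and> u - s < d"
      then have "\<bar>f (p s) - f (p x)\<bar> \<le> L * (x - s) * norm (b - a)" "\<bar>f (p u) - f (p x)\<bar> \<le> L * (u - x) * norm (b - a)"
        using near[of s] near[of u] by auto
      moreover have "L * (u - s) * norm (b - a) = L * (u - x) * norm (b - a) + L * (x - s) * norm (b - a)"
        by (simp add: algebra_simps)
      ultimately show "\<bar>f (p u) - f (p s)\<bar> \<le> L * (u - s) * norm (b - a)" by linarith
    qed
  qed simp
  then show ?thesis by (simp add: p_def)
qed

lemma has_derivative_quotient_tendsto:
  fixes f :: "'a::real_normed_vector \<Rightarrow> real"
  assumes D: "(f has_derivative D) (at x)"
  shows "((\<lambda>t. (f (x + t *\<^sub>R y) - f x) / t) \<longlongrightarrow> D y) (at_right 0)"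
proof -
  have "((\<lambda>t. x + t *\<^sub>R y) has_derivative (\<lambda>t. t *\<^sub>R y)) (at 0)"
    by (auto intro!: derivative_eq_intros)
  then have "((\<lambda>t. f (x + t *\<^sub>R y)) has_derivative (\<lambda>t. D (t *\<^sub>R y))) (at 0)"
    using D by (intro has_derivative_compose[of _ _ 0 UNIV f]) auto
  then have "((\<lambda>t. f (x + t *\<^sub>R y)) has_real_derivative D y) (at 0)"
    by (rule has_derivative_imp_has_field_derivative)
       (use linear_scale[OF has_derivative_linear[OF D]] in \<open>simp add: mult.commute\<close>)
  then have "((\<lambda>t. (f (x + t *\<^sub>R y) - f x) / t) \<longlongrightarrow> D y) (at 0)"
    by (simp add: DERIV_def)
  then show ?thesis by (rule tendsto_within_subset) simp
qed

lemma differentiable_quotient_tendsto: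
  fixes f :: "'a::real_normed_vector \<Rightarrow> real"
  assumes "f differentiable (at x)"
  shows "\<exists>l. ((\<lambda>t. (f (x + t *\<^sub>R y) - f x) / t) \<longlongrightarrow> l) (at_right 0)"
  using assms has_derivative_quotient_tendsto unfolding differentiable_def by blast

text \<open>A lower bound for the gap between upper and lower directional derivatives, phrased
  without extended reals so that scaling and adding functions become elementary estimates.\<close>

definition oscillates :: "('a::real_normed_vector \<Rightarrow> real) \<Rightarrow> 'a \<Rightarrow> 'a \<Rightarrow> real \<Rightarrow> bool" where
  "oscillates f x y s \<longleftrightarrow> (\<forall>\<epsilon>>0. \<forall>\<tau>>0. \<exists>t u. 0 < t \<and> t < \<tau> \<and> 0 < u \<and> u < \<tau> \<and>
     s - \<epsilon> \<le> (f (x + t *\<^sub>R y) - f x) / t - (f (x + u *\<^sub>R y) - f x) / u)"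

text \<open>\<open>t k\<close> is the working scale of stage \<open>k\<close>: the layers before
  \<open>k\<close> look linear on it because \<open>t k \<le> \<rho> j\<close> for
  \<open>j < k\<close>, while layer \<open>k\<close> and all later ones are too low to be seen at
  this scale. The bound on field sums reflects alternating signs; the 4 is twice the error bound 2
  of \<open>oscillation_plan\<close>, as every field occurs twice.\<close>

locale layer_sequence =
  fixes E F U :: "'a::euclidean_space set" and g :: "'a \<Rightarrow> real" and v :: "nat \<Rightarrow> 'a \<Rightarrow> 'a"
    and \<psi> :: "nat \<Rightarrow> 'a \<Rightarrow> real" and \<eta> t \<rho> :: "nat \<Rightarrow> real" and \<phi> :: "nat \<Rightarrow> 'a \<Rightarrow> real"
    and V W :: "nat \<Rightarrow> 'a set"
  assumes E: "E = F \<inter> U" "closed F" "open U" and g: "exhaustion U g"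
    and V0: "V 0 = U" and VSuc: "V (Suc k) = W k \<inter> (\<Union>x\<in>E. ball x ((1/2)^k))"
    and t: "0 < t k" "t 0 \<le> 1" "t (Suc k) \<le> t k / 2" "t (Suc k) \<le> \<rho> k"
    and layer: "layer E (V k) g (v k) (\<psi> k) (\<eta> k) (t k * (1/2)^k) ((1/2)^k) (\<phi> k) (W k) (\<rho> k)"
    and \<psi>: "0 \<le> \<psi> k x" "\<psi> k x \<le> 1" and \<eta>: "0 \<le> \<eta> k"
    and v_sum: "norm (\<Sum>j<n. v j x) \<le> 1" and err_sum: "(\<Sum>j<n. \<eta> j * \<psi> j x) \<le> 4"
begin

definition f :: "'a \<Rightarrow> real" where "f x = (\<Sum>k. \<phi> k x)"

definition partial :: "nat \<Rightarrow> 'a \<Rightarrow> real" where "partial n x = (\<Sum>k<n. \<phi> k x)"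

lemma t_decseq: "j \<le> k \<Longrightarrow> t k \<le> t j"
proof (rule lift_Suc_antimono_le[of t])
  show "t (Suc n) \<le> t n" for n using t(1,3)[of n] by simp
qed

lemma t_le_power: "t k \<le> (1/2)^k"
proof (induction k)
  case (Suc k) then show ?case using t(3)[of k] by simp
qed (use t(2) in simp)

lemma t_le_\<rho>: "j < k \<Longrightarrow> t k \<le> \<rho> j"
  using t_decseq[of "Suc j" k] t(4)[of j] by simp

lemma V_decseq: "j \<le> k \<Longrightarrow> V k \<subseteq> V j"
proof (rule lift_Suc_antimono_le[of V])
  show "V (Suc n) \<subseteq> V n" for n using layerD(6)[OF layer[of n]] VSuc[of n] by blast
qed

lemma E_subset_V: "E \<subseteq> V k"
proof (cases k)
  case 0 then show ?thesis using V0 E(1) by simp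
next
  case (Suc n) 
  have "x \<in> (\<Union>x\<in>E. ball x ((1/2)^n))" if "x \<in> E" for x
    using that by (intro UN_I[of x]) auto
  then show ?thesis using Suc layerD(5)[OF layer[of n]] VSuc[of n] by auto
qed

lemma \<phi>_zero_near:
  assumes "x \<notin> V k" shows "\<exists>r>0. \<forall>y\<in>ball x r. \<phi> k y = 0"
proof -
  obtain D where D: "compact D" "D \<subseteq> V k" "\<And>x. x \<notin> D \<Longrightarrow> \<phi> k x = 0" using layerD(2)[OF layer[of k]] by blast
  then have "open (-D)" "x \<in> -D" using assms compact_imp_closed by auto
  then obtain r where "r > 0" "ball x r \<subseteq> -D" using open_contains_ball by blast
  then show ?thesis using D(3) by blast
qed

lemma \<phi>_zero: "x \<notin> V k \<Longrightarrow> \<phi> k x = 0"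
  using \<phi>_zero_near[of x k] by auto

lemma \<phi>_bound: "\<bar>\<phi> k x\<bar> \<le> t k * (1/2)^k * (g x)\<^sup>2"
  using layerD(3)[OF layer] .

lemma \<phi>_bound': "\<bar>\<phi> k x\<bar> \<le> t k * (1/2)^k"
proof -
  have "(g x)\<^sup>2 \<le> 1" using exhaustionD(2,3)[OF g, of x] by (simp add: power_le_one)
  then have "t k * (1/2)^k * (g x)\<^sup>2 \<le> t k * (1/2)^k * 1" using t(1)[of k] by (intro mult_left_mono) auto
  then show ?thesis using \<phi>_bound[of k x] by simp
qed

lemma geometric_tail: "(\<lambda>j. c * (1/2)^(j + n)) sums (2 * c * (1/2)^n)" for c :: real
  using sums_mult[OF geometric_sums[of "1/2::real"], of "c * (1/2)^n"] by (simp add: power_add mult_ac)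

text \<open>Divided by a distance comparable to \<open>t n\<close>, the tail is of order
  \<open>(1/2)^n\<close>, so the layers from \<open>n\<close> on do not show at that scale.\<close>

lemma tail_bound: "\<bar>f x - partial n x\<bar> \<le> 2 * t n * (1/2)^n" and f_summable: "summable (\<lambda>k. \<phi> k x)"
proof -
  have b: "\<bar>\<phi> (j + n) x\<bar> \<le> t n * (1/2)^(j + n)" for j n
  proof -
    have "t (j + n) * (1/2)^(j + n) \<le> t n * (1/2)^(j + n)" by (intro mult_right_mono t_decseq) auto
    then show ?thesis using \<phi>_bound'[of "j + n" x] by linarith
  qed
  have s: "summable (\<lambda>j. \<phi> (j + n) x)" for n
    by (rule summable_comparison_test'[OF sums_summable[OF geometric_tail[of "t n" n]], of 0]) (use b in auto)
  from s[of 0] show 1: "summable (\<lambda>k. \<phi> k x)" by simp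
  have "f x - partial n x = (\<Sum>j. \<phi> (j + n) x)"
    unfolding f_def partial_def using suminf_split_initial_segment[OF 1, of n] by simp
  moreover have "norm (\<Sum>j. \<phi> (j + n) x) \<le> (\<Sum>j. t n * (1/2)^(j + n))"
    by (rule norm_suminf_le) (use b sums_summable[OF geometric_tail] in auto)
  ultimately show "\<bar>f x - partial n x\<bar> \<le> 2 * t n * (1/2)^n"
    using sums_unique[OF geometric_tail[of "t n" n]] by simp
qed

lemma f_gauge_bound: "\<bar>f x\<bar> \<le> 2 * (g x)\<^sup>2"
proof -
  have "norm (\<Sum>j. \<phi> j x) \<le> (\<Sum>j. (g x)\<^sup>2 * (1/2)^(j + 0))"
  proof (rule norm_suminf_le)
    fix j
    have "t j * (1/2)^j * (g x)\<^sup>2 \<le> 1 * (1/2)^j * (g x)\<^sup>2"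
      using t_decseq[of 0 j] t(2) by (intro mult_right_mono) auto
    then show "norm (\<phi> j x) \<le> (g x)\<^sup>2 * (1/2)^(j + 0)" using \<phi>_bound[of j x] by (simp add: mult.commute)
  qed (rule sums_summable[OF geometric_tail])
  then show ?thesis using sums_unique[OF geometric_tail[of "(g x)\<^sup>2" 0]] by (simp add: f_def)
qed

lemma f_bounded: "\<bar>f x\<bar> \<le> 2"
proof -
  have "(g x)\<^sup>2 \<le> 1" using exhaustionD(2,3)[OF g, of x] by (simp add: power_le_one)
  then show ?thesis using f_gauge_bound[of x] by simp
qed

section \<open>Linear and Lipschitz behaviour of the partial sums\<close>

lemma partial_differentiable: "partial n differentiable (at x)"
  unfolding partial_def[abs_def] using layerD(1)[OF layer] by (intro differentiable_sum) auto

text \<open>A point of \<open>V n\<close> lies in \<open>W j\<close> for every \<open>j < n\<close>,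
  where layer \<open>j\<close> has a controlled gradient, and \<open>t n \<le> \<rho> j\<close>
  brings the points within the reach of that control. Setting the first \<open>m\<close> layers
  aside serves \<open>quotient_estimate\<close>.\<close>

lemma partial_linear_near:
  assumes x: "x \<in> V n" and yz: "y \<in> ball x (t n)" "z \<in> ball x (t n)" and m: "m \<le> n"
  shows "\<bar>(partial n y - partial n z) - (partial m y - partial m z) - (\<Sum>j=m..<n. v j x) \<bullet> (y - z)\<bar>
    \<le> (\<Sum>j=m..<n. \<eta> j * \<psi> j x + (1/2)^j) * norm (y - z)"
proof -
  have split: "partial n u = partial m u + (\<Sum>j=m..<n. \<phi> j u)" for u
    unfolding partial_def using m by (metis atLeast0LessThan le0 sum.atLeastLessThan_concat)
  have "(partial n y - partial n z) - (partial m y - partial m z) - (\<Sum>j=m..<n. v j x) \<bullet> (y - z)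
     = (\<Sum>j=m..<n. \<phi> j y - \<phi> j z - v j x \<bullet> (y - z))"
    unfolding split by (simp add: sum_subtractf inner_sum_left)
  also have "\<bar>\<dots>\<bar> \<le> (\<Sum>j=m..<n. \<bar>\<phi> j y - \<phi> j z - v j x \<bullet> (y - z)\<bar>)" by (rule sum_abs)
  also have "\<dots> \<le> (\<Sum>j=m..<n. (\<eta> j * \<psi> j x + (1/2)^j) * norm (y - z))"
  proof (rule sum_mono)
    fix j assume j: "j \<in> {m..<n}"
    have "x \<in> W j" using x V_decseq[of "Suc j" n] VSuc[of j] j by auto
    moreover have "y \<in> ball x (\<rho> j)" "z \<in> ball x (\<rho> j)" using yz t_le_\<rho>[of j n] j by auto
    ultimately show "\<bar>\<phi> j y - \<phi> j z - v j x \<bullet> (y - z)\<bar> \<le> (\<eta> j * \<psi> j x + (1/2)^j) * norm (y - z)"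
      by (rule layerD(9)[OF layer])
  qed
  finally show ?thesis by (simp add: sum_distrib_right)
qed

text \<open>The constant is 1 from the field sum, 4 from the weighted errors and 2 from the
  geometric series.\<close>

lemma partial_lipschitz_near:
  assumes x: "x \<in> V n" and yz: "y \<in> ball x (t n)" "z \<in> ball x (t n)"
  shows "\<bar>partial n y - partial n z\<bar> \<le> 7 * norm (y - z)"
proof -
  have "(\<Sum>j=0..<n. (1/2::real)^j) \<le> 2" by (simp add: atLeast0LessThan sum_gp_strict)
  then have "(\<Sum>j=0..<n. \<eta> j * \<psi> j x + (1/2)^j) \<le> 6"
    using err_sum[where n = n and x = x] by (simp add: sum.distrib atLeast0LessThan)
  then have "(\<Sum>j=0..<n. \<eta> j * \<psi> j x + (1/2)^j) * norm (y - z) \<le> 6 * norm (y - z)"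
    by (intro mult_right_mono) auto
  moreover have "\<bar>(\<Sum>j=0..<n. v j x) \<bullet> (y - z)\<bar> \<le> 1 * norm (y - z)"
    using v_sum[where n = n and x = x]
    by (intro order_trans[OF Cauchy_Schwarz_ineq2] mult_right_mono) (auto simp: atLeast0LessThan)
  ultimately show ?thesis using partial_linear_near[OF x yz, of 0] by (simp add: partial_def)
qed

text \<open>Each layer from \<open>m\<close> on vanishes off a compact subset of its
  \<open>V k\<close>, and these sets decrease, so it vanishes near \<open>x\<close>.\<close>

lemma partial_constant_near:
  assumes x: "x \<notin> V m" and m: "m \<le> n"
  shows "\<exists>r>0. \<forall>y\<in>ball x r. partial n y = partial m y"
  using m
proof (induction n rule: dec_induct)
  case base
  show ?case by (rule exI[of _ 1]) simp
next
  case (step n)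
  obtain r where r: "r > 0" "\<forall>y\<in>ball x r. partial n y = partial m y" using step.IH by blast
  have "x \<notin> V n" using x V_decseq[OF step(1)] by blast
  then obtain s where s: "s > 0" "\<forall>y\<in>ball x s. \<phi> n y = 0" using \<phi>_zero_near by blast
  show ?case using r s by (intro exI[of _ "min r s"]) (auto simp: partial_def)
qed

text \<open>At each point at most one layer is uncontrolled. If \<open>x\<close> lies in
  \<open>V k\<close> but not in \<open>V (Suc k)\<close>, the layers before \<open>k\<close>
  contribute 7, layer \<open>k\<close> contributes 3 by its plain Lipschitz bound, and the later
  ones vanish near \<open>x\<close>.\<close>

lemma partial_lipschitz: "\<bar>partial n b - partial n a\<bar> \<le> 10 * norm (b - a)"
proof (rule locally_lipschitz_bound)
  fix x
  show "\<exists>r>0. \<forall>y\<in>ball x r. \<bar>partial n y - partial n x\<bar> \<le> 10 * norm (y - x)"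
  proof (cases "x \<in> V n")
    case True
    have "\<bar>partial n y - partial n x\<bar> \<le> 10 * norm (y - x)" if "y \<in> ball x (t n)" for y
      using partial_lipschitz_near[OF True that, of x] t(1)[of n] norm_ge_zero[of "y - x"] by simp
    then show ?thesis using t(1)[of n] by blast
  next
    case False
    define m where "m = (LEAST m. x \<notin> V m)"
    have m: "x \<notin> V m" unfolding m_def using False by (rule LeastI)
    have mn: "m \<le> n" unfolding m_def using False by (rule Least_le)
    obtain r where r: "r > 0" "\<And>y. y \<in> ball x r \<Longrightarrow> partial n y = partial m y"
      using partial_constant_near[OF m mn] by blast
    show ?thesis
    proof (cases m)
      case 0
      then have "\<bar>partial n y - partial n x\<bar> \<le> 10 * norm (y - x)" if "y \<in> ball x r" for y
        using r(2)[OF that] r(2)[of x] r(1) by (simp add: partial_def)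
      then show ?thesis using r(1) by blast
    next
      case (Suc k)
      then have k: "x \<in> V k" using not_less_Least[of k "\<lambda>m. x \<notin> V m"] unfolding m_def by auto
      have "\<bar>partial n y - partial n x\<bar> \<le> 10 * norm (y - x)" if y: "y \<in> ball x (min r (t m))" for y
      proof -
        have tm: "t m > 0" "t m \<le> t k" "t m \<le> \<rho> k" using t(1)[of m] t_decseq[of k m] t(4)[of k] Suc by auto
        have "\<bar>partial k y - partial k x\<bar> \<le> 7 * norm (y - x)"
          using y tm by (intro partial_lipschitz_near[OF k]) auto
        moreover have "\<bar>\<phi> k y - \<phi> k x\<bar> \<le> 3 * norm (y - x)"
        proof -
          have "\<bar>\<phi> k y - \<phi> k x\<bar> \<le> (2 * \<psi> k x + (1/2)^k) * norm (y - x)"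
            using y tm by (intro layerD(8)[OF layer]) auto
          also have "\<dots> \<le> 3 * norm (y - x)"
            using \<psi>(2)[of k x] power_le_one[of "1/2::real" k] by (intro mult_right_mono) auto
          finally show ?thesis .
        qed
        moreover have "partial m u = partial k u + \<phi> k u" for u by (simp add: partial_def Suc)
        ultimately show ?thesis using r(2)[of y] r(2)[of x] r(1) y by simp
      qed
      then show ?thesis using r(1) t(1)[of m] by (intro exI[of _ "min r (t m)"]) auto
    qed
  qed
qed simp

lemma f_lipschitz: "10-lipschitz_on UNIV f"
proof (rule lipschitz_onI)
  fix a b
  have lim: "(\<lambda>n. partial n x) \<longlonglongrightarrow> f x" for x
    unfolding partial_def f_def by (rule summable_LIMSEQ[OF f_summable])
  have "(\<lambda>n. \<bar>partial n a - partial n b\<bar>) \<longlonglongrightarrow> \<bar>f a - f b\<bar>"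
    by (intro tendsto_intros lim)
  then have "\<bar>f a - f b\<bar> \<le> 10 * norm (a - b)"
    by (rule LIMSEQ_le_const2) (use partial_lipschitz in blast)
  then show "dist (f a) (f b) \<le> 10 * dist a b" by (simp add: dist_norm)
qed simp

text \<open>Outside \<open>U\<close> the quadratic gauge bound forces a zero derivative. Inside
  \<open>U\<close> but off \<open>F\<close>, the sets \<open>V k\<close> eventually miss a
  neighbourhood of \<open>x\<close>, so the sum is locally finite.\<close>

lemma f_differentiable:
  assumes x: "x \<notin> E"
  shows "f differentiable (at x)"
proof (cases "x \<in> U")
  case False
  have fx: "f x = 0" using f_gauge_bound[of x] exhaustion_outside(1)[OF g False] by simp
  have "(f has_derivative (\<lambda>h. 0)) (at x)"
    unfolding has_derivative_at
  proof
    show "(\<lambda>h. norm (f (x + h) - f x - 0) / norm h) \<midarrow>0\<rightarrow> 0"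
    proof (rule Lim_null_comparison)
      have "norm (norm (f (x + h) - f x - 0) / norm h) \<le> 2 * norm h" for h
      proof (cases "h = 0")
        case False
        have "g (x + h) \<le> norm h" using exhaustion_outside(2)[OF g \<open>x \<notin> U\<close>, of "x + h"] by simp
        then have "(g (x + h))\<^sup>2 \<le> (norm h)\<^sup>2" using exhaustionD(2)[OF g] by (intro power_mono) auto
        then have "\<bar>f (x + h)\<bar> \<le> 2 * norm h * norm h" using f_gauge_bound[of "x + h"] by (simp add: power2_eq_square)
        then show ?thesis using False fx by (simp add: divide_le_eq)
      qed simp
      then show "\<forall>\<^sub>F h in at 0. norm (norm (f (x + h) - f x - 0) / norm h) \<le> 2 * norm h"
        by (rule always_eventually[OF allI])
      show "((\<lambda>h::'a. 2 * norm h) \<longlongrightarrow> 0) (at 0)"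
        by (intro tendsto_mult_right_zero tendsto_norm_zero tendsto_ident_at)
    qed
  qed simp
  then show ?thesis by (auto simp: differentiable_def)
next
  case True
  then have "open (U - F)" "x \<in> U - F" using E x by auto
  then obtain r where r: "r > 0" "ball x r \<subseteq> U - F" using open_contains_ball by blast
  obtain n where n: "(1/2::real)^n < r / 2" using real_arch_pow_inv[of "r/2" "1/2"] r(1) by auto
  have out: "y \<notin> V (Suc n)" if y: "y \<in> ball x (r/2)" for y
  proof
    assume "y \<in> V (Suc n)"
    then obtain z where z: "z \<in> E" "dist z y < (1/2)^n" by (auto simp: VSuc)
    have "dist x z \<le> dist x y + dist z y" using dist_triangle2[of x z y] .
    then have "z \<in> ball x r" using y z(2) n by simp
    then show False using r(2) z(1) E(1) by blast
  qed
  have eq: "f y = partial (Suc n) y" if y: "y \<in> ball x (r/2)" for y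
  proof -
    have "\<phi> k y = 0" if "k \<notin> {..<Suc n}" for k
      using \<phi>_zero[of y k] out[OF y] V_decseq[of "Suc n" k] that by auto
    then show ?thesis unfolding f_def partial_def by (intro suminf_finite) auto
  qed
  obtain D where "(partial (Suc n) has_derivative D) (at x)"
    using partial_differentiable unfolding differentiable_def by blast
  then have "(f has_derivative D) (at x)"
    by (rule has_derivative_transform_within_open[of _ _ _ _ "ball x (r/2)"]) (use r(1) eq in auto)
  then show ?thesis by (auto simp: differentiable_def)
qed

text \<open>The fixed partial sum \<open>partial p\<close> is merely differentiable at \<open>x\<close>, without uniform modulus; its
  contribution cancels when two scales are compared.\<close>

lemma quotient_estimate:
  assumes x: "x \<in> E" and p: "p \<le> n" and s: "s = t n / (norm y + 1)"
  shows "\<bar>(f (x + s *\<^sub>R y) - f x) / s - (partial p (x + s *\<^sub>R y) - partial p x) / s - (\<Sum>j=p..<n. v j x) \<bullet> y\<bar>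
    \<le> (\<Sum>j=p..<n. \<eta> j * \<psi> j x + (1/2)^j) * norm y + 4 * (norm y + 1) * (1/2)^n"
proof -
  have Y: "norm y + 1 > 0" by (simp add: add_nonneg_pos)
  have s0: "s > 0" using t(1)[of n] Y by (simp add: s)
  \<comment> \<open>Dividing by \<open>norm y + 1\<close> keeps \<open>x + s *\<^sub>R y\<close>
    strictly inside the ball of radius \<open>t n\<close> and avoids division by zero for
    \<open>y = 0\<close>.\<close>
  have sY: "s * (norm y + 1) = t n" using Y by (simp add: s)
  define z where "z = x + s *\<^sub>R y"
  have zx: "z - x = s *\<^sub>R y" by (simp add: z_def)
  have nz: "norm (z - x) = s * norm y" using s0 by (simp add: zx)
  have "s * norm y < t n" using sY s0 by (simp add: distrib_left)
  then have zb: "z \<in> ball x (t n)" "x \<in> ball x (t n)" using nz t(1)[of n] by (auto simp: dist_norm norm_minus_commute)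
  have "x \<in> V n" using x E_subset_V by blast
  define A where "A = (\<Sum>j=p..<n. \<eta> j * \<psi> j x + (1/2)^j)"
  have 1: "\<bar>(partial n z - partial n x) - (partial p z - partial p x) - s * ((\<Sum>j=p..<n. v j x) \<bullet> y)\<bar> \<le> A * (s * norm y)"
    using partial_linear_near[OF \<open>x \<in> V n\<close> zb p] unfolding nz A_def by (simp add: zx)
  have 2: "\<bar>(f z - f x) - (partial n z - partial n x)\<bar> \<le> 4 * t n * (1/2)^n"
    using tail_bound[of z n] tail_bound[of x n] by linarith
  have "\<bar>(f z - f x) - (partial p z - partial p x) - s * ((\<Sum>j=p..<n. v j x) \<bullet> y)\<bar> \<le> A * (s * norm y) + 4 * t n * (1/2)^n"
    using 1 2 by linarith
  also have "\<dots> = s * (A * norm y + 4 * (norm y + 1) * (1/2)^n)"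
    unfolding sY[symmetric] by (simp add: algebra_simps)
  finally have 3: "\<bar>(f z - f x) - (partial p z - partial p x) - s * ((\<Sum>j=p..<n. v j x) \<bullet> y)\<bar> / s \<le> A * norm y + 4 * (norm y + 1) * (1/2)^n"
    using s0 by (simp add: pos_divide_le_eq mult.commute)
  have "(f z - f x) / s - (partial p z - partial p x) / s - (\<Sum>j=p..<n. v j x) \<bullet> y
     = ((f z - f x) - (partial p z - partial p x) - s * ((\<Sum>j=p..<n. v j x) \<bullet> y)) / s"
    using s0 by (simp add: diff_divide_distrib)
  then show ?thesis using 3 s0 unfolding A_def z_def by (simp add: abs_divide)
qed

text \<open>The quotients at the scales of \<open>n\<close> and \<open>Suc n\<close> differ by
  \<open>- (v n x \<bullet> y)\<close> up to small errors, so jumps recurring at arbitrarily late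
  stages give oscillation.\<close>

lemma f_oscillates:
  assumes x: "x \<in> E"
    and jumps: "\<And>\<delta> N. \<delta> > 0 \<Longrightarrow> \<exists>n\<ge>N. c - \<delta> \<le> - (v n x \<bullet> y)"
  shows "oscillates f x y c"
  unfolding oscillates_def
proof (intro allI impI)
  fix \<epsilon> \<tau> :: real assume \<epsilon>: "\<epsilon> > 0" and \<tau>: "\<tau> > 0"
  define Y where "Y = norm y + 1"
  have Y: "Y \<ge> 1" "norm y \<le> Y" by (auto simp: Y_def)
  \<comment> \<open>Each use of \<open>est\<close> below costs three eighths of \<epsilon> and the
    choice of \<open>n\<close> at most one eighth, seven eighths in all.\<close>
  define \<epsilon>1 where "\<epsilon>1 = \<epsilon> / (8 * Y)"
  have \<epsilon>1: "\<epsilon>1 > 0" "\<epsilon>1 * Y = \<epsilon> / 8" using \<epsilon> Y by (auto simp: \<epsilon>1_def)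
  have \<epsilon>1': "\<epsilon>1 \<le> \<epsilon> / 8" using mult_left_mono[OF Y(1), of \<epsilon>1] \<epsilon>1 by simp
  define a where "a j = \<eta> j * \<psi> j x + (1/2)^j" for j
  have a0: "a j \<ge> 0" for j using \<eta>[of j] \<psi>(1)[of j x] by (simp add: a_def)
  have "summable a"
  proof (rule summableI_nonneg_bounded)
    fix n
    have "(\<Sum>j<n. (1/2::real)^j) \<le> 2" by (simp add: sum_gp_strict)
    then show "(\<Sum>j<n. a j) \<le> 6" using err_sum[where n = n and x = x] by (simp add: a_def sum.distrib)
  qed (rule a0)
  \<comment> \<open>\<open>p\<close> is fixed first, uniformly in \<open>n\<close>, because the
    scale \<open>\<tau>1\<close> below depends on \<open>partial p\<close>.\<close>
  then obtain p where p: "\<And>n. \<bar>sum a {p..<n}\<bar> < \<epsilon>1"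
    using \<epsilon>1(1) unfolding summable_Cauchy real_norm_def by blast
  obtain l where "((\<lambda>s. (partial p (x + s *\<^sub>R y) - partial p x) / s) \<longlongrightarrow> l) (at_right 0)"
    using differentiable_quotient_tendsto[OF partial_differentiable] by blast
  then have "\<forall>\<^sub>F s in at_right 0. dist ((partial p (x + s *\<^sub>R y) - partial p x) / s) l < \<epsilon>1"
    using \<epsilon>1(1) by (rule tendstoD)
  then obtain \<tau>1 where \<tau>1: "\<tau>1 > 0" "\<And>s. 0 < s \<Longrightarrow> s < \<tau>1 \<Longrightarrow> \<bar>(partial p (x + s *\<^sub>R y) - partial p x) / s - l\<bar> < \<epsilon>1"
    unfolding eventually_at_right_field dist_real_def by blast
  obtain N0 where N0: "(1/2::real)^N0 < min (min \<tau> \<tau>1) (\<epsilon>1 / 4)"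
    using real_arch_pow_inv[of "min (min \<tau> \<tau>1) (\<epsilon>1 / 4)" "1/2"] \<tau> \<tau>1(1) \<epsilon>1(1) by auto
  obtain n where n: "n \<ge> max p N0" "c - \<epsilon>1 \<le> - (v n x \<bullet> y)" using jumps[OF \<epsilon>1(1)] by blast
  define s where "s k = t k / (norm y + 1)" for k
  have small: "(1/2::real)^k < min (min \<tau> \<tau>1) (\<epsilon>1 / 4)" if "k \<ge> N0" for k
    by (rule le_less_trans[OF power_decreasing[OF that] N0]) auto
  have s: "0 < s k" "s k < \<tau>" "s k < \<tau>1" if "k \<ge> N0" for k
  proof -
    show "0 < s k" using t(1)[of k] Y(1) by (simp add: s_def flip: Y_def)
    have "s k \<le> t k / 1" unfolding s_def using t(1)[of k] Y(1) by (intro divide_left_mono) (auto simp flip: Y_def)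
    then have "s k \<le> (1/2)^k" using t_le_power[of k] by simp
    then show "s k < \<tau>" "s k < \<tau>1" using small[OF that] by auto
  qed
  define Q where "Q k = (f (x + s k *\<^sub>R y) - f x) / s k" for k
  have est: "\<bar>Q k - l - (\<Sum>j=p..<k. v j x) \<bullet> y\<bar> \<le> 3 * (\<epsilon> / 8)" if k: "k \<ge> p" "k \<ge> N0" for k
  proof -
    have "\<bar>Q k - (partial p (x + s k *\<^sub>R y) - partial p x) / s k - (\<Sum>j=p..<k. v j x) \<bullet> y\<bar> \<le> sum a {p..<k} * norm y + 4 * Y * (1/2)^k"
      using quotient_estimate[OF x k(1) s_def] unfolding Q_def a_def Y_def .
    also have "sum a {p..<k} * norm y \<le> \<epsilon>1 * Y"
      using p[of k] \<epsilon>1(1) Y by (intro mult_mono) auto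
    also have "4 * Y * (1/2)^k \<le> 4 * Y * (\<epsilon>1 / 4)"
      using small[OF k(2)] Y(1) by (intro mult_left_mono) auto
    also have "4 * Y * (\<epsilon>1 / 4) = \<epsilon> / 8" using \<epsilon>1(2) by (simp add: mult.commute)
    finally show ?thesis
      using \<tau>1(2)[OF s(1,3)[OF k(2)]] \<epsilon>1' \<epsilon>1(2) by linarith
  qed
  have np: "n \<ge> p" "n \<ge> N0" "Suc n \<ge> p" "Suc n \<ge> N0" using n(1) by auto
  have "(\<Sum>j=p..<Suc n. v j x) \<bullet> y = (\<Sum>j=p..<n. v j x) \<bullet> y + v n x \<bullet> y"
    using np(1) by (simp add: inner_add_left)
  then have "c - \<epsilon> \<le> Q n - Q (Suc n)"
    using est[OF np(1,2)] est[OF np(3,4)] n(2) \<epsilon>1' by linarith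
  then show "\<exists>t u. 0 < t \<and> t < \<tau> \<and> 0 < u \<and> u < \<tau> \<and> c - \<epsilon> \<le> (f (x + t *\<^sub>R y) - f x) / t - (f (x + u *\<^sub>R y) - f x) / u"
    using s[OF np(2)] s[OF np(4)] unfolding Q_def by blast
qed

end

section \<open>Construction on a piece and conclusion\<close>

text \<open>The scale \<open>t (Suc k)\<close> can be chosen only after layer \<open>k\<close> has
  produced \<open>\<rho> k\<close>, so pairs of region and scale are built by dependent
  choice.\<close>

lemma layer_sequence_exists:
  fixes E F U :: "'a::euclidean_space set"
  assumes E: "E = F \<inter> U" "open U"
    and adm: "\<And>k. admissible E U g (v k) (\<psi> k) (\<eta> k)"
  obtains t \<rho> \<phi> V W where "V 0 = U" "\<And>k. V (Suc k) = W k \<inter> (\<Union>x\<in>E. ball x ((1/2)^k))"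
    "\<And>k. 0 < t k" "t 0 \<le> 1" "\<And>k. t (Suc k) \<le> t k / 2" "\<And>k. t (Suc k) \<le> \<rho> k"
    "\<And>k. layer E (V k) g (v k) (\<psi> k) (\<eta> k) (t k * (1/2)^k) ((1/2)^k) (\<phi> k) (W k) (\<rho> k)"
proof -
  define P where "P n st \<longleftrightarrow> open (fst st) \<and> E \<subseteq> fst st \<and> fst st \<subseteq> U \<and> snd st > 0 \<and> (n = 0 \<longrightarrow> fst st = U \<and> snd st \<le> 1)"
    for n :: nat and st :: "'a set \<times> real"
  define Q where "Q n st st' \<longleftrightarrow> (\<exists>\<phi> W \<rho>. layer E (fst st) g (v n) (\<psi> n) (\<eta> n) (snd st * (1/2)^n) ((1/2)^n) \<phi> W \<rho> \<and>
       fst st' = W \<inter> (\<Union>x\<in>E. ball x ((1/2)^n)) \<and> snd st' \<le> snd st / 2 \<and> snd st' \<le> \<rho>)"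
    for n :: nat and st st' :: "'a set \<times> real"
  have "\<exists>st. \<forall>n. P n (st n) \<and> Q n (st n) (st (Suc n))"
  proof (rule dependent_nat_choice)
    show "\<exists>st. P 0 st" using E by (intro exI[of _ "(U, 1)"]) (auto simp: P_def)
    fix st n assume st: "P n st"
    then have "open (fst st) \<and> E \<subseteq> fst st \<and> fst st \<subseteq> U \<and> snd st * (1/2)^n > 0 \<and> (1/2::real)^n > 0"
      by (simp add: P_def)
    then obtain \<phi> W \<rho> where l: "layer E (fst st) g (v n) (\<psi> n) (\<eta> n) (snd st * (1/2)^n) ((1/2)^n) \<phi> W \<rho>"
      using adm[of n, unfolded admissible_def, rule_format, of "fst st" "snd st * (1/2)^n" "(1/2)^n"] by blast
    have "x \<in> (\<Union>x\<in>E. ball x ((1/2)^n))" if "x \<in> E" for x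
      using that by (intro UN_I[of x]) auto
    then have "P (Suc n) (W \<inter> (\<Union>x\<in>E. ball x ((1/2)^n)), min (snd st / 2) \<rho>)"
      using layerD(4-7)[OF l] st unfolding P_def by auto
    moreover have "Q n st (W \<inter> (\<Union>x\<in>E. ball x ((1/2)^n)), min (snd st / 2) \<rho>)"
      unfolding Q_def using l by (intro exI[of _ \<phi>] exI[of _ W] exI[of _ \<rho>]) auto
    ultimately show "\<exists>st'. P (Suc n) st' \<and> Q n st st'" by blast
  qed
  then obtain st where st: "\<And>n. P n (st n)" "\<And>n. Q n (st n) (st (Suc n))" by blast
  obtain \<phi> W \<rho> where l: "\<And>n. layer E (fst (st n)) g (v n) (\<psi> n) (\<eta> n) (snd (st n) * (1/2)^n) ((1/2)^n) (\<phi> n) (W n) (\<rho> n)"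
       "\<And>n. fst (st (Suc n)) = W n \<inter> (\<Union>x\<in>E. ball x ((1/2)^n))"
       "\<And>n. snd (st (Suc n)) \<le> snd (st n) / 2" "\<And>n. snd (st (Suc n)) \<le> \<rho> n"
    using st(2)[unfolded Q_def] by metis
  show thesis
    by (rule that[of "\<lambda>n. fst (st n)" W "\<lambda>n. snd (st n)" \<rho> \<phi>])
       (use l st(1) in \<open>auto simp: P_def\<close>)
qed

lemma piece_function:
  fixes F U :: "'a::euclidean_space set"
  assumes "closed F" "open U"
  shows "\<exists>f. 10-lipschitz_on UNIV f \<and> (\<forall>x. \<bar>f x\<bar> \<le> 2) \<and> (\<forall>x. x \<notin> F \<inter> U \<longrightarrow> f differentiable (at x)) \<and>
    (\<forall>x\<in>F \<inter> U. \<forall>e\<in>null_dirs (F \<inter> U) x. \<forall>y. norm e = 1 \<longrightarrow> 0 \<le> e \<bullet> y \<longrightarrow> oscillates f x y ((e \<bullet> y) / 2))"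
proof -
  define E where "E = F \<inter> U"
  obtain g where g: "exhaustion U g" using exhaustion_exists[OF assms(2)] by blast
  obtain v0 :: "nat \<Rightarrow> 'a \<Rightarrow> 'a" and \<psi>0 \<eta>0 where
    adm0: "\<And>k. admissible E U g (v0 k) (\<psi>0 k) (\<eta>0 k)" and \<psi>0: "\<And>k x. 0 \<le> \<psi>0 k x" "\<And>k x. \<psi>0 k x \<le> 1"
    and v0: "\<And>k x. norm (v0 k x) \<le> 1" and \<eta>0: "\<And>k. 0 \<le> \<eta>0 k" "\<And>N x. (\<Sum>k<N. \<eta>0 k * \<psi>0 k x) \<le> 2"
    and often: "\<And>x e \<delta> N. x \<in> E \<Longrightarrow> e \<in> null_dirs E x \<Longrightarrow> norm e = 1 \<Longrightarrow> \<delta> > 0 \<Longrightarrow>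
       \<exists>k\<ge>N. \<psi>0 k x \<ge> 1/2 \<and> norm (v0 k x - \<psi>0 k x *\<^sub>R e) \<le> \<delta>"
    by (rule oscillation_plan[OF E_def assms g]) (rule that, assumption+)
  \<comment> \<open>Each field is followed by its negative, so an initial sum of fields is either 0
    or a single field.\<close>
  define v where "v k = (if even k then v0 (k div 2) else (\<lambda>x. - v0 (k div 2) x))" for k
  define \<psi> where "\<psi> k = \<psi>0 (k div 2)" for k
  define \<eta> where "\<eta> k = \<eta>0 (k div 2)" for k
  have adm: "admissible E U g (v k) (\<psi> k) (\<eta> k)" for k
    using adm0[of "k div 2"] admissible_minus[OF adm0[of "k div 2"]] by (simp add: v_def \<psi>_def \<eta>_def)
  have "(\<Sum>j<n. v j x) = (if even n then 0 else v0 (n div 2) x)" for n x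
    by (induction n) (auto simp: v_def)
  then have v_sum: "norm (\<Sum>j<n. v j x) \<le> 1" for n x using v0 by simp
  have err_sum: "(\<Sum>j<n. \<eta> j * \<psi> j x) \<le> 4" for n x
  proof -
    have "(\<Sum>j<2 * N. \<eta> j * \<psi> j x) = 2 * (\<Sum>k<N. \<eta>0 k * \<psi>0 k x)" for N
      by (induction N) (auto simp: \<eta>_def \<psi>_def)
    moreover have "(\<Sum>j<n. \<eta> j * \<psi> j x) \<le> (\<Sum>j<2 * n. \<eta> j * \<psi> j x)"
      by (rule sum_mono2) (use \<eta>0 \<psi>0 in \<open>auto simp: \<eta>_def \<psi>_def\<close>)
    ultimately show ?thesis using \<eta>0(2)[where N = n and x = x] by simp
  qed
  obtain t \<rho> \<phi> V W where seq: "V 0 = U" "\<And>k. V (Suc k) = W k \<inter> (\<Union>x\<in>E. ball x ((1/2)^k))"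
    "\<And>k. 0 < t k" "t 0 \<le> 1" "\<And>k. t (Suc k) \<le> t k / 2" "\<And>k. t (Suc k) \<le> \<rho> k"
    "\<And>k. layer E (V k) g (v k) (\<psi> k) (\<eta> k) (t k * (1/2)^k) ((1/2)^k) (\<phi> k) (W k) (\<rho> k)"
    by (rule layer_sequence_exists[OF E_def assms(2) adm]) (rule that, assumption+)
  interpret layer_sequence E F U g v \<psi> \<eta> t \<rho> \<phi> V W
    by unfold_locales
       (rule E_def assms g seq v_sum err_sum | simp add: \<psi>_def \<eta>_def \<psi>0 \<eta>0)+
  have "oscillates f x y ((e \<bullet> y) / 2)"
    if x: "x \<in> E" and e: "e \<in> null_dirs E x" "norm e = 1" "0 \<le> e \<bullet> y" for x e y
  proof (rule f_oscillates[OF x])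
    fix \<delta> :: real and N assume \<delta>: "\<delta> > 0"
    define \<delta>' where "\<delta>' = \<delta> / (norm y + 1)"
    have Y: "norm y + 1 > 0" by (simp add: add_nonneg_pos)
    then have \<delta>': "\<delta>' > 0" using \<delta> by (simp add: \<delta>'_def)
    obtain k where k: "k \<ge> N" "\<psi>0 k x \<ge> 1/2" "norm (v0 k x - \<psi>0 k x *\<^sub>R e) \<le> \<delta>'"
      using often[OF x e(1,2) \<delta>'] by blast
    have "\<bar>(v0 k x - \<psi>0 k x *\<^sub>R e) \<bullet> y\<bar> \<le> \<delta>' * norm y"
      using k(3) by (intro order_trans[OF Cauchy_Schwarz_ineq2] mult_right_mono) auto
    also have "\<dots> \<le> \<delta>' * (norm y + 1)" using \<delta>' by (intro mult_left_mono) auto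
    also have "\<dots> = \<delta>" using Y by (simp add: \<delta>'_def)
    finally have "\<psi>0 k x * (e \<bullet> y) - \<delta> \<le> v0 k x \<bullet> y" by (simp add: inner_diff_left)
    moreover have "1/2 * (e \<bullet> y) \<le> \<psi>0 k x * (e \<bullet> y)" using k(2) e(3) by (rule mult_right_mono)
    \<comment> \<open>The odd index carries \<open>- v0 k\<close>, which has the sign that
      \<open>f_oscillates\<close> asks for.\<close>
    ultimately have "(e \<bullet> y) / 2 - \<delta> \<le> - (v (Suc (2 * k)) x \<bullet> y)" by (simp add: v_def)
    then show "\<exists>n\<ge>N. (e \<bullet> y) / 2 - \<delta> \<le> - (v n x \<bullet> y)" using k(1) by (intro exI[of _ "Suc (2 * k)"]) auto
  qed
  then show ?thesis
    using f_lipschitz f_bounded f_differentiable unfolding E_def by blast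
qed

section \<open>Series of Lipschitz functions\<close>

lemma lipschitz_derivative_bound:
  fixes f :: "'a::real_normed_vector \<Rightarrow> real"
  assumes L: "L-lipschitz_on UNIV f" and D: "(f has_derivative D) (at x)"
  shows "norm (D y) \<le> norm y * L"
proof (rule tendsto_upperbound[OF tendsto_norm[OF has_derivative_quotient_tendsto[OF D]]])
  show "\<forall>\<^sub>F t in at_right 0. norm ((f (x + t *\<^sub>R y) - f x) / t) \<le> norm y * L"
    unfolding eventually_at_right_field
  proof (intro exI[of _ 1] conjI allI impI)
    fix t :: real assume "0 < t"
    moreover have "norm (f (x + t *\<^sub>R y) - f x) \<le> L * norm (t *\<^sub>R y)"
      using lipschitz_on_normD[OF L, of "x + t *\<^sub>R y" x] by simp
    ultimately show "norm ((f (x + t *\<^sub>R y) - f x) / t) \<le> norm y * L"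
      by (simp add: abs_divide pos_divide_le_eq mult_ac)
  qed simp
qed simp

text \<open>The Lipschitz constants bound both the increments of the tail and the norms of its
  derivatives, so differentiability of the terms at the single point \<open>x\<close>
  suffices.\<close>

lemma differentiable_suminf:
  fixes h :: "nat \<Rightarrow> 'a::real_normed_vector \<Rightarrow> real"
  assumes L: "\<And>n. (L n)-lipschitz_on UNIV (h n)" "summable L" and s: "\<And>x. summable (\<lambda>n. h n x)"
    and d: "\<And>n. h n differentiable (at x)"
  shows "(\<lambda>x. \<Sum>n. h n x) differentiable (at x)"
proof -
  obtain D where D: "\<And>n. (h n has_derivative D n) (at x)" using d unfolding differentiable_def by metis
  define B where "B n = Blinfun (D n)" for n
  have B: "blinfun_apply (B n) = D n" for n
    unfolding B_def using has_derivative_bounded_linear[OF D] by (rule bounded_linear_Blinfun_apply)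
  have L0: "L n \<ge> 0" for n using L(1) lipschitz_on_nonneg by blast
  have nB: "norm (B n) \<le> L n" for n
    by (rule norm_blinfun_bound[OF L0]) (use lipschitz_derivative_bound[OF L(1) D] B in \<open>simp add: mult.commute\<close>)
  have sB: "summable (\<lambda>n. norm (B n))" by (rule summable_comparison_test'[OF L(2), of 0]) (use nB in simp)
  define T where "T = (\<Sum>n. B n)"
  have "((\<lambda>x. \<Sum>n. h n x) has_derivative T) (at x)"
    unfolding has_derivative_at_alt
  proof (intro conjI allI impI)
    show "bounded_linear T" by (rule blinfun.bounded_linear_right)
    fix e :: real assume e: "e > 0"
    \<comment> \<open>One third of \<open>e\<close> goes to each of the finite sum, the tail
      increments and the tail derivatives.\<close>
    obtain N where N: "\<And>n. n \<ge> N \<Longrightarrow> norm (\<Sum>i. L (i + n)) < e / 3"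
      using suminf_exist_split[OF _ L(2), of "e/3"] e by auto
    define R where "R = (\<Sum>i. L (i + N))"
    have R: "R \<le> e / 3" using N[of N] by (simp add: R_def)
    have sL: "summable (\<lambda>i. L (i + N))" using L(2) by (simp add: summable_iff_shift)
    have "((\<lambda>x. \<Sum>n<N. h n x) has_derivative (\<lambda>v. \<Sum>n<N. D n v)) (at x)"
      by (rule has_derivative_sum) (rule D)
    then obtain r where r: "r > 0" "\<And>y. norm (y - x) < r \<Longrightarrow>
        norm ((\<Sum>n<N. h n y) - (\<Sum>n<N. h n x) - (\<Sum>n<N. D n (y - x))) \<le> e / 3 * norm (y - x)"
      unfolding has_derivative_at_alt using e by (metis divide_pos_pos zero_less_numeral)
    have "norm ((\<Sum>n. h n y) - (\<Sum>n. h n x) - T (y - x)) \<le> e * norm (y - x)" if y: "norm (y - x) < r" for y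
    proof -
      have sp: "(\<Sum>n. h n u) = (\<Sum>n. h (n + N) u) + (\<Sum>n<N. h n u)" for u
        by (rule suminf_split_initial_segment[OF s])
      have sN: "summable (\<lambda>n. h (n + N) u)" for u
        by (rule summable_ignore_initial_segment[OF s])
      have "T = (\<Sum>n. B (n + N)) + (\<Sum>n<N. B n)"
        unfolding T_def by (rule suminf_split_initial_segment[OF summable_norm_cancel[OF sB]])
      then have Tsp: "T (y - x) = (\<Sum>n. B (n + N)) (y - x) + (\<Sum>n<N. D n (y - x))"
        by (simp add: plus_blinfun.rep_eq blinfun.sum_left B)
      have "norm (\<Sum>n. B (n + N)) \<le> R" unfolding R_def
        by (rule norm_suminf_le[OF nB sL])
      then have 1: "norm ((\<Sum>n. B (n + N)) (y - x)) \<le> e / 3 * norm (y - x)"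
        using R by (intro order_trans[OF norm_blinfun] mult_right_mono) auto
      have "(\<Sum>n. h (n + N) y) - (\<Sum>n. h (n + N) x) = (\<Sum>n. h (n + N) y - h (n + N) x)"
        by (rule suminf_diff[OF sN sN])
      also have "norm \<dots> \<le> (\<Sum>n. L (n + N) * norm (y - x))"
        by (rule norm_suminf_le) (use lipschitz_on_normD[OF L(1)] summable_mult2[OF sL] in auto)
      also have "\<dots> = R * norm (y - x)" unfolding R_def by (rule suminf_mult2[OF sL, symmetric])
      also have "\<dots> \<le> e / 3 * norm (y - x)" using R by (intro mult_right_mono) auto
      finally have 2: "norm ((\<Sum>n. h (n + N) y) - (\<Sum>n. h (n + N) x)) \<le> e / 3 * norm (y - x)" .
      show ?thesis using 1 2 r(2)[OF y] unfolding sp Tsp real_norm_def by linarith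
    qed
    then show "\<exists>d>0. \<forall>y. norm (y - x) < d \<longrightarrow> norm ((\<Sum>n. h n y) - (\<Sum>n. h n x) - T (y - x)) \<le> e * norm (y - x)"
      using r(1) by blast
  qed
  then show ?thesis by (auto simp: differentiable_def)
qed

section \<open>Oscillation and directional derivatives\<close>

lemma oscillates_not_differentiable:
  assumes o: "oscillates f x y s" and s: "s > 0"
  shows "\<not> f differentiable (at x)"
proof
  assume "f differentiable (at x)"
  then obtain l where "((\<lambda>t. (f (x + t *\<^sub>R y) - f x) / t) \<longlongrightarrow> l) (at_right 0)"
    using differentiable_quotient_tendsto by blast
  then have "\<forall>\<^sub>F t in at_right 0. dist ((f (x + t *\<^sub>R y) - f x) / t) l < s / 4"
    using s by (intro tendstoD) auto
  then obtain \<tau> where \<tau>: "\<tau> > 0" "\<And>t. 0 < t \<Longrightarrow> t < \<tau> \<Longrightarrow> \<bar>(f (x + t *\<^sub>R y) - f x) / t - l\<bar> < s / 4"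
    unfolding eventually_at_right_field dist_real_def by blast
  obtain t u where tu: "0 < t" "t < \<tau>" "0 < u" "u < \<tau>"
    "s - s / 4 \<le> (f (x + t *\<^sub>R y) - f x) / t - (f (x + u *\<^sub>R y) - f x) / u"
    using o[unfolded oscillates_def, rule_format, of "s / 4" \<tau>] s \<tau>(1) by auto
  then show False using \<tau>(2)[OF tu(1,2)] \<tau>(2)[OF tu(3,4)] s by linarith
qed

text \<open>The quotients of \<open>h\<close> converge, so at two small scales they differ by less
  than half of \<epsilon>.\<close>

lemma oscillates_add_differentiable:
  assumes o: "oscillates f x y s" and d: "h differentiable (at x)" and c: "c > 0"
  shows "oscillates (\<lambda>x. c * f x + h x) x y (c * s)"
  unfolding oscillates_def
proof (intro allI impI)
  fix \<epsilon> \<tau> :: real assume \<epsilon>: "\<epsilon> > 0" and \<tau>: "\<tau> > 0"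
  obtain l where "((\<lambda>t. (h (x + t *\<^sub>R y) - h x) / t) \<longlongrightarrow> l) (at_right 0)"
    using differentiable_quotient_tendsto[OF d] by blast
  then have "\<forall>\<^sub>F t in at_right 0. dist ((h (x + t *\<^sub>R y) - h x) / t) l < \<epsilon> / 4"
    using \<epsilon> by (intro tendstoD) auto
  then obtain \<tau>1 where \<tau>1: "\<tau>1 > 0" "\<And>t. 0 < t \<Longrightarrow> t < \<tau>1 \<Longrightarrow> \<bar>(h (x + t *\<^sub>R y) - h x) / t - l\<bar> < \<epsilon> / 4"
    unfolding eventually_at_right_field dist_real_def by blast
  obtain t u where tu: "0 < t" "t < min \<tau> \<tau>1" "0 < u" "u < min \<tau> \<tau>1"
    "s - \<epsilon> / (2 * c) \<le> (f (x + t *\<^sub>R y) - f x) / t - (f (x + u *\<^sub>R y) - f x) / u"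
    using o[unfolded oscillates_def, rule_format, of "\<epsilon> / (2 * c)" "min \<tau> \<tau>1"] \<epsilon> c \<tau> \<tau>1(1) by auto
  have q: "(c * f (x + t *\<^sub>R y) + h (x + t *\<^sub>R y) - (c * f x + h x)) / t =
     c * ((f (x + t *\<^sub>R y) - f x) / t) + (h (x + t *\<^sub>R y) - h x) / t" for t
    by (simp add: diff_divide_distrib add_divide_distrib right_diff_distrib)
  have "c * (s - \<epsilon> / (2 * c)) \<le> c * ((f (x + t *\<^sub>R y) - f x) / t - (f (x + u *\<^sub>R y) - f x) / u)"
    using tu(5) c by (intro mult_left_mono) auto
  then have "c * s - \<epsilon> / 2 \<le> c * ((f (x + t *\<^sub>R y) - f x) / t) - c * ((f (x + u *\<^sub>R y) - f x) / u)"
    using c by (simp add: right_diff_distrib)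
  moreover have "\<bar>(h (x + t *\<^sub>R y) - h x) / t - l\<bar> < \<epsilon> / 4" "\<bar>(h (x + u *\<^sub>R y) - h x) / u - l\<bar> < \<epsilon> / 4"
    using tu(2,4) by (simp_all only: \<tau>1(2)[OF tu(1)] \<tau>1(2)[OF tu(3)] min_less_iff_conj)
  ultimately have "c * s - \<epsilon> \<le> (c * f (x + t *\<^sub>R y) + h (x + t *\<^sub>R y) - (c * f x + h x)) / t
      - (c * f (x + u *\<^sub>R y) + h (x + u *\<^sub>R y) - (c * f x + h x)) / u"
    unfolding q by linarith
  then show "\<exists>t u. 0 < t \<and> t < \<tau> \<and> 0 < u \<and> u < \<tau> \<and>
     c * s - \<epsilon> \<le> (c * f (x + t *\<^sub>R y) + h (x + t *\<^sub>R y) - (c * f x + h x)) / t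
      - (c * f (x + u *\<^sub>R y) + h (x + u *\<^sub>R y) - (c * f x + h x)) / u"
    using tu by auto
qed

text \<open>Finiteness of both derivatives makes their extended real difference an ordinary
  difference of reals.\<close>

lemma dir_derivs_finite:
  assumes L: "L-lipschitz_on UNIV f"
  obtains u l where "upper_dir_deriv f x y = ereal u" "lower_dir_deriv f x y = ereal l" "l \<le> u"
proof -
  have b: "\<forall>\<^sub>F t in at_right 0. \<bar>(f (x + t *\<^sub>R y) - f x) / t\<bar> \<le> L * norm y"
    unfolding eventually_at_right_field
  proof (intro exI[of _ 1] conjI allI impI)
    fix t :: real assume "0 < t"
    moreover have "norm (f (x + t *\<^sub>R y) - f x) \<le> L * norm (t *\<^sub>R y)"
      using lipschitz_on_normD[OF L, of "x + t *\<^sub>R y" x] by simp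
    ultimately show "\<bar>(f (x + t *\<^sub>R y) - f x) / t\<bar> \<le> L * norm y"
      by (simp add: abs_divide pos_divide_le_eq mult_ac)
  qed simp
  have up: "upper_dir_deriv f x y \<le> ereal (L * norm y)"
    unfolding upper_dir_deriv_def
    by (rule Limsup_bounded, rule eventually_mono[OF b]) (metis abs_le_D1 ereal_less_eq(3))
  have lo: "ereal (- (L * norm y)) \<le> lower_dir_deriv f x y"
    unfolding lower_dir_deriv_def
    by (rule Liminf_bounded, rule eventually_mono[OF b]) (metis abs_le_D2 ereal_less_eq(3) minus_le_iff)
  have le: "lower_dir_deriv f x y \<le> upper_dir_deriv f x y"
    unfolding lower_dir_deriv_def upper_dir_deriv_def by (rule Liminf_le_Limsup) simp
  from up lo le show thesis
    by (cases "upper_dir_deriv f x y"; cases "lower_dir_deriv f x y") (auto intro: that)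
qed

lemma oscillates_dir_derivs:
  assumes o: "oscillates f x y s" and d: "upper_dir_deriv f x y = ereal u" "lower_dir_deriv f x y = ereal l"
  shows "s \<le> u - l"
proof (rule ccontr)
  assume "\<not> s \<le> u - l"
  then have s: "u - l < s" by simp
  \<comment> \<open>\<epsilon> is lost three times: once for each derivative and once in the
    oscillation.\<close>
  define \<epsilon> where "\<epsilon> = (s - (u - l)) / 3"
  have \<epsilon>: "\<epsilon> > 0" using s by (simp add: \<epsilon>_def)
  have "\<forall>\<^sub>F t in at_right 0. ereal ((f (x + t *\<^sub>R y) - f x) / t) < ereal (u + \<epsilon>)"
    by (rule Limsup_lessD) (use d(1) \<epsilon> in \<open>simp add: upper_dir_deriv_def\<close>)
  moreover have "\<forall>\<^sub>F t in at_right 0. ereal (l - \<epsilon>) < ereal ((f (x + t *\<^sub>R y) - f x) / t)"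
    by (rule less_LiminfD) (use d(2) \<epsilon> in \<open>simp add: lower_dir_deriv_def\<close>)
  ultimately have "\<forall>\<^sub>F t in at_right 0. (f (x + t *\<^sub>R y) - f x) / t < u + \<epsilon> \<and> l - \<epsilon> < (f (x + t *\<^sub>R y) - f x) / t"
    by eventually_elim simp
  then obtain \<tau> where \<tau>: "\<tau> > 0" "\<And>t. 0 < t \<Longrightarrow> t < \<tau> \<Longrightarrow> (f (x + t *\<^sub>R y) - f x) / t < u + \<epsilon> \<and> l - \<epsilon> < (f (x + t *\<^sub>R y) - f x) / t"
    unfolding eventually_at_right_field by blast
  obtain t w where tw: "0 < t" "t < \<tau>" "0 < w" "w < \<tau>"
    "s - \<epsilon> \<le> (f (x + t *\<^sub>R y) - f x) / t - (f (x + w *\<^sub>R y) - f x) / w"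
    using o[unfolded oscillates_def, rule_format, OF \<epsilon> \<tau>(1)] by blast
  have "s < (u - l) + 3 * \<epsilon>" using \<tau>(2)[OF tw(1,2)] \<tau>(2)[OF tw(3,4)] tw(5) by linarith
  moreover have "3 * \<epsilon> = s - (u - l)" by (simp add: \<epsilon>_def)
  ultimately show False by linarith
qed

text \<open>The cone depends only on the ray of \<open>e\<close>, so passing to unit vectors loses
  nothing.\<close>

lemma null_dirs_normalize:
  assumes "e \<in> null_dirs S x" "e \<noteq> 0"
  shows "(1 / norm e) *\<^sub>R e \<in> null_dirs S x"
proof -
  define c where "c = 1 / norm e"
  have c: "c > 0" using assms(2) by (simp add: c_def)
  have "dir_cone (c *\<^sub>R e) \<alpha> = dir_cone e \<alpha>" for \<alpha>
  proof -
    have "\<alpha> * norm z * norm (c *\<^sub>R e) \<le> z \<bullet> (c *\<^sub>R e) \<longleftrightarrow> c * (\<alpha> * norm z * norm e) \<le> c * (z \<bullet> e)" for z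
      using c by (simp add: mult_ac)
    then show ?thesis using c by (simp add: dir_cone_def mult.assoc)
  qed
  then have "width (c *\<^sub>R e) \<alpha> T = width e \<alpha> T" for \<alpha> T
    using c by (simp add: width_def width_open_def cone_curves_def)
  then show ?thesis using assms(1) by (simp add: null_dirs_def c_def)
qed

text \<open>Cutting a set into pieces can only enlarge the null directions at a point, so
  oscillation obtained on a piece serves the whole set.\<close>

lemma null_dirs_antimono: "S \<subseteq> T \<Longrightarrow> null_dirs T x \<subseteq> null_dirs S x"
proof
  fix e assume sub: "S \<subseteq> T" and e: "e \<in> null_dirs T x"
  have "\<exists>r>0. width e \<epsilon> (ball x r \<inter> S) = 0" if \<epsilon>: "\<epsilon> > 0" for \<epsilon>
  proof -
    obtain r where "r > 0" "width e \<epsilon> (ball x r \<inter> T) = 0" using e \<epsilon> by (auto simp: null_dirs_def)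
    then show ?thesis using width_zero_subset[of "ball x r \<inter> S" "ball x r \<inter> T"] sub by blast
  qed
  then show "e \<in> null_dirs S x" by (simp add: null_dirs_def)
qed

lemma zero_in_null_dirs: "0 \<in> null_dirs S x"
  by (auto simp: null_dirs_def width_def intro: exI[of _ 1])

text \<open>At a point of \<open>P n\<close> disjointness makes all summands but the n-th
  differentiable, and so is their sum. The constant on \<open>P n\<close> is the weight
  \<open>(1/2)^n\<close> times the factor one half of \<open>piece_function\<close>.\<close>

lemma countable_pieces_function:
  fixes P :: "nat \<Rightarrow> 'a::euclidean_space set"
  assumes P: "\<And>n. \<exists>F U. closed F \<and> open U \<and> P n = F \<inter> U" and disj: "disjoint_family P"
  shows "\<exists>f L. L-lipschitz_on UNIV f \<and> (\<forall>x. x \<notin> (\<Union>n. P n) \<longrightarrow> f differentiable (at x)) \<and>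
    (\<forall>n. \<exists>c>0. \<forall>x\<in>P n. \<forall>e\<in>null_dirs (P n) x. \<forall>y. norm e = 1 \<longrightarrow> 0 \<le> e \<bullet> y \<longrightarrow> oscillates f x y (c * (e \<bullet> y)))"
proof -
  have "\<forall>n. \<exists>f. 10-lipschitz_on UNIV f \<and> (\<forall>x. \<bar>f x\<bar> \<le> 2) \<and> (\<forall>x. x \<notin> P n \<longrightarrow> f differentiable (at x)) \<and>
    (\<forall>x\<in>P n. \<forall>e\<in>null_dirs (P n) x. \<forall>y. norm e = 1 \<longrightarrow> 0 \<le> e \<bullet> y \<longrightarrow> oscillates f x y ((e \<bullet> y) / 2))"
    using P piece_function by metis
  then obtain \<phi> where \<phi>: "\<And>n. 10-lipschitz_on UNIV (\<phi> n)" "\<And>n x. \<bar>\<phi> n x\<bar> \<le> 2"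
    "\<And>n x. x \<notin> P n \<Longrightarrow> \<phi> n differentiable (at x)"
    "\<And>n x e y. x \<in> P n \<Longrightarrow> e \<in> null_dirs (P n) x \<Longrightarrow> norm e = 1 \<Longrightarrow> 0 \<le> e \<bullet> y \<Longrightarrow> oscillates (\<phi> n) x y ((e \<bullet> y) / 2)"
    by metis
  define h where "h n x = (1/2)^n * \<phi> n x" for n x
  define f where "f x = (\<Sum>n. h n x)" for x
  define L where "L n = (1/2::real)^n * 10" for n
  have L: "(L n)-lipschitz_on UNIV (h n)" for n
    unfolding L_def h_def[abs_def] by (rule lipschitz_on_cmult_real_nonneg[OF \<phi>(1)]) simp
  have sL: "summable L" unfolding L_def by (intro summable_mult2 summable_geometric) simp
  have hb: "norm (h n x) \<le> (1/2)^n * 2" for n x using \<phi>(2)[of n x] by (simp add: h_def abs_mult)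
  have sh: "summable (\<lambda>n. h n x)" for x
    by (rule summable_comparison_test'[of "\<lambda>n. (1/2::real)^n * 2" 0])
       (use hb in \<open>auto intro!: summable_mult2 summable_geometric\<close>)
  have hd: "h n differentiable (at x)" if "x \<notin> P n" for n x
    unfolding h_def[abs_def] using \<phi>(3)[OF that] by simp
  have "(suminf L)-lipschitz_on UNIV f"
  proof (rule lipschitz_onI)
    fix x y
    have "norm (\<Sum>n. h n x - h n y) \<le> (\<Sum>n. L n * norm (x - y))"
      by (rule norm_suminf_le) (use lipschitz_on_normD[OF L] summable_mult2[OF sL] in auto)
    then show "dist (f x) (f y) \<le> suminf L * dist x y"
      unfolding f_def dist_norm by (simp add: suminf_diff[OF sh sh] suminf_mult2[OF sL])
  qed (use suminf_nonneg[OF sL] in \<open>simp add: L_def\<close>)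
  moreover have "f differentiable (at x)" if "x \<notin> (\<Union>n. P n)" for x
    unfolding f_def[abs_def] by (rule differentiable_suminf[OF L sL sh]) (use hd that in auto)
  moreover have "oscillates f x y ((1/2)^Suc n * (e \<bullet> y))"
    if x: "x \<in> P n" and e: "e \<in> null_dirs (P n) x" "norm e = 1" "0 \<le> e \<bullet> y" for n x e y
  proof -
    define r where "r m = (if m = n then (\<lambda>x. 0) else h m)" for m
    have sr: "summable (\<lambda>m. r m z)" for z
      by (rule summable_comparison_test'[OF summable_mult2[of "\<lambda>n. (1/2::real)^n" 2], of 0])
         (use hb[of _ z] in \<open>auto simp: r_def intro!: summable_geometric\<close>)
    have rd: "(\<lambda>x. \<Sum>m. r m x) differentiable (at x)"
    proof (rule differentiable_suminf[OF _ sL sr])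
      have "(L m)-lipschitz_on UNIV (\<lambda>x::'a. 0::real)" for m
        by (rule lipschitz_on_mono[OF lipschitz_on_constant]) (auto simp: L_def)
      then show "(L m)-lipschitz_on UNIV (r m)" for m using L[of m] by (simp add: r_def)
      show "r m differentiable (at x)" for m
        using hd[of x m] disj x by (auto simp: r_def disjoint_family_on_def)
    qed
    have "f z = (1/2)^n * \<phi> n z + (\<Sum>m. r m z)" for z
    proof -
      have "(\<lambda>m. (if m = n then h n z else 0) + r m z) sums (h n z + (\<Sum>m. r m z))"
        by (intro sums_add sums_single summable_sums[OF sr])
      moreover have "(if m = n then h n z else 0) + r m z = h m z" for m by (simp add: r_def)
      ultimately have "(\<lambda>m. h m z) sums (h n z + (\<Sum>m. r m z))" by simp
      then show ?thesis unfolding f_def by (simp add: sums_iff h_def)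
    qed
    then have "f = (\<lambda>z. (1/2)^n * \<phi> n z + (\<Sum>m. r m z))" by (rule ext)
    moreover have "oscillates (\<lambda>z. (1/2)^n * \<phi> n z + (\<Sum>m. r m z)) x y ((1/2)^n * ((e \<bullet> y) / 2))"
      by (rule oscillates_add_differentiable[OF \<phi>(4)[OF x e] rd]) simp
    ultimately show ?thesis by simp
  qed
  ultimately show ?thesis
    by (intro exI[of _ f] exI[of _ "suminf L"]) (auto intro!: exI[of _ "(1/2)^Suc _"])
qed

theorem corollary1p10:
  fixes E :: "'i \<Rightarrow> (real ^ 'n) set" and I :: "'i set"
  assumes "countable I"
    and "disjoint_family_on E I"
    and "\<And>k. k \<in> I \<Longrightarrow> fsigma (E k)"
    and "\<And>k. k \<in> I \<Longrightarrow> cone_unrectifiable (E k)"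
  shows "\<exists>f :: real ^ 'n \<Rightarrow> real.
    (\<exists>L. L-lipschitz_on UNIV f) \<and>
    (\<forall>x. x \<notin> (\<Union>k\<in>I. E k) \<longrightarrow> f differentiable (at x)) \<and>
    (\<forall>k\<in>I. \<forall>x\<in>E k.
       (\<exists>c>0. \<forall>y. upper_dir_deriv f x y - lower_dir_deriv f x y
                    \<ge> ereal c * (SUP e \<in> null_dirs (E k) x \<inter> cball 0 1. ereal (e \<bullet> y))) \<and>
       \<not> f differentiable (at x))"
proof -
  have "\<exists>K :: nat \<Rightarrow> (real ^ 'n) set. (\<forall>j. closed (K j)) \<and> E k = (\<Union>j. K j)" if "k \<in> I" for k
    using assms(3)[OF that] unfolding fsigma.simps by blast
  then obtain K :: "'i \<Rightarrow> nat \<Rightarrow> (real ^ 'n) set" where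
    K: "\<And>k j. k \<in> I \<Longrightarrow> closed (K k j)" "\<And>k. k \<in> I \<Longrightarrow> E k = (\<Union>j. K k j)" by metis
  \<comment> \<open>Removing the earlier closed sets makes the pieces disjoint and keeps them of the
    form closed intersected with open.\<close>
  define Q where "Q k j = K k j \<inter> - (\<Union>i<j. K k i)" for k j
  \<comment> \<open>The pieces of all \<open>E k\<close> are listed in one sequence; codes that
    belong to no index in \<open>I\<close> get the empty set, as \<open>I\<close> may be
    finite.\<close>
  define P where "P n = (if fst (prod_decode n) \<in> to_nat_on I ` I
      then Q (from_nat_into I (fst (prod_decode n))) (snd (prod_decode n)) else {})" for n
  have Qsub: "Q k j \<subseteq> E k" if "k \<in> I" for k j using K(2)[OF that] by (auto simp: Q_def)
  have Qcov: "\<exists>j. x \<in> Q k j" if "k \<in> I" "x \<in> E k" for k x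
  proof -
    have ex: "\<exists>j. x \<in> K k j" using that K(2) by auto
    define j where "j = (LEAST j. x \<in> K k j)"
    have "x \<in> K k j" unfolding j_def using ex by (rule LeastI_ex)
    moreover have "x \<notin> K k i" if "i < j" for i using that not_less_Least unfolding j_def by blast
    ultimately show ?thesis by (auto simp: Q_def)
  qed
  have Qdisj: "i = j" if "x \<in> Q k i" "x \<in> Q k j" for x k i j
    using that unfolding Q_def by (meson ComplD IntD1 IntD2 UN_I lessThan_iff linorder_neqE_nat)
  have Pcode: "P (prod_encode (to_nat_on I k, j)) = Q k j" if "k \<in> I" for k j
    using that assms(1) by (simp add: P_def)
  have Pfrom: "\<exists>k\<in>I. \<exists>j. n = prod_encode (to_nat_on I k, j) \<and> x \<in> Q k j" if x: "x \<in> P n" for x n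
  proof -
    have "fst (prod_decode n) \<in> to_nat_on I ` I" using x by (auto simp: P_def split: if_splits)
    then obtain k where k: "k \<in> I" "fst (prod_decode n) = to_nat_on I k" by blast
    then have n: "n = prod_encode (to_nat_on I k, snd (prod_decode n))"
      by (metis prod.collapse prod_decode_inverse)
    then show ?thesis using x k(1) Pcode[OF k(1)] by metis
  qed
  have "\<exists>F U. closed F \<and> open U \<and> P n = F \<inter> U" for n
  proof (cases "P n = {}")
    case True
    then show ?thesis by (intro exI[of _ "{}"] exI[of _ UNIV]) simp
  next
    case False
    then obtain k j where "k \<in> I" "n = prod_encode (to_nat_on I k, j)" using Pfrom by blast
    then show ?thesis using Pcode[of k j] K(1)[of k]
      by (intro exI[of _ "K k j"] exI[of _ "- (\<Union>i<j. K k i)"]) (auto simp: Q_def intro!: open_Compl)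
  qed
  moreover have "disjoint_family P"
  proof -
    have "m = n" if mn: "x \<in> P m" "x \<in> P n" for x m n
    proof -
      obtain k i where k: "k \<in> I" "m = prod_encode (to_nat_on I k, i)" "x \<in> Q k i" using Pfrom[OF mn(1)] by blast
      obtain l j where l: "l \<in> I" "n = prod_encode (to_nat_on I l, j)" "x \<in> Q l j" using Pfrom[OF mn(2)] by blast
      have "x \<in> E k" "x \<in> E l" using k l Qsub by blast+
      then have "k = l" using assms(2) k(1) l(1) unfolding disjoint_family_on_def by blast
      then show ?thesis using k l Qdisj by blast
    qed
    then show ?thesis unfolding disjoint_family_on_def by blast
  qed
  ultimately obtain f L where f: "L-lipschitz_on UNIV f"
    "\<And>x. x \<notin> (\<Union>n. P n) \<Longrightarrow> f differentiable (at x)"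
    "\<And>n. \<exists>c>0. \<forall>x\<in>P n. \<forall>e\<in>null_dirs (P n) x. \<forall>y. norm e = 1 \<longrightarrow> 0 \<le> e \<bullet> y \<longrightarrow> oscillates f x y (c * (e \<bullet> y))"
    using countable_pieces_function[of P] by metis
  have main: "\<exists>c>0. \<forall>e\<in>null_dirs (E k) x. \<forall>y. norm e = 1 \<longrightarrow> 0 \<le> e \<bullet> y \<longrightarrow> oscillates f x y (c * (e \<bullet> y))"
    if k: "k \<in> I" "x \<in> E k" for k x
  proof -
    obtain j where j: "x \<in> Q k j" using Qcov[OF k] by blast
    have "null_dirs (E k) x \<subseteq> null_dirs (Q k j) x" by (rule null_dirs_antimono[OF Qsub[OF k(1)]])
    then show ?thesis using f(3)[of "prod_encode (to_nat_on I k, j)"] j unfolding Pcode[OF k(1)] by blast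
  qed
  show ?thesis
  proof (rule exI[of _ f], intro conjI allI impI ballI)
    show "\<exists>L. L-lipschitz_on UNIV f" using f(1) by blast
  next
    fix x assume "x \<notin> (\<Union>k\<in>I. E k)"
    then have "x \<notin> (\<Union>n. P n)" using Pfrom Qsub by blast
    then show "f differentiable (at x)" by (rule f(2))
  next
    fix k x assume k: "k \<in> I" "x \<in> E k"
    obtain c where c: "c > 0" "\<And>e y. e \<in> null_dirs (E k) x \<Longrightarrow> norm e = 1 \<Longrightarrow> 0 \<le> e \<bullet> y \<Longrightarrow> oscillates f x y (c * (e \<bullet> y))"
      using main[OF k] by blast
    show "\<exists>c>0. \<forall>y. upper_dir_deriv f x y - lower_dir_deriv f x y
                    \<ge> ereal c * (SUP e \<in> null_dirs (E k) x \<inter> cball 0 1. ereal (e \<bullet> y))"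
    proof (intro exI[of _ c] conjI c(1) allI)
      fix y
      obtain u l where ul: "upper_dir_deriv f x y = ereal u" "lower_dir_deriv f x y = ereal l" "l \<le> u"
        using dir_derivs_finite[OF f(1)] by blast
      \<comment> \<open>Nonpositive values are covered by \<open>l \<le> u\<close>. For a positive
        value, normalising \<open>e\<close> within the unit ball can only increase the
        product.\<close>
      have "e \<bullet> y \<le> (u - l) / c" if e: "e \<in> null_dirs (E k) x" "norm e \<le> 1" for e
      proof (cases "e \<bullet> y \<le> 0")
        case True
        then show ?thesis using ul(3) c(1) by (meson diff_ge_0_iff_ge divide_nonneg_pos order_trans)
      next
        case False
        then have e0: "e \<noteq> 0" by auto
        define d where "d = (1 / norm e) *\<^sub>R e"
        have d: "d \<in> null_dirs (E k) x" "norm d = 1" using null_dirs_normalize[OF e(1) e0] e0 by (simp_all add: d_def)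
        have le: "e \<bullet> y \<le> d \<bullet> y"
        proof -
          have "norm e * (e \<bullet> y) \<le> 1 * (e \<bullet> y)" using e(2) False by (intro mult_right_mono) auto
          then show ?thesis using e0 by (simp add: d_def field_simps)
        qed
        have "c * (d \<bullet> y) \<le> u - l"
          by (rule oscillates_dir_derivs[OF c(2)[OF d] ul(1,2)]) (use le False in simp)
        then have "d \<bullet> y \<le> (u - l) / c" using c(1) by (simp add: field_simps)
        then show ?thesis using le by simp
      qed
      then have "(SUP e \<in> null_dirs (E k) x \<inter> cball 0 1. ereal (e \<bullet> y)) \<le> ereal ((u - l) / c)"
        by (intro SUP_least) auto
      then have "ereal c * (SUP e \<in> null_dirs (E k) x \<inter> cball 0 1. ereal (e \<bullet> y)) \<le> ereal c * ereal ((u - l) / c)"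
        using c(1) by (intro ereal_mult_left_mono) auto
      then show "ereal c * (SUP e \<in> null_dirs (E k) x \<inter> cball 0 1. ereal (e \<bullet> y)) \<le> upper_dir_deriv f x y - lower_dir_deriv f x y"
        using c(1) by (simp add: ul)
    qed
    have "null_dirs (E k) x \<noteq> {0}" using assms(4)[OF k(1)] k(2) by (simp add: cone_unrectifiable_def)
    then obtain e where e: "e \<in> null_dirs (E k) x" "e \<noteq> 0" using zero_in_null_dirs by blast
    define d where "d = (1 / norm e) *\<^sub>R e"
    have d: "d \<in> null_dirs (E k) x" "norm d = 1" using null_dirs_normalize[OF e] e(2) by (simp_all add: d_def)
    \<comment> \<open>Testing along the unit null direction itself gives a positive gap.\<close>
    have "oscillates f x d (c * (d \<bullet> d))" by (rule c(2)[OF d]) simp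
    moreover have "c * (d \<bullet> d) > 0" using c(1) d(2) by (simp add: dot_square_norm)
    ultimately show "\<not> f differentiable (at x)" by (rule oscillates_not_differentiable)
  qed
qed

end
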